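(* In the game $G_{\mathbb O}$ described in the context, there exists a strategy $\mathcal S_{\mathsf{PHP}}$ winning for the player $P_{\mathsf{PHP}}$, i.e. such that the resulting expansion $\mathbb I_\triangleleft$ satisfies $\mathsf{PHP}(\Delta^b_1(\triangleleft))$.
   Context: Setup: $\mathbb M$ is a countable nonstandard model of true arithmetic in the language $\{0,1,+,\cdot,|\cdot|,\lfloor\cdot/2\rfloor,\#,\le\}$ ($|x|$ bit length, $x\#y=2^{|x||y|}$). Fix a nonstandard $n\in\mathbb M$; $[0,\dots,n)=\{0,\dots,n-1\}$. $\mathbb I$ is the substructure of $\mathbb M$ with domain $\{m:m\le2^{|n|^c}$ for some standard $c\}$. "Definable" means definable in $\mathbb M$ with parameters. Conditions: $\mathbb O$ is the set of sequences (in $\mathbb M$) of distinct numbers from $[0,\dots,n)$ of length at most $|n|^c$ for some standard $c$. Each $o\in\mathbb O$ induces a strict order $\triangleleft_o$ on its set of entries $\mathrm{el}(o)$, ordered as listed. $o'\preceq o$ ($o'$ extends $o$) if $\triangleleft_{o'}\supseteq\triangleleft_o$. Game $G_{\mathbb O}$: players $P_{\mathsf{MIN}},P_{\mathsf{IND}},P_{\mathsf{PHP}}$ play at stages $k\equiv0,1,2\pmod3$ respectively, countably many stages; $o_0$ is empty; at stage $k$ the player receives $o_k$ and chooses $o_{k+1}\in\mathbb O$, $o_{k+1}\preceq o_k$. A strategy is a function $\mathcal S:\mathbb O\to\mathbb O$ with $\mathcal S(o)\preceq o$. A play yields $\triangleleft=\bigcup_i\triangleleft_{o_i}$, and $\mathbb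 I_\triangleleft$ is $\mathbb I$ expanded by this interpretation of the symbol $\triangleleft$. The goal of $P_{\mathsf{MIN}}$ is that $\triangleleft$ be a strict linear order of $[0,\dots,n)$ with no least element; the goal of $P_{\mathsf{IND}}$ is that $\mathbb I_\triangleleft$ satisfy induction for $\Sigma^b_1(\triangleleft)$ formulas; the goal of $P_{\mathsf{PHP}}$ is that $\mathbb I_\triangleleft\models\mathsf{PHP}(\Delta^b_1(\triangleleft))$. A strategy is winning if the corresponding goal is achieved regardless of how the other players play. Formula classes: $\Sigma^b_1(\triangleleft)$ is the smallest class containing sharply bounded formulas (quantifiers bounded by $|t|$) of the language with $\triangleleft$ and closed under $\land,\lor$, sharply bounded quantifiers, and bounded existential quantifiers $\exists x\le t$. $\mathsf{S}^1_2(\triangleleft)$ is Buss's $\mathsf{BASIC}$ plus polynomial induction ($\varphi(0)\land\forall x(\varphi(\lfloor x/2\rfloor)\to\varphi(x))\to\forall x\varphi(x)$) for $\Sigma^b_1(\triangleleft)$ formulas. $\varphi$ is $\Delta^b_1(\triangleleft)$ if $\varphi\in\Sigma^b_1(\triangleleft)$ and $\mathsf{S}^1_2(\triangleleft)\vdash\varphi\leftrightarrow\neg\psi$ for some $\psi\in\Sigma^b_1(\triangleleft)$. $\mathsf{PHP}(\varphi(x,y,\bar z))$ is $\forall\bar z\forall u,v(u>v\to[\exists x<u\forall y<v\neg\varphi\ \lor\ \exists x\ne x'<u\,\exists y<v(\varphi(x,y,\bar z)\land\varphi(x',y,\bar z))\ \lor\ \exists x<u\,\exists y\ne y'<v(\varphi(x,y,\bar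 z)\land\varphi(x,y',\bar z))])$; $\mathsf{PHP}(\Delta^b_1(\triangleleft))$ is the set of these for all $\Delta^b_1(\triangleleft)$ formulas $\varphi$. *)

theory Defs
  imports Main "HOL-Library.Countable_Set" "HOL-Library.FuncSet" "HOL-Library.Log_Nat"
begin

section \<open>Syntax\<close>

text \<open>Terms and formulas use de Bruijn indices: below k binders, \<open>Var i\<close> with \<open>i < k\<close> is bound and
  \<open>Var (k + j)\<close> is the free variable number j.  \<open>Prec\<close> is the symbol for the strict order.\<close>

datatype tm = Var nat | Zero | One | Add tm tm | Mul tm tm | Len tm | Half tm | Smash tm tm

datatype fm = Eq tm tm | Le tm tm | Prec tm tm
  | Neg fm | And fm fm | Or fm fm | Imp fm fm | Forall fm | Exists fm

primrec tsubst :: "(nat \<Rightarrow> tm) \<Rightarrow> tm \<Rightarrow> tm" where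
  "tsubst \<sigma> (Var i) = \<sigma> i"
| "tsubst \<sigma> Zero = Zero"
| "tsubst \<sigma> One = One"
| "tsubst \<sigma> (Add s t) = Add (tsubst \<sigma> s) (tsubst \<sigma> t)"
| "tsubst \<sigma> (Mul s t) = Mul (tsubst \<sigma> s) (tsubst \<sigma> t)"
| "tsubst \<sigma> (Len s) = Len (tsubst \<sigma> s)"
| "tsubst \<sigma> (Half s) = Half (tsubst \<sigma> s)"
| "tsubst \<sigma> (Smash s t) = Smash (tsubst \<sigma> s) (tsubst \<sigma> t)"

definition tlift :: "tm \<Rightarrow> tm" where
  "tlift = tsubst (\<lambda>i. Var (Suc i))"

definition up :: "(nat \<Rightarrow> tm) \<Rightarrow> nat \<Rightarrow> tm" where
  "up \<sigma> = case_nat (Var 0) (\<lambda>i. tlift (\<sigma> i))"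

primrec subst :: "(nat \<Rightarrow> tm) \<Rightarrow> fm \<Rightarrow> fm" where
  "subst \<sigma> (Eq s t) = Eq (tsubst \<sigma> s) (tsubst \<sigma> t)"
| "subst \<sigma> (Le s t) = Le (tsubst \<sigma> s) (tsubst \<sigma> t)"
| "subst \<sigma> (Prec s t) = Prec (tsubst \<sigma> s) (tsubst \<sigma> t)"
| "subst \<sigma> (Neg p) = Neg (subst \<sigma> p)"
| "subst \<sigma> (And p q) = And (subst \<sigma> p) (subst \<sigma> q)"
| "subst \<sigma> (Or p q) = Or (subst \<sigma> p) (subst \<sigma> q)"
| "subst \<sigma> (Imp p q) = Imp (subst \<sigma> p) (subst \<sigma> q)"
| "subst \<sigma> (Forall p) = Forall (subst (up \<sigma>) p)"
| "subst \<sigma> (Exists p) = Exists (subst (up \<sigma>) p)"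

definition lift :: "fm \<Rightarrow> fm" where
  "lift = subst (\<lambda>i. Var (Suc i))"

text \<open>\<open>inst t p\<close> removes the free variable 0 (replacing it by t) and renumbers the others;
  \<open>subst0 t p\<close> replaces the free variable 0 by t and keeps the numbering.\<close>

definition inst :: "tm \<Rightarrow> fm \<Rightarrow> fm" where
  "inst t = subst (case_nat t Var)"

definition subst0 :: "tm \<Rightarrow> fm \<Rightarrow> fm" where
  "subst0 t = subst (Var(0 := t))"

definition Iff :: "fm \<Rightarrow> fm \<Rightarrow> fm" where
  "Iff p q = And (Imp p q) (Imp q p)"

definition Lt :: "tm \<Rightarrow> tm \<Rightarrow> fm" where
  "Lt s t = And (Le s t) (Neg (Eq s t))"

definition Forall_le :: "tm \<Rightarrow> fm \<Rightarrow> fm" where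
  "Forall_le t p = Forall (Imp (Le (Var 0) (tlift t)) p)"

definition Exists_le :: "tm \<Rightarrow> fm \<Rightarrow> fm" where
  "Exists_le t p = Exists (And (Le (Var 0) (tlift t)) p)"

definition Forall_lt :: "tm \<Rightarrow> fm \<Rightarrow> fm" where
  "Forall_lt t p = Forall (Imp (Lt (Var 0) (tlift t)) p)"

definition Exists_lt :: "tm \<Rightarrow> fm \<Rightarrow> fm" where
  "Exists_lt t p = Exists (And (Lt (Var 0) (tlift t)) p)"

primrec prec_free :: "fm \<Rightarrow> bool" where
  "prec_free (Eq s t) = True"
| "prec_free (Le s t) = True"
| "prec_free (Prec s t) = False"
| "prec_free (Neg p) = prec_free p"
| "prec_free (And p q) = (prec_free p \<and> prec_free q)"
| "prec_free (Or p q) = (prec_free p \<and> prec_free q)"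
| "prec_free (Imp p q) = (prec_free p \<and> prec_free q)"
| "prec_free (Forall p) = prec_free p"
| "prec_free (Exists p) = prec_free p"


section \<open>Structures and satisfaction\<close>

record 'a arith =
  carr :: "'a set"
  zero :: 'a
  one :: 'a
  add :: "'a \<Rightarrow> 'a \<Rightarrow> 'a"
  mul :: "'a \<Rightarrow> 'a \<Rightarrow> 'a"
  len :: "'a \<Rightarrow> 'a"
  half :: "'a \<Rightarrow> 'a"
  smash :: "'a \<Rightarrow> 'a \<Rightarrow> 'a"
  le :: "'a \<Rightarrow> 'a \<Rightarrow> bool"

definition is_structure :: "'a arith \<Rightarrow> bool" where
  "is_structure A \<longleftrightarrow> zero A \<in> carr A \<and> one A \<in> carr A \<and>
    (\<forall>x\<in>carr A. len A x \<in> carr A \<and> half A x \<in> carr A) \<and>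
    (\<forall>x\<in>carr A. \<forall>y\<in>carr A. add A x y \<in> carr A \<and> mul A x y \<in> carr A \<and> smash A x y \<in> carr A)"

primrec tval :: "'a arith \<Rightarrow> (nat \<Rightarrow> 'a) \<Rightarrow> tm \<Rightarrow> 'a" where
  "tval A e (Var i) = e i"
| "tval A e Zero = zero A"
| "tval A e One = one A"
| "tval A e (Add s t) = add A (tval A e s) (tval A e t)"
| "tval A e (Mul s t) = mul A (tval A e s) (tval A e t)"
| "tval A e (Len s) = len A (tval A e s)"
| "tval A e (Half s) = half A (tval A e s)"
| "tval A e (Smash s t) = smash A (tval A e s) (tval A e t)"

text \<open>\<open>sat A R e p\<close>: p holds under the valuation e in the expansion of A that interprets
  \<open>Prec\<close> by R.\<close>

primrec sat :: "'a arith \<Rightarrow> ('a \<times> 'a) set \<Rightarrow> (nat \<Rightarrow> 'a) \<Rightarrow> fm \<Rightarrow> bool" where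
  "sat A R e (Eq s t) \<longleftrightarrow> tval A e s = tval A e t"
| "sat A R e (Le s t) \<longleftrightarrow> le A (tval A e s) (tval A e t)"
| "sat A R e (Prec s t) \<longleftrightarrow> (tval A e s, tval A e t) \<in> R"
| "sat A R e (Neg p) \<longleftrightarrow> \<not> sat A R e p"
| "sat A R e (And p q) \<longleftrightarrow> sat A R e p \<and> sat A R e q"
| "sat A R e (Or p q) \<longleftrightarrow> sat A R e p \<or> sat A R e q"
| "sat A R e (Imp p q) \<longleftrightarrow> (sat A R e p \<longrightarrow> sat A R e q)"
| "sat A R e (Forall p) \<longleftrightarrow> (\<forall>a\<in>carr A. sat A R (case_nat a e) p)"
| "sat A R e (Exists p) \<longleftrightarrow> (\<exists>a\<in>carr A. sat A R (case_nat a e) p)"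

text \<open>Free variables are read as universally quantified, so \<open>models\<close> speaks about the universal
  closure of p; in \<open>true_arithmetic\<close> below this covers exactly the sentences.\<close>

definition models :: "'a arith \<Rightarrow> ('a \<times> 'a) set \<Rightarrow> fm \<Rightarrow> bool" where
  "models A R p \<longleftrightarrow> (\<forall>e. range e \<subseteq> carr A \<longrightarrow> sat A R e p)"

definition std :: "nat arith" where
  "std = \<lparr>carr = UNIV, zero = 0, one = 1, add = (+), mul = (*), len = floorlog 2,
          half = (\<lambda>x. x div 2), smash = (\<lambda>x y. 2 ^ (floorlog 2 x * floorlog 2 y)), le = (\<le>)\<rparr>"

text \<open>Models of true arithmetic; the relation \<open>{}\<close> is a dummy, as p does not mention \<open>Prec\<close>.\<close>

definition true_arithmetic :: "'a arith \<Rightarrow> bool" where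
  "true_arithmetic M \<longleftrightarrow> is_structure M \<and>
    (\<forall>p. prec_free p \<longrightarrow> models std {} p \<longrightarrow> models M {} p)"

primrec numeral_val :: "'a arith \<Rightarrow> nat \<Rightarrow> 'a" where
  "numeral_val M 0 = zero M"
| "numeral_val M (Suc k) = add M (numeral_val M k) (one M)"

definition nonstandard :: "'a arith \<Rightarrow> 'a \<Rightarrow> bool" where
  "nonstandard M a \<longleftrightarrow> a \<in> carr M \<and> a \<notin> range (numeral_val M)"

definition nonstandard_model :: "'a arith \<Rightarrow> bool" where
  "nonstandard_model M \<longleftrightarrow> (\<exists>a. nonstandard M a)"


section \<open>The theory S12 and its provability relation\<close>

inductive sharply_bounded :: "fm \<Rightarrow> bool" where
  "sharply_bounded (Eq s t)"
| "sharply_bounded (Le s t)"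
| "sharply_bounded (Prec s t)"
| "sharply_bounded p \<Longrightarrow> sharply_bounded (Neg p)"
| "sharply_bounded p \<Longrightarrow> sharply_bounded q \<Longrightarrow> sharply_bounded (And p q)"
| "sharply_bounded p \<Longrightarrow> sharply_bounded q \<Longrightarrow> sharply_bounded (Or p q)"
| "sharply_bounded p \<Longrightarrow> sharply_bounded q \<Longrightarrow> sharply_bounded (Imp p q)"
| "sharply_bounded p \<Longrightarrow> sharply_bounded (Forall_le (Len t) p)"
| "sharply_bounded p \<Longrightarrow> sharply_bounded (Exists_le (Len t) p)"

inductive Sigma_b1 :: "fm \<Rightarrow> bool" where
  "sharply_bounded p \<Longrightarrow> Sigma_b1 p"
| "Sigma_b1 p \<Longrightarrow> Sigma_b1 q \<Longrightarrow> Sigma_b1 (And p q)"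
| "Sigma_b1 p \<Longrightarrow> Sigma_b1 q \<Longrightarrow> Sigma_b1 (Or p q)"
| "Sigma_b1 p \<Longrightarrow> Sigma_b1 (Forall_le (Len t) p)"
| "Sigma_b1 p \<Longrightarrow> Sigma_b1 (Exists_le (Len t) p)"
| "Sigma_b1 p \<Longrightarrow> Sigma_b1 (Exists_le t p)"

abbreviation Succ :: "tm \<Rightarrow> tm" where
  "Succ t \<equiv> Add t One"

abbreviation Dbl :: "tm \<Rightarrow> tm" where
  "Dbl t \<equiv> Mul (Add One One) t"

text \<open>The 32 open axioms of BASIC (Buss, Bounded Arithmetic, 1986), in the original order.  Buss's successor
  Sx is rendered as x + 1, and his S0 as the constant 1.\<close>

definition BASIC :: "fm set" where
  "BASIC = (let x = Var 0; y = Var 1; z = Var 2; u = Var 3; v = Var 4 in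
   {Imp (Le y x) (Le y (Succ x)),
    Neg (Eq x (Succ x)),
    Le Zero x,
    Iff (And (Le x y) (Neg (Eq x y))) (Le (Succ x) y),
    Imp (Neg (Eq x Zero)) (Neg (Eq (Dbl x) Zero)),
    Or (Le y x) (Le x y),
    Imp (And (Le x y) (Le y x)) (Eq x y),
    Imp (And (Le x y) (Le y z)) (Le x z),
    Eq (Len Zero) Zero,
    Imp (Neg (Eq x Zero))
      (And (Eq (Len (Dbl x)) (Succ (Len x))) (Eq (Len (Succ (Dbl x))) (Succ (Len x)))),
    Eq (Len One) One,
    Imp (Le x y) (Le (Len x) (Len y)),
    Eq (Len (Smash x y)) (Succ (Mul (Len x) (Len y))),
    Eq (Smash Zero y) One,
    Imp (Neg (Eq x Zero))
      (And (Eq (Smash One (Dbl x)) (Dbl (Smash One x)))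
           (Eq (Smash One (Succ (Dbl x))) (Dbl (Smash One x)))),
    Eq (Smash x y) (Smash y x),
    Imp (Eq (Len x) (Len y)) (Eq (Smash x z) (Smash y z)),
    Imp (Eq (Len x) (Add (Len u) (Len v))) (Eq (Smash x y) (Mul (Smash u y) (Smash v y))),
    Le x (Add x y),
    Imp (And (Le x y) (Neg (Eq x y)))
      (And (Le (Succ (Dbl x)) (Dbl y)) (Neg (Eq (Succ (Dbl x)) (Dbl y)))),
    Eq (Add x y) (Add y x),
    Eq (Add x Zero) x,
    Eq (Add x (Succ y)) (Succ (Add x y)),
    Eq (Add (Add x y) z) (Add x (Add y z)),
    Iff (Le (Add x y) (Add x z)) (Le y z),
    Eq (Mul x Zero) Zero,
    Eq (Mul x (Succ y)) (Add (Mul x y) x),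
    Eq (Mul x y) (Mul y x),
    Eq (Mul x (Add y z)) (Add (Mul x y) (Mul x z)),
    Imp (Le One x) (Iff (Le (Mul x y) (Mul x z)) (Le y z)),
    Imp (Neg (Eq x Zero)) (Eq (Len x) (Succ (Len (Half x)))),
    Iff (Eq x (Half y)) (Or (Eq (Dbl x) y) (Eq (Succ (Dbl x)) y))})"

text \<open>Polynomial induction on the free variable 0 of p; the other free variables are parameters.\<close>

definition PIND :: "fm \<Rightarrow> fm" where
  "PIND p = Imp (And (inst Zero p) (Forall (Imp (subst0 (Half (Var 0)) p) p))) (Forall p)"

definition S12 :: "fm set" where
  "S12 = BASIC \<union> PIND ` {p. Sigma_b1 p}"

text \<open>Hilbert calculus with equality.  The rule \<open>Gen\<close> makes free variables in the axioms T and in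
  theorems implicitly universally quantified.\<close>

primrec prop_eval :: "(fm \<Rightarrow> bool) \<Rightarrow> fm \<Rightarrow> bool" where
  "prop_eval \<nu> (Eq s t) = \<nu> (Eq s t)"
| "prop_eval \<nu> (Le s t) = \<nu> (Le s t)"
| "prop_eval \<nu> (Prec s t) = \<nu> (Prec s t)"
| "prop_eval \<nu> (Neg p) = (\<not> prop_eval \<nu> p)"
| "prop_eval \<nu> (And p q) = (prop_eval \<nu> p \<and> prop_eval \<nu> q)"
| "prop_eval \<nu> (Or p q) = (prop_eval \<nu> p \<or> prop_eval \<nu> q)"
| "prop_eval \<nu> (Imp p q) = (prop_eval \<nu> p \<longrightarrow> prop_eval \<nu> q)"
| "prop_eval \<nu> (Forall p) = \<nu> (Forall p)"
| "prop_eval \<nu> (Exists p) = \<nu> (Exists p)"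

definition tautology :: "fm \<Rightarrow> bool" where
  "tautology p \<longleftrightarrow> (\<forall>\<nu>. prop_eval \<nu> p)"

inductive provable :: "fm set \<Rightarrow> fm \<Rightarrow> bool" for T :: "fm set" where
  Ax: "p \<in> T \<Longrightarrow> provable T p"
| Taut: "tautology p \<Longrightarrow> provable T p"
| Forall_inst: "provable T (Imp (Forall p) (inst t p))"
| Forall_dist: "provable T (Imp (Forall (Imp (lift q) p)) (Imp q (Forall p)))"
| Exists_inst: "provable T (Imp (inst t p) (Exists p))"
| Exists_elim: "provable T (Imp (Forall (Imp p (lift q))) (Imp (Exists p) q))"
| Eq_refl: "provable T (Eq t t)"
| Eq_subst: "provable T (Imp (Eq s t) (Imp (inst s p) (inst t p)))"
| MP: "provable T (Imp p q) \<Longrightarrow> provable T p \<Longrightarrow> provable T q"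
| Gen: "provable T p \<Longrightarrow> provable T (Forall p)"

definition Delta_b1 :: "fm \<Rightarrow> bool" where
  "Delta_b1 p \<longleftrightarrow> Sigma_b1 p \<and> (\<exists>q. Sigma_b1 q \<and> provable S12 (Iff p (Neg q)))"


section \<open>The pigeonhole principle\<close>

text \<open>In p, the free variables 0 and 1 play the roles of x and y, all others are parameters.
  \<open>apply2 k s t p\<close> is p(s, t, parameters), to be used below k binders.\<close>

definition apply2 :: "nat \<Rightarrow> tm \<Rightarrow> tm \<Rightarrow> fm \<Rightarrow> fm" where
  "apply2 k s t = subst (case_nat s (case_nat t (\<lambda>j. Var (j + k))))"

text \<open>\<open>PHP p\<close> is left open in the parameters.  Outermost binder u, then v; below these, u and v are
  \<open>Var 1\<close> and \<open>Var 0\<close>, and every further quantifier raises both indices by one.\<close>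

definition PHP :: "fm \<Rightarrow> fm" where
  "PHP p = Forall (Forall (Imp (Lt (Var 0) (Var 1)) (Or
     (Exists_lt (Var 1) (Forall_lt (Var 1) (Neg (apply2 4 (Var 1) (Var 0) p)))) (Or
     (Exists_lt (Var 1) (Exists_lt (Var 2) (And (Neg (Eq (Var 1) (Var 0)))
        (Exists_lt (Var 2) (And (apply2 5 (Var 2) (Var 0) p) (apply2 5 (Var 1) (Var 0) p))))))
     (Exists_lt (Var 1) (Exists_lt (Var 1) (Exists_lt (Var 2) (And (Neg (Eq (Var 1) (Var 0)))
        (And (apply2 5 (Var 2) (Var 1) p) (apply2 5 (Var 2) (Var 0) p))))))))))"

lemma tval_tsubst: "tval A e (tsubst \<sigma> t) = tval A (\<lambda>i. tval A e (\<sigma> i)) t"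
  by (induction t) simp_all

lemma tval_tlift [simp]: "tval A (case_nat a e) (tlift t) = tval A e t"
  by (simp add: tlift_def tval_tsubst)

lemma tval_up: "(\<lambda>i. tval A (case_nat a e) (up \<sigma> i)) = case_nat a (\<lambda>i. tval A e (\<sigma> i))"
  by (auto simp: up_def split: nat.split)

lemma sat_subst: "sat A R e (subst \<sigma> p) \<longleftrightarrow> sat A R (\<lambda>i. tval A e (\<sigma> i)) p"
  by (induction p arbitrary: \<sigma> e) (simp_all add: tval_tsubst tval_up)

lemma sat_apply2: "sat A R e (apply2 k s t p) \<longleftrightarrow>
    sat A R (case_nat (tval A e s) (case_nat (tval A e t) (\<lambda>j. e (j + k)))) p"
  unfolding apply2_def sat_subst by (rule arg_cong[where f = "\<lambda>e. sat A R e p"]) (auto split: nat.split)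

lemma sat_PHP:
  "sat A R e (PHP p) \<longleftrightarrow>
    (let lt = (\<lambda>a b. le A a b \<and> a \<noteq> b); \<phi> = (\<lambda>x y. sat A R (case_nat x (case_nat y e)) p) in
     \<forall>u\<in>carr A. \<forall>v\<in>carr A. lt v u \<longrightarrow>
       (\<exists>x\<in>carr A. lt x u \<and> (\<forall>y\<in>carr A. lt y v \<longrightarrow> \<not> \<phi> x y)) \<or>
       (\<exists>x\<in>carr A. lt x u \<and> (\<exists>x'\<in>carr A. lt x' u \<and> x \<noteq> x' \<and>
          (\<exists>y\<in>carr A. lt y v \<and> \<phi> x y \<and> \<phi> x' y))) \<or>
       (\<exists>x\<in>carr A. lt x u \<and> (\<exists>y\<in>carr A. lt y v \<and> (\<exists>y'\<in>carr A. lt y' v \<and> y \<noteq> y' \<and>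
          \<phi> x y \<and> \<phi> x y'))))"
  by (simp add: PHP_def Exists_lt_def Forall_lt_def Lt_def sat_apply2 Let_def eval_nat_numeral)


section \<open>The cut I\<close>

primrec pow :: "'a arith \<Rightarrow> 'a \<Rightarrow> nat \<Rightarrow> 'a" where
  "pow M a 0 = one M"
| "pow M a (Suc c) = mul M (pow M a c) a"

text \<open>\<open>exp2 M k p\<close> says that p is 2 to the k in M: if x has length k then 1 # x is 2 to the
  |1| * |x| = k.\<close>

definition exp2 :: "'a arith \<Rightarrow> 'a \<Rightarrow> 'a \<Rightarrow> bool" where
  "exp2 M k p \<longleftrightarrow> (\<exists>x\<in>carr M. len M x = k \<and> p = smash M (one M) x)"

definition cut :: "'a arith \<Rightarrow> 'a \<Rightarrow> 'a arith" where
  "cut M n = M\<lparr>carr := {m \<in> carr M. \<exists>c p. exp2 M (pow M (len M n) c) p \<and> le M m p}\<rparr>"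


section \<open>Conditions\<close>

definition below :: "'a arith \<Rightarrow> 'a \<Rightarrow> 'a set" where
  "below M b = {a \<in> carr M. le M a b \<and> a \<noteq> b}"

text \<open>A sequence of length l is a pair (l, s) with s a function on the numbers below l (and
  \<open>undefined\<close> elsewhere).  It is a sequence in M if it has a code in M.  We use Goedel's beta
  function: the entry with index i is the remainder of a modulo 1 + (i + 1) b.\<close>

type_synonym 'a seq = "'a \<times> ('a \<Rightarrow> 'a)"

definition beta :: "'a arith \<Rightarrow> 'a \<Rightarrow> 'a \<Rightarrow> 'a \<Rightarrow> 'a \<Rightarrow> bool" where
  "beta M a b i r \<longleftrightarrow>
    (let d = add M (one M) (mul M (add M i (one M)) b)
     in r \<in> below M d \<and> (\<exists>q\<in>carr M. a = add M (mul M q d) r))"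

definition internal_seqs :: "'a arith \<Rightarrow> 'a seq set" where
  "internal_seqs M = {(l, s). l \<in> carr M \<and> s \<in> extensional (below M l) \<and>
     (\<exists>a\<in>carr M. \<exists>b\<in>carr M. \<forall>i\<in>below M l. beta M a b i (s i))}"

definition conditions :: "'a arith \<Rightarrow> 'a \<Rightarrow> 'a seq set" where
  "conditions M n = {(l, s) \<in> internal_seqs M.
     s ` below M l \<subseteq> below M n \<and> inj_on s (below M l) \<and> (\<exists>c. le M l (pow M (len M n) c))}"

definition prec :: "'a arith \<Rightarrow> 'a seq \<Rightarrow> ('a \<times> 'a) set" where
  "prec M = (\<lambda>(l, s). {(s i, s j) | i j. j \<in> below M l \<and> i \<in> below M j})"

definition extends :: "'a arith \<Rightarrow> 'a seq \<Rightarrow> 'a seq \<Rightarrow> bool" where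
  "extends M o1 o0 \<longleftrightarrow> prec M o0 \<subseteq> prec M o1"

definition empty_seq :: "'a arith \<Rightarrow> 'a seq" where
  "empty_seq M = (zero M, \<lambda>_. undefined)"


section \<open>The game\<close>

datatype player = P_MIN | P_IND | P_PHP

definition mover :: "nat \<Rightarrow> player" where
  "mover k = (if k mod 3 = 0 then P_MIN else if k mod 3 = 1 then P_IND else P_PHP)"

definition play :: "'a arith \<Rightarrow> 'a \<Rightarrow> (nat \<Rightarrow> 'a seq) \<Rightarrow> bool" where
  "play M n os \<longleftrightarrow> os 0 = empty_seq M \<and>
     (\<forall>k. os (Suc k) \<in> conditions M n \<and> extends M (os (Suc k)) (os k))"

definition strategy :: "'a arith \<Rightarrow> 'a \<Rightarrow> ('a seq \<Rightarrow> 'a seq) \<Rightarrow> bool" where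
  "strategy M n S \<longleftrightarrow> (\<forall>os\<in>conditions M n. S os \<in> conditions M n \<and> extends M (S os) os)"

definition follows :: "player \<Rightarrow> ('a seq \<Rightarrow> 'a seq) \<Rightarrow> (nat \<Rightarrow> 'a seq) \<Rightarrow> bool" where
  "follows P S os \<longleftrightarrow> (\<forall>k. mover k = P \<longrightarrow> os (Suc k) = S (os k))"

definition outcome :: "'a arith \<Rightarrow> (nat \<Rightarrow> 'a seq) \<Rightarrow> ('a \<times> 'a) set" where
  "outcome M os = (\<Union>k. prec M (os k))"

definition winning ::
  "'a arith \<Rightarrow> 'a \<Rightarrow> player \<Rightarrow> (('a \<times> 'a) set \<Rightarrow> bool) \<Rightarrow> ('a seq \<Rightarrow> 'a seq) \<Rightarrow> bool" where
  "winning M n P goal S \<longleftrightarrow> (\<forall>os. play M n os \<and> follows P S os \<longrightarrow> goal (outcome M os))"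

definition goal_PHP :: "'a arith \<Rightarrow> 'a \<Rightarrow> ('a \<times> 'a) set \<Rightarrow> bool" where
  "goal_PHP M n R \<longleftrightarrow> (\<forall>p. Delta_b1 p \<longrightarrow> models (cut M n) R (PHP p))"

end

theory Submission
  imports Defs "HOL-Number_Theory.Cong"
begin

text \<open>A condition forces a formula if the formula holds over every total order of the numbers below n that
  is coded in M and extends the condition.  The player's strategy meets, one by one, countably many dense
  requirements, always extending towards the first unmet one.  The requirements make the truth of
  \<open>\<Sigma>\<^sup>b\<^sub>1\<close> formulas in the cut coincide with being forced by some condition of the
  play, and they refute each instance of the pigeonhole principle for a \<open>\<Delta>\<^sup>b\<^sub>1\<close> formula.
  Their density is a combinatorial statement about finite linear orders, proved in the natural numbers and
  transferred to M as a sentence of true arithmetic.  Its heart is that a true \<open>\<Sigma>\<^sup>b\<^sub>1\<close>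
  formula is certified by the order on polylogarithmically many points, and that by the soundness of
  \<open>S12\<close> both a \<open>\<Delta>\<^sup>b\<^sub>1\<close> formula and its negation have such
  certificates.\<close>

section \<open>Finite linear orders\<close>

text \<open>The union of the conditions of a play need not be coded in M, so true arithmetic says
  nothing about it directly. Forcing therefore quantifies over coded total orders only, where
  formulas keep their classical meaning and where \<open>Prec\<close> can be replaced by the
  relation that a code defines. What is transferred is one sentence per formula and per exponent c
  bounding the parameters; hence every bound on certificates has the form |n|^d with d chosen before
  n. This also keeps the lengths of conditions polylogarithmic.

  A second obstacle: a sharply bounded quantifier may still range over infinitely many elements of
  M, so its instances cannot be settled one move at a time. It gets a density argument of its own,
  \<open>reach_all_le\<close>.

  For the pigeonhole principle, the certificates of the negation serve to ensure that the next
  certificate collected belongs to a different value. Certificates are first played against each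
  other for one fixed x; the finite pigeonhole principle enters only afterwards, for the resulting
  total map.\<close>

definition lin :: "'b set \<Rightarrow> ('b \<times> 'b) set \<Rightarrow> bool" where
  "lin S r \<longleftrightarrow> r \<subseteq> S \<times> S \<and> strict_linear_order_on S r"

lemma lin_iff: "lin S r \<longleftrightarrow> r \<subseteq> S \<times> S \<and> (\<forall>x y z. (x, y) \<in> r \<longrightarrow> (y, z) \<in> r \<longrightarrow> (x, z) \<in> r) \<and>
    (\<forall>x. (x, x) \<notin> r) \<and> (\<forall>x\<in>S. \<forall>y\<in>S. x \<noteq> y \<longrightarrow> (x, y) \<in> r \<or> (y, x) \<in> r)"
  unfolding lin_def strict_linear_order_on_def trans_def irrefl_def total_on_def by blast

lemma lin_asym: "lin S r \<Longrightarrow> (x, y) \<in> r \<Longrightarrow> (y, x) \<notin> r"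
  unfolding lin_iff by metis

lemma lin_less: "lin (S :: nat set) ({(x, y). x < y} \<inter> S \<times> S)"
  unfolding lin_iff by auto

lemma lin_restrict: "lin S r \<Longrightarrow> W \<subseteq> S \<Longrightarrow> lin W (r \<inter> W \<times> W)"
  unfolding lin_iff by blast

text \<open>The new point b goes into the cut immediately above D; closure of D under predecessors
  is what keeps the result transitive.\<close>

lemma lin_insert:
  assumes "lin T r" "b \<notin> T" "D \<subseteq> T" "\<And>x y. x \<in> D \<Longrightarrow> (y, x) \<in> r \<Longrightarrow> y \<in> D"
  shows "lin (insert b T) (r \<union> D \<times> {b} \<union> {b} \<times> (T - D))"
proof -
  have r: "\<And>x y. (x, y) \<in> r \<Longrightarrow> x \<in> T \<and> y \<in> T" "\<And>x y z. (x, y) \<in> r \<Longrightarrow> (y, z) \<in> r \<Longrightarrow> (x, z) \<in> r"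
    "\<And>x. (x, x) \<notin> r" "\<And>x y. x \<in> T \<Longrightarrow> y \<in> T \<Longrightarrow> x \<noteq> y \<Longrightarrow> (x, y) \<in> r \<or> (y, x) \<in> r"
    using assms(1) unfolding lin_iff by blast+
  let ?s = "r \<union> D \<times> {b} \<union> {b} \<times> (T - D)"
  have cross: "(x, y) \<in> r" if "x \<in> D" "y \<in> T - D" for x y
    using r(4)[of x y] assms(3,4) that by blast
  have "(x, z) \<in> ?s" if "(x, y) \<in> ?s" "(y, z) \<in> ?s" for x y z
    using that r(1,2) assms(2,3,4) cross by blast
  moreover have "?s \<subseteq> insert b T \<times> insert b T" using r(1) assms(3) by auto
  moreover have "(x, x) \<notin> ?s" for x using r(3) assms(2,3) by blast
  moreover have "(x, y) \<in> ?s \<or> (y, x) \<in> ?s" if "x \<in> insert b T" "y \<in> insert b T" "x \<noteq> y" for x y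
    using that r(4) by blast
  ultimately show ?thesis unfolding lin_iff by meson
qed

definition agree :: "'b set \<Rightarrow> ('b \<times> 'b) set \<Rightarrow> ('b \<times> 'b) set \<Rightarrow> bool" where
  "agree W r s \<longleftrightarrow> (\<forall>x\<in>W. \<forall>y\<in>W. (x, y) \<in> r \<longleftrightarrow> (x, y) \<in> s)"

lemma agree_refl: "agree W r r"
  by (simp add: agree_def)

lemma agree_sym: "agree W r s \<Longrightarrow> agree W s r"
  by (simp add: agree_def)

lemma agree_trans: "agree W r s \<Longrightarrow> agree W s t \<Longrightarrow> agree W r t"
  by (simp add: agree_def)

lemma agree_mono: "agree W r s \<Longrightarrow> V \<subseteq> W \<Longrightarrow> agree V r s"
  unfolding agree_def by blast

text \<open>Linear orders have the amalgamation property. The points of \<open>B - A\<close> are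
  inserted into r one at a time, each in the cut that s prescribes relative to the points of B
  already present.\<close>

lemma lin_amalgam:
  assumes "finite B" "lin A r" "lin B s" "agree (A \<inter> B) r s"
  shows "\<exists>t. lin (A \<union> B) t \<and> agree A r t \<and> agree B s t"
proof -
  have s: "\<And>x y. (x, y) \<in> s \<Longrightarrow> x \<in> B \<and> y \<in> B" "\<And>x y z. (x, y) \<in> s \<Longrightarrow> (y, z) \<in> s \<Longrightarrow> (x, z) \<in> s"
    "\<And>x. (x, x) \<notin> s" "\<And>x y. x \<in> B \<Longrightarrow> y \<in> B \<Longrightarrow> x \<noteq> y \<Longrightarrow> (x, y) \<in> s \<or> (y, x) \<in> s"
    using assms(3) unfolding lin_iff by blast+
  have "\<exists>t. lin (A \<union> C) t \<and> agree A r t \<and> agree ((A \<inter> B) \<union> C) s t"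
    if "finite C" "C \<subseteq> B - A" for C
    using that
  proof (induction C rule: finite_induct)
    case empty
    then show ?case using assms(2) agree_refl[of A r] agree_sym[OF assms(4)] by (intro exI[of _ r]) simp
  next
    case (insert b C)
    then obtain t where t: "lin (A \<union> C) t" "agree A r t" "agree ((A \<inter> B) \<union> C) s t"
      by auto
    let ?T = "A \<union> C" and ?E = "(A \<inter> B) \<union> C"
    \<comment> \<open>The downward closure in t of the points of B present so far that s puts below
      b. It picks up no further points of \<open>?E\<close>, because t and s agree there; this is
      \<open>DE\<close>.\<close>
    define D where "D = {z \<in> ?T. \<exists>z'\<in>?E. (z', b) \<in> s \<and> (z = z' \<or> (z, z') \<in> t)}"
    have b: "b \<notin> ?T" "b \<in> B" using insert by auto
    have tr: "\<And>x y z. (x, y) \<in> t \<Longrightarrow> (y, z) \<in> t \<Longrightarrow> (x, z) \<in> t" "\<And>x y. (x, y) \<in> t \<Longrightarrow> x \<in> ?T \<and> y \<in> ?T"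
      using t(1) unfolding lin_iff by blast+
    have EB: "?E \<subseteq> B" "?E \<subseteq> ?T" using insert by auto
    have low: "y \<in> D" if "x \<in> D" "(y, x) \<in> t" for x y
      using that tr unfolding D_def by blast
    have DE: "z \<in> D \<longleftrightarrow> (z, b) \<in> s" if z: "z \<in> ?E" for z
    proof
      assume "z \<in> D"
      then obtain z' where z': "z' \<in> ?E" "(z', b) \<in> s" "z = z' \<or> (z, z') \<in> t" unfolding D_def by blast
      then have "z = z' \<or> (z, z') \<in> s" using t(3) z unfolding agree_def by blast
      then show "(z, b) \<in> s" using z' s(2) by blast
    next
      assume "(z, b) \<in> s" then show "z \<in> D" using z EB(2) unfolding D_def by blast
    qed
    define t' where "t' = t \<union> D \<times> {b} \<union> {b} \<times> (?T - D)"
    have DT: "D \<subseteq> ?T" unfolding D_def by blast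
    then have "lin (insert b ?T) t'" unfolding t'_def by (rule lin_insert[OF t(1) b(1)]) (rule low)
    moreover have t': "(x, y) \<in> t \<longleftrightarrow> (x, y) \<in> t'" if "x \<noteq> b" "y \<noteq> b" for x y
      using that by (auto simp: t'_def)
    moreover have "agree A r t'"
      unfolding agree_def
    proof (intro ballI)
      fix x y assume "x \<in> A" "y \<in> A"
      moreover from this have "x \<noteq> b" "y \<noteq> b" using b by auto
      ultimately show "(x, y) \<in> r \<longleftrightarrow> (x, y) \<in> t'" using t(2) t' by (simp add: agree_def)
    qed
    moreover have "agree (insert b ?E) s t'"
      unfolding agree_def
    proof (intro ballI)
      fix x y assume xy: "x \<in> insert b ?E" "y \<in> insert b ?E"
      have bt: "(b, z) \<notin> t" "(z, b) \<notin> t" for z using tr(2)[of b z] tr(2)[of z b] b(1) by auto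
      consider "x = b" "y = b" | "x = b" "y \<in> ?E" "y \<noteq> b" | "x \<in> ?E" "y = b" "x \<noteq> b"
        | "x \<in> ?E" "y \<in> ?E" "x \<noteq> b" "y \<noteq> b"
        using xy b(1) by auto
      then show "(x, y) \<in> s \<longleftrightarrow> (x, y) \<in> t'"
      proof cases
        case 1
        then have "(x, y) \<notin> t'" using b(1) DT bt by (auto simp: t'_def)
        then show ?thesis using 1 s(3) by blast
      next
        case 2
        have "(b, y) \<in> s \<longleftrightarrow> (y, b) \<notin> s" using s(2,3) s(4)[of b y] 2 b EB by blast
        moreover have "(b, y) \<in> t' \<longleftrightarrow> y \<notin> D" using 2 EB bt DT b(1) unfolding t'_def by blast
        ultimately show ?thesis using 2 DE by blast
      next
        case 3
        have "(x, b) \<in> t' \<longleftrightarrow> x \<in> D" using 3 bt unfolding t'_def by blast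
        then show ?thesis using 3 DE by blast
      next
        case 4
        then show ?thesis using t(3) t' by (simp add: agree_def)
      qed
    qed
    ultimately show ?case by (intro exI[of _ t']) simp
  qed
  from this[of "B - A"] assms(1) obtain t where "lin (A \<union> (B - A)) t" "agree A r t"
    "agree ((A \<inter> B) \<union> (B - A)) s t" by auto
  moreover have "(A \<inter> B) \<union> (B - A) = B" "A \<union> (B - A) = A \<union> B" by auto
  ultimately show ?thesis by (intro exI[of _ t]) simp
qed

text \<open>Amalgamation with the usual order of the remaining points; the two sets are disjoint, so
  the agreement is vacuous.\<close>

lemma lin_extend:
  assumes "finite U" "T \<subseteq> U" "lin T (r :: (nat \<times> nat) set)"
  shows "\<exists>r'. lin U r' \<and> agree T r r'"
proof -
  have "\<exists>t. lin (T \<union> (U - T)) t \<and> agree T r t \<and> agree (U - T) ({(x, y). x < y} \<inter> (U - T) \<times> (U - T)) t"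
    using assms by (intro lin_amalgam lin_less) (auto simp: agree_def)
  moreover have "T \<union> (U - T) = U" using assms(2) by auto
  ultimately show ?thesis by auto
qed

definition LO :: "nat \<Rightarrow> (nat \<times> nat) set set" where
  "LO n = {L. lin {..<n} L}"

lemma agree_subset: "lin S r \<Longrightarrow> agree S r s \<Longrightarrow> r \<subseteq> s"
  unfolding lin_iff agree_def by auto

text \<open>A linear order on W is maximal: a pair of s within W that is missing from r would be
  reversed in r, against the asymmetry of s.\<close>

lemma agree_iff_subset:
  assumes "lin W r" "lin S s" "W \<subseteq> S"
  shows "agree W r s \<longleftrightarrow> r \<subseteq> s"
proof
  assume "r \<subseteq> s"
  show "agree W r s"
    unfolding agree_def
  proof (intro ballI iffI)
    fix x y assume xy: "x \<in> W" "y \<in> W" "(x, y) \<in> s"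
    then have "x \<noteq> y" "(y, x) \<notin> s" using lin_asym[OF assms(2)] by auto
    then show "(x, y) \<in> r" using assms(1) xy \<open>r \<subseteq> s\<close> unfolding lin_iff by blast
  qed (use \<open>r \<subseteq> s\<close> in blast)
qed (rule agree_subset[OF assms(1)])

lemma agree_restrict: "agree W (L \<inter> W \<times> W) K \<longleftrightarrow> agree W L K"
  unfolding agree_def by simp

lemma LO_extend:
  assumes "S \<subseteq> {..<n}" "lin S r"
  shows "\<exists>L\<in>LO n. r \<subseteq> L"
  using lin_extend[OF _ assms] agree_subset[OF assms(2)] unfolding LO_def by auto

lemma LO_restrict:
  assumes "L \<in> LO n" "W \<subseteq> {..<n}"
  shows "lin W (L \<inter> W \<times> W)"
  using assms lin_restrict unfolding LO_def by blast

lemma LO_agree_iff: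
  assumes "L \<in> LO n" "L' \<in> LO n" "W \<subseteq> {..<n}"
  shows "agree W L L' \<longleftrightarrow> L \<inter> W \<times> W \<subseteq> L'"
  using agree_iff_subset[OF LO_restrict[OF assms(1,3)], of "{..<n}" L'] assms
  unfolding LO_def agree_restrict by auto

text \<open>Used for sets A and B that contain certificates: both then take effect in the single
  order K.\<close>

lemma LO_amalgam:
  assumes "L \<in> LO n" "L' \<in> LO n" "A \<subseteq> {..<n}" "B \<subseteq> {..<n}" "agree (A \<inter> B) L L'"
  shows "\<exists>K\<in>LO n. agree A L K \<and> agree B L' K"
proof -
  have "finite B" using assms(4) finite_subset by blast
  then have "\<exists>t. lin (A \<union> B) t \<and> agree A (L \<inter> A \<times> A) t \<and> agree B (L' \<inter> B \<times> B) t"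
    using assms by (intro lin_amalgam LO_restrict[of _ n]) (auto simp: agree_def)
  then obtain t where t: "lin (A \<union> B) t" "agree A L t" "agree B L' t"
    unfolding agree_restrict by blast
  obtain K where K: "lin {..<n} K" "agree (A \<union> B) t K"
    using lin_extend[of "{..<n}" "A \<union> B" t] t(1) assms by auto
  then have "agree A t K" "agree B t K" using agree_mono by blast+
  then show ?thesis using t(2,3) K(1) agree_trans unfolding LO_def by (intro bexI[of _ K]) auto
qed

section \<open>Certificates\<close>

abbreviation blen :: "nat \<Rightarrow> nat" where
  "blen \<equiv> floorlog 2"

text \<open>The standard counterpart of a valuation in the cut, with one exponent c for all
  variables.\<close>

definition bounded :: "nat \<Rightarrow> nat \<Rightarrow> (nat \<Rightarrow> nat) \<Rightarrow> bool" where
  "bounded n c e \<longleftrightarrow> (\<forall>i. e i \<le> 2 ^ (blen n ^ c))"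

lemma blen_1: "blen 1 = 1"
  by (simp add: floorlog_def)

lemma blen_pow2: "blen (2 ^ k) = k + 1"
  using floorlog_power[of 1 2 k] blen_1 by simp

lemma blen_ge2: "n \<ge> 2 \<Longrightarrow> blen n \<ge> 2"
  using floorlog_mono[of "2 ^ 1" n 2] blen_pow2[of 1] by simp

lemma blen_le: "blen n \<le> n"
  by (rule floorlog_leI) auto

lemma power_sum_le:
  fixes N :: nat assumes "N \<ge> 2" shows "N ^ a + N ^ b \<le> N ^ (a + b + 1)"
proof -
  have "N ^ a \<le> N ^ (a + b)" "N ^ b \<le> N ^ (a + b)" using assms by (auto intro: power_increasing)
  then have "N ^ a + N ^ b \<le> 2 * N ^ (a + b)" by simp
  also have "\<dots> \<le> N * N ^ (a + b)" using assms by simp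
  finally show ?thesis by simp
qed

text \<open>One unit is lost in \<open>blen_pow2\<close>; the \<open>+ 1\<close> of the claim is
  there because a quantifier bounded by |x| ranges over |x| + 1 values.\<close>

lemma blen_bounded: assumes "n \<ge> 2" "x \<le> 2 ^ (blen n ^ c)" shows "blen x + 1 \<le> blen n ^ (c + 2)"
proof -
  have "blen x \<le> blen n ^ c + 1"
    using floorlog_mono[OF assms(2), of 2] blen_pow2 by simp
  moreover have "blen n ^ c + blen n ^ 1 \<le> blen n ^ (c + 1 + 1)"
    by (rule power_sum_le) (use assms blen_ge2 in auto)
  ultimately show ?thesis using blen_ge2[OF assms(1)] by simp
qed

lemma pow2_mono: "a \<le> b \<Longrightarrow> x \<le> 2 ^ a \<Longrightarrow> x \<le> (2::nat) ^ b"
  by (meson le_trans one_le_numeral power_increasing)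

lemma blen_power_mono: "n \<ge> 2 \<Longrightarrow> c \<le> d \<Longrightarrow> blen n ^ c \<le> blen n ^ d"
  using blen_ge2[of n] by (intro power_increasing) auto

lemma bounded_mono: "n \<ge> 2 \<Longrightarrow> c \<le> d \<Longrightarrow> bounded n c e \<Longrightarrow> bounded n d e"
  unfolding bounded_def using pow2_mono blen_power_mono by blast

lemma bounded_case_nat: "bounded n c e \<Longrightarrow> x \<le> 2 ^ (blen n ^ c) \<Longrightarrow> bounded n c (case_nat x e)"
  unfolding bounded_def by (auto split: nat.split)

lemma std_simps [simp]: "carr std = UNIV" "zero std = 0" "one std = 1" "add std = (+)" "mul std = (*)"
  "len std = floorlog 2" "half std = (\<lambda>x. x div 2)" "smash std = (\<lambda>x y. 2 ^ (floorlog 2 x * floorlog 2 y))"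
  "le std = (\<le>)"
  by (simp_all add: std_def)

text \<open>The closure of the cut under the operations, with an exponent that depends on c and t
  alone. For \<open>Smash\<close> the lengths multiply, so the exponents add.\<close>

lemma tval_bounded:
  "\<exists>d. \<forall>n\<ge>2. \<forall>e. bounded n c e \<longrightarrow> tval std e t \<le> 2 ^ (blen n ^ d)"
proof (induction t)
  case (Var x)
  then show ?case by (auto simp: bounded_def)
next
  case Zero
  then show ?case by simp
next
  case One
  then show ?case by simp
next
  case (Add s t)
  then obtain c1 c2 where c: "\<forall>n\<ge>2. \<forall>e. bounded n c e \<longrightarrow> tval std e s \<le> 2 ^ (blen n ^ c1)"
    "\<forall>n\<ge>2. \<forall>e. bounded n c e \<longrightarrow> tval std e t \<le> 2 ^ (blen n ^ c2)" by blast
  show ?case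
  proof (intro exI allI impI)
    fix n :: nat and e assume n: "n \<ge> 2" and e: "bounded n c e"
    have "tval std e (Add s t) \<le> 2 ^ (blen n ^ c1) + 2 ^ (blen n ^ c2)"
      using c n e by (simp add: add_mono)
    also have "\<dots> \<le> 2 ^ (blen n ^ c1 + blen n ^ c2 + 1)" by (rule power_sum_le) simp
    also have "\<dots> \<le> 2 ^ (blen n ^ (c1 + c2 + 2))"
      using power_sum_le[OF blen_ge2[OF n], of c1 c2] power_sum_le[OF blen_ge2[OF n], of "c1 + c2 + 1" 0]
      by (intro power_increasing) auto
    finally show "tval std e (Add s t) \<le> 2 ^ (blen n ^ (c1 + c2 + 2))" .
  qed
next
  case (Mul s t)
  then obtain c1 c2 where c: "\<forall>n\<ge>2. \<forall>e. bounded n c e \<longrightarrow> tval std e s \<le> 2 ^ (blen n ^ c1)"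
    "\<forall>n\<ge>2. \<forall>e. bounded n c e \<longrightarrow> tval std e t \<le> 2 ^ (blen n ^ c2)" by blast
  show ?case
  proof (intro exI allI impI)
    fix n :: nat and e assume n: "n \<ge> 2" and e: "bounded n c e"
    have "tval std e (Mul s t) \<le> 2 ^ (blen n ^ c1) * 2 ^ (blen n ^ c2)"
      using c n e by (simp add: mult_mono)
    also have "\<dots> = 2 ^ (blen n ^ c1 + blen n ^ c2)" by (simp add: power_add)
    also have "\<dots> \<le> 2 ^ (blen n ^ (c1 + c2 + 1))"
      using power_sum_le[OF blen_ge2[OF n], of c1 c2] by (intro power_increasing) auto
    finally show "tval std e (Mul s t) \<le> 2 ^ (blen n ^ (c1 + c2 + 1))" .
  qed
next
  case (Len t)
  then obtain d where "\<forall>n\<ge>2. \<forall>e. bounded n c e \<longrightarrow> tval std e t \<le> 2 ^ (blen n ^ d)" by blast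
  then have "\<forall>n\<ge>2. \<forall>e. bounded n c e \<longrightarrow> tval std e (Len t) \<le> 2 ^ (blen n ^ d)"
    using blen_le le_trans by (simp, blast)
  then show ?case by blast
next
  case (Half t)
  then obtain d where "\<forall>n\<ge>2. \<forall>e. bounded n c e \<longrightarrow> tval std e t \<le> 2 ^ (blen n ^ d)" by blast
  then have "\<forall>n\<ge>2. \<forall>e. bounded n c e \<longrightarrow> tval std e (Half t) \<le> 2 ^ (blen n ^ d)"
    using div_le_dividend le_trans by (simp, blast)
  then show ?case by blast
next
  case (Smash s t)
  then obtain c1 c2 where c: "\<forall>n\<ge>2. \<forall>e. bounded n c e \<longrightarrow> tval std e s \<le> 2 ^ (blen n ^ c1)"
    "\<forall>n\<ge>2. \<forall>e. bounded n c e \<longrightarrow> tval std e t \<le> 2 ^ (blen n ^ c2)" by blast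
  show ?case
  proof (intro exI allI impI)
    fix n :: nat and e assume n: "n \<ge> 2" and e: "bounded n c e"
    have "blen (tval std e s) \<le> blen n ^ (c1 + 2)" "blen (tval std e t) \<le> blen n ^ (c2 + 2)"
      using blen_bounded[OF n] c n e by (meson add_leD1)+
    then have "blen (tval std e s) * blen (tval std e t) \<le> blen n ^ (c1 + 2 + (c2 + 2))"
      unfolding power_add[of _ "c1 + 2"] by (rule mult_mono) auto
    then show "tval std e (Smash s t) \<le> 2 ^ (blen n ^ (c1 + 2 + (c2 + 2)))" by simp
  qed
qed

lemma tval_boundedD:
  obtains d where "\<And>n e. n \<ge> 2 \<Longrightarrow> bounded n c e \<Longrightarrow> tval std e t \<le> 2 ^ (blen n ^ d)"
proof -
  obtain d where "\<forall>n\<ge>2. \<forall>e. bounded n c e \<longrightarrow> tval std e t \<le> 2 ^ (blen n ^ d)"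
    using tval_bounded by blast
  then show ?thesis by (intro that) blast
qed

section \<open>Certificates: sets of points whose order secures the truth of a formula\<close>

definition certifies :: "nat \<Rightarrow> ((nat \<times> nat) set \<Rightarrow> bool) \<Rightarrow> nat set \<Rightarrow> (nat \<times> nat) set \<Rightarrow> bool" where
  "certifies n F W L \<longleftrightarrow> W \<subseteq> {..<n} \<and> (\<forall>L'\<in>LO n. agree W L L' \<longrightarrow> F L')"

text \<open>The exponent d is chosen after c but before n, e and L. This uniformity later makes each
  density statement a single sentence of arithmetic.\<close>

definition certifiable :: "((nat \<times> nat) set \<Rightarrow> (nat \<Rightarrow> nat) \<Rightarrow> bool) \<Rightarrow> bool" where
  "certifiable F \<longleftrightarrow> (\<forall>c. \<exists>d. \<forall>n\<ge>2. \<forall>e. bounded n c e \<longrightarrow>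
     (\<forall>L\<in>LO n. F L e \<longrightarrow> (\<exists>W. card W \<le> blen n ^ d \<and> certifies n (\<lambda>L. F L e) W L)))"

lemma certifiableD:
  assumes "certifiable F"
  obtains d where "\<And>n e L. n \<ge> 2 \<Longrightarrow> bounded n c e \<Longrightarrow> L \<in> LO n \<Longrightarrow> F L e \<Longrightarrow>
    \<exists>W. card W \<le> blen n ^ d \<and> certifies n (\<lambda>L. F L e) W L"
proof -
  obtain d where "\<forall>n\<ge>2. \<forall>e. bounded n c e \<longrightarrow>
     (\<forall>L\<in>LO n. F L e \<longrightarrow> (\<exists>W. card W \<le> blen n ^ d \<and> certifies n (\<lambda>L. F L e) W L))"
    using assms unfolding certifiable_def by blast
  then show ?thesis by (intro that) blast
qed

lemma certifiable_const: "certifiable (\<lambda>L. F)"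
  unfolding certifiable_def certifies_def by (intro allI exI[of _ 0] impI ballI exI[of _ "{}"]) auto

lemma certifiable_by_two_points:
  assumes "\<And>L e n. n \<ge> 2 \<Longrightarrow> F L e \<Longrightarrow> L \<in> LO n \<Longrightarrow> \<exists>W\<subseteq>{..<n}. card W \<le> 2 \<and> (\<forall>L'\<in>LO n. agree W L L' \<longrightarrow> F L' e)"
  shows "certifiable F"
  unfolding certifiable_def certifies_def
proof (intro allI exI[of _ 1] impI ballI)
  fix n :: nat and e L assume n: "2 \<le> n" "L \<in> LO n" "F L e"
  obtain W where "W \<subseteq> {..<n}" "card W \<le> 2" "\<forall>L'\<in>LO n. agree W L L' \<longrightarrow> F L' e" using assms n by meson
  then show "\<exists>W. card W \<le> blen n ^ 1 \<and> W \<subseteq> {..<n} \<and> (\<forall>L'\<in>LO n. agree W L L' \<longrightarrow> F L' e)"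
    using blen_ge2[OF n(1)] by (intro exI[of _ W]) simp
qed

lemma certifiable_prec:
  "certifiable (\<lambda>L e. (tval std e s, tval std e t) \<in> L)"
  "certifiable (\<lambda>L e. (tval std e s, tval std e t) \<notin> L)"
proof -
  have *: "\<exists>W\<subseteq>{..<n}. card W \<le> 2 \<and> (\<forall>L'\<in>LO n. agree W L L' \<longrightarrow> (a, b) \<in> L \<longleftrightarrow> (a, b) \<in> L')"
    if "L \<in> LO n" for n a b L
  proof (cases "a < n \<and> b < n")
    case True
    have "card {a, b} \<le> 2" by (simp add: card_insert_if)
    then show ?thesis using True by (intro exI[of _ "{a, b}"]) (auto simp: agree_def)
  next
    \<comment> \<open>A member of \<open>LO n\<close> relates no points outside the numbers below n,
      so nothing has to be fixed.\<close>
    case False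
    then have "\<forall>L'\<in>LO n. (a, b) \<notin> L'" by (auto simp: LO_def lin_def)
    then show ?thesis using that by (intro exI[of _ "{}"]) auto
  qed
  show "certifiable (\<lambda>L e. (tval std e s, tval std e t) \<in> L)"
  proof (rule certifiable_by_two_points)
    fix L e and n :: nat assume "L \<in> LO n" "(tval std e s, tval std e t) \<in> L"
    then show "\<exists>W\<subseteq>{..<n}. card W \<le> 2 \<and> (\<forall>L'\<in>LO n. agree W L L' \<longrightarrow> (tval std e s, tval std e t) \<in> L')"
      using *[of L n "tval std e s" "tval std e t"] by meson
  qed
  show "certifiable (\<lambda>L e. (tval std e s, tval std e t) \<notin> L)"
  proof (rule certifiable_by_two_points)
    fix L e and n :: nat assume "L \<in> LO n" "(tval std e s, tval std e t) \<notin> L"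
    then show "\<exists>W\<subseteq>{..<n}. card W \<le> 2 \<and> (\<forall>L'\<in>LO n. agree W L L' \<longrightarrow> (tval std e s, tval std e t) \<notin> L')"
      using *[of L n "tval std e s" "tval std e t"] by meson
  qed
qed

lemma certifies_mono: "certifies n F W L \<Longrightarrow> (\<And>L. F L \<Longrightarrow> G L) \<Longrightarrow> certifies n G W L"
  unfolding certifies_def by blast

lemma certifiable_or: assumes "certifiable F" "certifiable G" shows "certifiable (\<lambda>L e. F L e \<or> G L e)"
  unfolding certifiable_def
proof
  fix c
  obtain d1 where d1: "\<And>n e L. n \<ge> 2 \<Longrightarrow> bounded n c e \<Longrightarrow> L \<in> LO n \<Longrightarrow> F L e \<Longrightarrow>
     \<exists>W. card W \<le> blen n ^ d1 \<and> certifies n (\<lambda>L. F L e) W L" by (rule certifiableD[OF assms(1)], rule that) blast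
  obtain d2 where d2: "\<And>n e L. n \<ge> 2 \<Longrightarrow> bounded n c e \<Longrightarrow> L \<in> LO n \<Longrightarrow> G L e \<Longrightarrow>
     \<exists>W. card W \<le> blen n ^ d2 \<and> certifies n (\<lambda>L. G L e) W L" by (rule certifiableD[OF assms(2)], rule that) blast
  have "\<exists>W. card W \<le> blen n ^ (d1 + d2) \<and> certifies n (\<lambda>L. F L e \<or> G L e) W L"
    if n: "n \<ge> 2" "bounded n c e" "L \<in> LO n" "F L e \<or> G L e" for n e L
  proof -
    have m: "blen n ^ d1 \<le> blen n ^ (d1 + d2)" "blen n ^ d2 \<le> blen n ^ (d1 + d2)"
      using blen_power_mono n(1) by auto
    show ?thesis
    proof (cases "F L e")
      case True
      then obtain W where "card W \<le> blen n ^ d1" "certifies n (\<lambda>L. F L e) W L" using d1[OF n(1,2,3)] n(4) True by blast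
      then show ?thesis using m certifies_mono[of n _ W L "\<lambda>L. F L e \<or> G L e"] by (intro exI[of _ W]) (auto intro: le_trans)
    next
      case False
      then obtain W where "card W \<le> blen n ^ d2" "certifies n (\<lambda>L. G L e) W L" using d2[OF n(1,2,3)] n(4) False by blast
      then show ?thesis using m certifies_mono[of n _ W L "\<lambda>L. F L e \<or> G L e"] by (intro exI[of _ W]) (auto intro: le_trans)
    qed
  qed
  then show "\<exists>d. \<forall>n\<ge>2. \<forall>e. bounded n c e \<longrightarrow>
     (\<forall>L\<in>LO n. F L e \<or> G L e \<longrightarrow> (\<exists>W. card W \<le> blen n ^ d \<and> certifies n (\<lambda>L. F L e \<or> G L e) W L))" by blast
qed

lemma certifiable_and: assumes "certifiable F" "certifiable G" shows "certifiable (\<lambda>L e. F L e \<and> G L e)"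
  unfolding certifiable_def
proof
  fix c
  obtain d1 where d1: "\<And>n e L. n \<ge> 2 \<Longrightarrow> bounded n c e \<Longrightarrow> L \<in> LO n \<Longrightarrow> F L e \<Longrightarrow>
     \<exists>W. card W \<le> blen n ^ d1 \<and> certifies n (\<lambda>L. F L e) W L" by (rule certifiableD[OF assms(1)], rule that) blast
  obtain d2 where d2: "\<And>n e L. n \<ge> 2 \<Longrightarrow> bounded n c e \<Longrightarrow> L \<in> LO n \<Longrightarrow> G L e \<Longrightarrow>
     \<exists>W. card W \<le> blen n ^ d2 \<and> certifies n (\<lambda>L. G L e) W L" by (rule certifiableD[OF assms(2)], rule that) blast
  have "\<exists>W. card W \<le> blen n ^ (d1 + d2 + 1) \<and> certifies n (\<lambda>L. F L e \<and> G L e) W L"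
    if n: "n \<ge> 2" "bounded n c e" "L \<in> LO n" "F L e \<and> G L e" for n e L
  proof -
    obtain W where W: "card W \<le> blen n ^ d1" "certifies n (\<lambda>L. F L e) W L" using d1[OF n(1,2,3)] n(4) by blast
    obtain V where V: "card V \<le> blen n ^ d2" "certifies n (\<lambda>L. G L e) V L" using d2[OF n(1,2,3)] n(4) by blast
    have "card (W \<union> V) \<le> blen n ^ (d1 + d2 + 1)"
      using card_Un_le[of W V] W(1) V(1) power_sum_le[OF blen_ge2[OF n(1)], of d1 d2] by linarith
    moreover have "certifies n (\<lambda>L. F L e \<and> G L e) (W \<union> V) L"
      using W(2) V(2) agree_mono[of "W \<union> V"] unfolding certifies_def by blast
    ultimately show ?thesis by blast
  qed
  then show "\<exists>d. \<forall>n\<ge>2. \<forall>e. bounded n c e \<longrightarrow>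
     (\<forall>L\<in>LO n. F L e \<and> G L e \<longrightarrow> (\<exists>W. card W \<le> blen n ^ d \<and> certifies n (\<lambda>L. F L e \<and> G L e) W L))" by blast
qed

lemma certifiable_imp: "certifiable (\<lambda>L e. \<not> F L e) \<Longrightarrow> certifiable G \<Longrightarrow> certifiable (\<lambda>L e. F L e \<longrightarrow> G L e)"
  using certifiable_or[of "\<lambda>L e. \<not> F L e" G] by simp

text \<open>A certificate for one witness certifies the existential statement. Only the exponent of
  the valuation grows, since the witness may be as large as t.\<close>

lemma certifiable_ex_le:
  assumes "certifiable F"
  shows "certifiable (\<lambda>L e. \<exists>a\<le>tval std e t. F L (case_nat a e))"
  unfolding certifiable_def
proof
  fix c
  obtain c' where c': "\<And>n e. n \<ge> 2 \<Longrightarrow> bounded n c e \<Longrightarrow> tval std e t \<le> 2 ^ (blen n ^ c')"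
    by (rule tval_boundedD, rule that) blast
  obtain d where d: "\<And>n e L. n \<ge> 2 \<Longrightarrow> bounded n (c + c') e \<Longrightarrow> L \<in> LO n \<Longrightarrow> F L e \<Longrightarrow>
     \<exists>W. card W \<le> blen n ^ d \<and> certifies n (\<lambda>L. F L e) W L" by (rule certifiableD[OF assms(1)], rule that) blast
  have "\<exists>W. card W \<le> blen n ^ d \<and> certifies n (\<lambda>L. \<exists>a\<le>tval std e t. F L (case_nat a e)) W L"
    if n: "n \<ge> 2" "bounded n c e" "L \<in> LO n" "\<exists>a\<le>tval std e t. F L (case_nat a e)" for n e L
  proof -
    obtain a where a: "a \<le> tval std e t" "F L (case_nat a e)" using n(4) by blast
    have "a \<le> 2 ^ (blen n ^ (c + c'))"
      using a(1) c'[OF n(1,2)] pow2_mono[OF blen_power_mono[OF n(1)], of c' "c + c'" a] by simp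
    then have "bounded n (c + c') (case_nat a e)"
      by (intro bounded_case_nat bounded_mono[OF n(1) _ n(2)]) auto
    then obtain W where "card W \<le> blen n ^ d" "certifies n (\<lambda>L. F L (case_nat a e)) W L"
      using d[OF n(1) _ n(3) a(2)] by blast
    moreover from this(2) have "certifies n (\<lambda>L. \<exists>a\<le>tval std e t. F L (case_nat a e)) W L"
      by (rule certifies_mono) (use a(1) in blast)
    ultimately show ?thesis by blast
  qed
  then show "\<exists>d. \<forall>n\<ge>2. \<forall>e. bounded n c e \<longrightarrow>
     (\<forall>L\<in>LO n. (\<exists>a\<le>tval std e t. F L (case_nat a e)) \<longrightarrow>
       (\<exists>W. card W \<le> blen n ^ d \<and> certifies n (\<lambda>L. \<exists>a\<le>tval std e t. F L (case_nat a e)) W L))" by blast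
qed

text \<open>The certificates of the single cases are united; there are at most |t| + 1 of them, a
  polylogarithmic number. Arbitrary initial segments are treated because \<open>reach_all_le\<close>
  certifies the cases before a first counterexample.\<close>

lemma certifies_all_le:
  assumes "certifiable F"
  shows "\<exists>d. \<forall>n\<ge>2. \<forall>e. bounded n c e \<longrightarrow> (\<forall>L\<in>LO n. \<forall>j\<le>blen (tval std e t) + 1. (\<forall>i<j. F L (case_nat i e)) \<longrightarrow>
    (\<exists>W. card W \<le> blen n ^ d \<and> certifies n (\<lambda>L. \<forall>i<j. F L (case_nat i e)) W L))"
proof -
  obtain c' where c': "\<And>n e. n \<ge> 2 \<Longrightarrow> bounded n c e \<Longrightarrow> tval std e t \<le> 2 ^ (blen n ^ c')"
    by (rule tval_boundedD, rule that) blast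
  obtain d where d: "\<And>n e L. n \<ge> 2 \<Longrightarrow> bounded n (c + c') e \<Longrightarrow> L \<in> LO n \<Longrightarrow> F L e \<Longrightarrow>
     \<exists>W. card W \<le> blen n ^ d \<and> certifies n (\<lambda>L. F L e) W L" by (rule certifiableD[OF assms(1)], rule that) blast
  have "\<exists>W. card W \<le> blen n ^ (c' + 2 + d) \<and> certifies n (\<lambda>L. \<forall>i<j. F L (case_nat i e)) W L"
    if n: "n \<ge> 2" "bounded n c e" "L \<in> LO n" "j \<le> blen (tval std e t) + 1" "\<forall>i<j. F L (case_nat i e)" for n e L j
  proof -
    have "\<exists>W. card W \<le> blen n ^ d \<and> certifies n (\<lambda>L. F L (case_nat i e)) W L" if i: "i < j" for i
    proof -
      have "i \<le> tval std e t" using i n(4) blen_le[of "tval std e t"] by simp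
      then have "i \<le> 2 ^ (blen n ^ (c + c'))"
        using c'[OF n(1,2)] pow2_mono[OF blen_power_mono[OF n(1)], of c' "c + c'" i] by simp
      then have "bounded n (c + c') (case_nat i e)"
        by (intro bounded_case_nat bounded_mono[OF n(1) _ n(2)]) auto
      then show ?thesis using d[OF n(1) _ n(3)] n(5) i by blast
    qed
    then obtain W where W: "\<And>i. i < j \<Longrightarrow> card (W i) \<le> blen n ^ d"
      "\<And>i. i < j \<Longrightarrow> certifies n (\<lambda>L. F L (case_nat i e)) (W i) L" by metis
    have "card (\<Union>i<j. W i) \<le> (\<Sum>i<j. card (W i))" by (rule card_UN_le) simp
    also have "\<dots> \<le> j * blen n ^ d" using sum_bounded_above[of "{..<j}" "\<lambda>i. card (W i)" "blen n ^ d"] W(1) by simp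
    also have "\<dots> \<le> blen n ^ (c' + 2) * blen n ^ d"
      using n(4) blen_bounded[OF n(1) c'[OF n(1,2)]] by simp
    finally have "card (\<Union>i<j. W i) \<le> blen n ^ (c' + 2 + d)" by (simp add: power_add)
    moreover have "certifies n (\<lambda>L. \<forall>i<j. F L (case_nat i e)) (\<Union>i<j. W i) L"
      unfolding certifies_def
    proof (intro conjI ballI impI allI)
      show "(\<Union>i<j. W i) \<subseteq> {..<n}" using W(2) unfolding certifies_def by blast
      fix L' i assume "L' \<in> LO n" "agree (\<Union>i<j. W i) L L'" "i < j"
      moreover from this have "agree (W i) L L'" by (auto intro: agree_mono)
      ultimately show "F L' (case_nat i e)" using W(2) unfolding certifies_def by blast
    qed
    ultimately show ?thesis by blast
  qed
  then show ?thesis by blast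
qed

lemma certifiable_all_le:
  assumes "certifiable F"
  shows "certifiable (\<lambda>L e. \<forall>a\<le>blen (tval std e t). F L (case_nat a e))"
  unfolding certifiable_def
proof
  fix c
  obtain d where d: "\<forall>n\<ge>2. \<forall>e. bounded n c e \<longrightarrow> (\<forall>L\<in>LO n. \<forall>j\<le>blen (tval std e t) + 1. (\<forall>i<j. F L (case_nat i e)) \<longrightarrow>
    (\<exists>W. card W \<le> blen n ^ d \<and> certifies n (\<lambda>L. \<forall>i<j. F L (case_nat i e)) W L))"
    using certifies_all_le[OF assms] by blast
  have *: "(\<forall>a\<le>b. P a) \<longleftrightarrow> (\<forall>a<b + 1. P a)" for b :: nat and P
    by (metis Suc_eq_plus1 less_Suc_eq_le)
  show "\<exists>d. \<forall>n\<ge>2. \<forall>e. bounded n c e \<longrightarrow> (\<forall>L\<in>LO n. (\<forall>a\<le>blen (tval std e t). F L (case_nat a e)) \<longrightarrow>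
      (\<exists>W. card W \<le> blen n ^ d \<and> certifies n (\<lambda>L. \<forall>a\<le>blen (tval std e t). F L (case_nat a e)) W L))"
  proof (intro exI[of _ d] allI impI ballI)
    fix n :: nat and e L
    assume "2 \<le> n" "bounded n c e" "L \<in> LO n" "\<forall>a\<le>blen (tval std e t). F L (case_nat a e)"
    then show "\<exists>W. card W \<le> blen n ^ d \<and> certifies n (\<lambda>L. \<forall>a\<le>blen (tval std e t). F L (case_nat a e)) W L"
      using d[rule_format, of n e L "blen (tval std e t) + 1"] unfolding * by simp
  qed
qed

abbreviation sem :: "fm \<Rightarrow> (nat \<times> nat) set \<Rightarrow> (nat \<Rightarrow> nat) \<Rightarrow> bool" where
  "sem p \<equiv> \<lambda>L e. sat std L e p"

lemma sat_Forall_le: "sat A R e (Forall_le t p) \<longleftrightarrow> (\<forall>a\<in>carr A. le A a (tval A e t) \<longrightarrow> sat A R (case_nat a e) p)"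
  by (simp add: Forall_le_def)

lemma sat_Exists_le: "sat A R e (Exists_le t p) \<longleftrightarrow> (\<exists>a\<in>carr A. le A a (tval A e t) \<and> sat A R (case_nat a e) p)"
  by (simp add: Exists_le_def)

text \<open>Negation interchanges the two claims, so they are proved together. The quantifiers are
  dual: a failing universal quantifier has a counterexample as witness.\<close>

lemma sharply_bounded_certifiable:
  "sharply_bounded p \<Longrightarrow> certifiable (sem p) \<and> certifiable (\<lambda>L e. \<not> sem p L e)"
proof (induction rule: sharply_bounded.induct)
  case (8 p t)
  then show ?case using certifiable_all_le[of "sem p" t] certifiable_ex_le[of "\<lambda>L e. \<not> sem p L e" "Len t"]
    by (simp add: sat_Forall_le)
next
  case (9 p t)
  then show ?case using certifiable_all_le[of "\<lambda>L e. \<not> sem p L e" t] certifiable_ex_le[of "sem p" "Len t"]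
    by (simp add: sat_Exists_le)
qed (simp_all add: certifiable_const certifiable_prec certifiable_and certifiable_or certifiable_imp)

text \<open>Only truth is certified here: the failure of \<open>Exists_le t p\<close> may depend on
  all of its quasi-polynomially many instances.\<close>

lemma Sigma_b1_certifiable: "Sigma_b1 p \<Longrightarrow> certifiable (sem p)"
proof (induction rule: Sigma_b1.induct)
  case (4 p t)
  then show ?case using certifiable_all_le[of "sem p" t] by (simp add: sat_Forall_le)
next
  case (5 p t)
  then show ?case using certifiable_ex_le[of "sem p" "Len t"] by (simp add: sat_Exists_le)
next
  case (6 p t)
  then show ?case using certifiable_ex_le[of "sem p" t] by (simp add: sat_Exists_le)
qed (simp_all add: sharply_bounded_certifiable certifiable_and certifiable_or)

section \<open>Density over the standard numbers\<close>

definition forced :: "nat \<Rightarrow> (nat \<times> nat) set \<Rightarrow> ((nat \<times> nat) set \<Rightarrow> bool) \<Rightarrow> bool" where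
  "forced n r F \<longleftrightarrow> (\<forall>L\<in>LO n. r \<subseteq> L \<longrightarrow> F L)"

text \<open>S is carried along because r does not determine it: the order on a single point is the
  empty relation.\<close>

definition reach :: "nat \<Rightarrow> nat set \<Rightarrow> (nat \<times> nat) set \<Rightarrow> nat \<Rightarrow> ((nat \<times> nat) set \<Rightarrow> bool) \<Rightarrow> bool" where
  "reach n S r b Q \<longleftrightarrow>
    (\<exists>S' r'. S' \<subseteq> {..<n} \<and> lin S' r' \<and> r \<subseteq> r' \<and> card S' \<le> card S + b \<and> Q r')"

lemma reach_refl: "S \<subseteq> {..<n} \<Longrightarrow> lin S r \<Longrightarrow> Q r \<Longrightarrow> reach n S r b Q"
  unfolding reach_def by (intro exI[of _ S] exI[of _ r]) simp

lemma reach_mono: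
  assumes "reach n S r b Q" "b \<le> b'" "\<And>P. Q P \<Longrightarrow> Q' P"
  shows "reach n S r b' Q'"
proof -
  obtain S' r' where "S' \<subseteq> {..<n}" "lin S' r'" "r \<subseteq> r'" "card S' \<le> card S + b" "Q r'"
    using assms(1) unfolding reach_def by blast
  then show ?thesis unfolding reach_def using assms(2,3) by (intro exI[of _ S'] exI[of _ r']) auto
qed

text \<open>Extensions of r are cut out of a total order above r by restricting it to S and the
  points of interest W, so linearity comes for free.\<close>

lemma reachI:
  assumes "L \<in> LO n" "S \<subseteq> {..<n}" "lin S r" "r \<subseteq> L" "W \<subseteq> {..<n}" "card W \<le> b"
    "Q (L \<inter> (S \<union> W) \<times> (S \<union> W))"
  shows "reach n S r b Q"
  unfolding reach_def
proof (intro exI conjI)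
  show "S \<union> W \<subseteq> {..<n}" using assms by simp
  then show "lin (S \<union> W) (L \<inter> (S \<union> W) \<times> (S \<union> W))" using LO_restrict assms(1) by blast
  show "r \<subseteq> L \<inter> (S \<union> W) \<times> (S \<union> W)" using assms(3,4) unfolding lin_def by auto
  show "card (S \<union> W) \<le> card S + b" using card_Un_le[of S W] assms(6) by linarith
qed (rule assms(7))

lemma forced_restrict_iff:
  assumes "L \<in> LO n" "T \<subseteq> {..<n}"
  shows "forced n (L \<inter> T \<times> T) F \<longleftrightarrow> (\<forall>L'\<in>LO n. agree T L L' \<longrightarrow> F L')"
  using LO_agree_iff[OF assms(1) _ assms(2)] unfolding forced_def by blast

lemma certifies_forced:
  assumes "L \<in> LO n" "T \<subseteq> {..<n}" "certifies n F W L" "W \<subseteq> T"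
  shows "forced n (L \<inter> T \<times> T) F"
  unfolding forced_restrict_iff[OF assms(1,2)]
proof (intro ballI impI)
  fix L' assume "L' \<in> LO n" "agree T L L'"
  then show "F L'" using assms(3) agree_mono[OF _ assms(4)] unfolding certifies_def by blast
qed

lemma certifies_subset: "certifies n F W L \<Longrightarrow> W \<subseteq> {..<n}"
  by (simp add: certifies_def)

lemma reach_certified:
  assumes "L \<in> LO n" "S \<subseteq> {..<n}" "lin S r" "r \<subseteq> L" "card W \<le> b" "certifies n F W L"
    "\<And>r'. r \<subseteq> r' \<Longrightarrow> forced n r' F \<Longrightarrow> Q r'"
  shows "reach n S r b Q"
proof (rule reachI[OF assms(1-4) certifies_subset[OF assms(6)] assms(5)])
  show "Q (L \<inter> (S \<union> W) \<times> (S \<union> W))"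
  proof (rule assms(7))
    show "r \<subseteq> L \<inter> (S \<union> W) \<times> (S \<union> W)" using assms(3,4) unfolding lin_def by auto
    show "forced n (L \<inter> (S \<union> W) \<times> (S \<union> W)) F"
      by (rule certifies_forced[OF assms(1) _ assms(6)]) (use assms(2) certifies_subset[OF assms(6)] in auto)
  qed
qed

lemma reach_compare:
  assumes "S \<subseteq> {..<n}" "lin S r" "x < n" "y < n" "x \<noteq> y"
  shows "reach n S r 2 (\<lambda>r'. (x, y) \<in> r' \<or> (y, x) \<in> r')"
proof -
  obtain L where L: "L \<in> LO n" "r \<subseteq> L" using LO_extend[OF assms(1,2)] by blast
  show ?thesis
  proof (rule reachI[OF L(1) assms(1,2) L(2), of "{x, y}"])
    show "(x, y) \<in> L \<inter> (S \<union> {x, y}) \<times> (S \<union> {x, y}) \<or> (y, x) \<in> L \<inter> (S \<union> {x, y}) \<times> (S \<union> {x, y})"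
      using L(1) assms(3-5) unfolding LO_def lin_iff by auto
  qed (use assms in \<open>auto simp: card_insert_if\<close>)
qed

text \<open>Either r already forces that there is no witness, or some total order above r has one;
  the certificate of that instance then forces it.\<close>

lemma reach_ex_le:
  assumes "certifiable F"
  shows "\<exists>d. \<forall>n\<ge>2. \<forall>e. bounded n c e \<longrightarrow> (\<forall>S r. S \<subseteq> {..<n} \<longrightarrow> lin S r \<longrightarrow>
    reach n S r (blen n ^ d) (\<lambda>r'. forced n r' (\<lambda>L. \<not> (\<exists>a\<le>tval std e t. F L (case_nat a e))) \<or>
      (\<exists>a\<le>tval std e t. forced n r' (\<lambda>L. F L (case_nat a e)))))"
proof -
  obtain c' where c': "\<And>n e. n \<ge> 2 \<Longrightarrow> bounded n c e \<Longrightarrow> tval std e t \<le> 2 ^ (blen n ^ c')"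
    by (rule tval_boundedD, rule that) blast
  obtain d where d: "\<And>n e L. n \<ge> 2 \<Longrightarrow> bounded n (c + c') e \<Longrightarrow> L \<in> LO n \<Longrightarrow> F L e \<Longrightarrow>
     \<exists>W. card W \<le> blen n ^ d \<and> certifies n (\<lambda>L. F L e) W L" by (rule certifiableD[OF assms], rule that) blast
  show ?thesis
  proof (intro exI[of _ d] allI impI)
    fix n :: nat and e S r assume n: "n \<ge> 2" "bounded n c e" and S: "S \<subseteq> {..<n}" "lin S r"
    let ?Q = "\<lambda>r'. forced n r' (\<lambda>L. \<not> (\<exists>a\<le>tval std e t. F L (case_nat a e))) \<or>
      (\<exists>a\<le>tval std e t. forced n r' (\<lambda>L. F L (case_nat a e)))"
    show "reach n S r (blen n ^ d) ?Q"
    proof (cases "forced n r (\<lambda>L. \<not> (\<exists>a\<le>tval std e t. F L (case_nat a e)))")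
      case True
      then show ?thesis using reach_refl[OF S] by simp
    next
      case False
      then obtain L a where L: "L \<in> LO n" "r \<subseteq> L" and a: "a \<le> tval std e t" "F L (case_nat a e)"
        unfolding forced_def by blast
      have "a \<le> 2 ^ (blen n ^ (c + c'))"
        using a(1) c'[OF n(1,2)] pow2_mono[OF blen_power_mono[OF n(1)], of c' "c + c'" a] by simp
      then have "bounded n (c + c') (case_nat a e)"
        by (intro bounded_case_nat bounded_mono[OF n(1) _ n(2)]) auto
      then obtain W where W: "card W \<le> blen n ^ d" "certifies n (\<lambda>L. F L (case_nat a e)) W L"
        using d[OF n(1) _ L(1) a(2)] by blast
      show ?thesis
      proof (rule reach_certified[OF L(1) S L(2) W])
        fix r' assume "forced n r' (\<lambda>L. F L (case_nat a e))"
        then show "?Q r'" using a(1) by blast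
      qed
    qed
  qed
qed

text \<open>For a forced counterexample, take an order extending r whose first counterexample j is as
  large as possible and fix a certificate for the cases below j.\<close>

lemma reach_all_le:
  assumes "certifiable F"
  shows "\<exists>d. \<forall>n\<ge>2. \<forall>e. bounded n c e \<longrightarrow> (\<forall>S r. S \<subseteq> {..<n} \<longrightarrow> lin S r \<longrightarrow>
    reach n S r (blen n ^ d) (\<lambda>r'. forced n r' (\<lambda>L. \<forall>a\<le>blen (tval std e t). F L (case_nat a e)) \<or>
      (\<exists>a\<le>blen (tval std e t). forced n r' (\<lambda>L. \<not> F L (case_nat a e)))))"
proof -
  obtain d where d: "\<forall>n\<ge>2. \<forall>e. bounded n c e \<longrightarrow> (\<forall>L\<in>LO n. \<forall>j\<le>blen (tval std e t) + 1. (\<forall>i<j. F L (case_nat i e)) \<longrightarrow>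
    (\<exists>W. card W \<le> blen n ^ d \<and> certifies n (\<lambda>L. \<forall>i<j. F L (case_nat i e)) W L))"
    using certifies_all_le[OF assms] by blast
  show ?thesis
  proof (intro exI[of _ d] allI impI)
    fix n :: nat and e S r assume n: "n \<ge> 2" "bounded n c e" and S: "S \<subseteq> {..<n}" "lin S r"
    let ?m = "blen (tval std e t) + 1"
    let ?Q = "\<lambda>r'. forced n r' (\<lambda>L. \<forall>a\<le>blen (tval std e t). F L (case_nat a e)) \<or>
      (\<exists>a\<le>blen (tval std e t). forced n r' (\<lambda>L. \<not> F L (case_nat a e)))"
    \<comment> \<open>The lengths of initial segments of cases that hold together over some order
      extending r. The largest possible length \<open>?m\<close> means that all cases hold.\<close>
    define J where "J = {j. j \<le> ?m \<and> (\<exists>L\<in>LO n. r \<subseteq> L \<and> (\<forall>i<j. F L (case_nat i e)))}"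
    have "finite J" unfolding J_def by simp
    moreover have "0 \<in> J" using LO_extend[OF S] unfolding J_def by simp
    ultimately have J: "Max J \<in> J" "\<And>j. j \<in> J \<Longrightarrow> j \<le> Max J" using Max_in[of J] Max_ge[of J] by blast+
    define j where "j = Max J"
    obtain L where L: "L \<in> LO n" "r \<subseteq> L" and j: "j \<le> ?m" "\<forall>i<j. F L (case_nat i e)"
      using J(1) unfolding J_def j_def by blast
    obtain W where W: "card W \<le> blen n ^ d" "certifies n (\<lambda>L. \<forall>i<j. F L (case_nat i e)) W L"
      using d[rule_format, OF n L(1) j(1)] j(2) by blast
    show "reach n S r (blen n ^ d) ?Q"
    proof (rule reach_certified[OF L(1) S L(2) W])
      fix r' assume r': "r \<subseteq> r'" and f: "forced n r' (\<lambda>L. \<forall>i<j. F L (case_nat i e))"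
      show "?Q r'"
      proof (cases "j = ?m")
        case True
        then show ?thesis using f unfolding forced_def by (simp add: less_Suc_eq_le)
      next
        case False
        \<comment> \<open>An order above r' satisfying case j would satisfy all cases below j + 1,
          against the maximality of j. Hence every such order refutes case j, which is therefore a
          forced counterexample.\<close>
        have "\<not> F L' (case_nat j e)" if L': "L' \<in> LO n" "r' \<subseteq> L'" for L'
        proof
          assume "F L' (case_nat j e)"
          moreover have "\<forall>i<j. F L' (case_nat i e)" using f L' unfolding forced_def by blast
          ultimately have "\<forall>i<Suc j. F L' (case_nat i e)" by (simp add: less_Suc_eq)
          moreover have "r \<subseteq> L'" using r' L'(2) by blast
          moreover have "Suc j \<le> ?m" using j(1) False by simp
          ultimately have "Suc j \<in> J" using L'(1) unfolding J_def by blast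
          then show False using J(2)[of "Suc j"] unfolding j_def by simp
        qed
        then have "forced n r' (\<lambda>L. \<not> F L (case_nat j e))" unfolding forced_def by blast
        then show ?thesis using j(1) False by (intro disjI2 exI[of _ j]) simp
      qed
    qed
  qed
qed

text \<open>The disjuncts follow \<open>PHP\<close>, but with the quantifiers outside the forcing:
  the witnesses have to be fixed by a single condition.\<close>

definition php_failure :: "nat \<Rightarrow> nat \<Rightarrow> nat \<Rightarrow> (nat \<Rightarrow> nat \<Rightarrow> (nat \<times> nat) set \<Rightarrow> bool) \<Rightarrow> (nat \<times> nat) set \<Rightarrow> bool" where
  "php_failure n u v F r \<longleftrightarrow>
    (\<exists>x<u. \<forall>y<v. forced n r (\<lambda>L. \<not> F x y L)) \<or>
    (\<exists>x<u. \<exists>x'<u. x \<noteq> x' \<and> (\<exists>y<v. forced n r (F x y) \<and> forced n r (F x' y))) \<or>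
    (\<exists>x<u. \<exists>y<v. \<exists>y'<v. y \<noteq> y' \<and> forced n r (F x y) \<and> forced n r (F x y'))"

text \<open>If no small extension of r refutes the pigeonhole instance, then F is total over every
  order L extending r.  Indeed, suppose x has no value over L.  Starting from the field of r, repeatedly
  enlarge a set T by the certificate of some value y of x over an order that agrees with L on T, and by a
  certificate that y is not the value of x over L.  Certificates of different values of x are
  incompatible, hence after m rounds each certificate of a value of x that is compatible with L on T
  meets T in at least m points.  With more than k rounds this contradicts the size of certificates.\<close>

lemma reach_php_failure:
  assumes certF: "\<And>x y L. x < u \<Longrightarrow> y < v \<Longrightarrow> L \<in> LO n \<Longrightarrow> F x y L \<Longrightarrow> \<exists>W. card W \<le> k \<and> certifies n (F x y) W L"
    and certN: "\<And>x y L. x < u \<Longrightarrow> y < v \<Longrightarrow> L \<in> LO n \<Longrightarrow> \<not> F x y L \<Longrightarrow>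
      \<exists>W. card W \<le> k \<and> certifies n (\<lambda>L. \<not> F x y L) W L"
    and uv: "v < u" and S: "S \<subseteq> {..<n}" "lin S r" and b: "2 * k * (k + 2) \<le> b"
  shows "reach n S r b (php_failure n u v F)"
proof (rule ccontr)
  assume no: "\<not> reach n S r b (php_failure n u v F)"
  have nofail: "\<not> php_failure n u v F (L \<inter> (S \<union> W) \<times> (S \<union> W))"
    if "L \<in> LO n" "r \<subseteq> L" "W \<subseteq> {..<n}" "card W \<le> b" for L W
    using no reachI[OF that(1) S that(2,3,4)] by blast
  have kb: "k + k \<le> b" using b by (simp add: algebra_simps) 
  \<comment> \<open>Two clashing certificates over one order would force the second or third
    disjunct of \<open>php_failure\<close>. The last premise covers both kinds of clash: two pigeons
    in one hole, two holes for one pigeon.\<close>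
  have pair: "certifies n (F x y) W L \<Longrightarrow> certifies n (F x' y') V L \<Longrightarrow> card W \<le> k \<Longrightarrow> card V \<le> k \<Longrightarrow>
      L \<in> LO n \<Longrightarrow> r \<subseteq> L \<Longrightarrow> x < u \<Longrightarrow> x' < u \<Longrightarrow> y < v \<Longrightarrow> y' < v \<Longrightarrow> (x \<noteq> x' \<longleftrightarrow> y = y') \<Longrightarrow> False"
    for x y x' y' W V L
  proof -
    assume A: "certifies n (F x y) W L" "certifies n (F x' y') V L" "card W \<le> k" "card V \<le> k"
      "L \<in> LO n" "r \<subseteq> L" "x < u" "x' < u" "y < v" "y' < v" "x \<noteq> x' \<longleftrightarrow> y = y'"
    let ?T = "S \<union> (W \<union> V)"
    have WV: "W \<union> V \<subseteq> {..<n}" using A(1,2) unfolding certifies_def by blast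
    have "forced n (L \<inter> ?T \<times> ?T) (F x y)" "forced n (L \<inter> ?T \<times> ?T) (F x' y')"
      using certifies_forced[OF A(5) _ A(1), of ?T] certifies_forced[OF A(5) _ A(2), of ?T] S(1) WV by auto
    then have "php_failure n u v F (L \<inter> ?T \<times> ?T)"
      unfolding php_failure_def using A(7-11) by blast
    moreover have "card (W \<union> V) \<le> b" using card_Un_le[of W V] A(3,4) kb by linarith
    ultimately show False using nofail[OF A(5,6) WV] by blast
  qed
  have total: "\<exists>y<v. F x y L" if L: "L \<in> LO n" "r \<subseteq> L" and x: "x < u" for L x
  proof (rule ccontr)
    assume "\<not> (\<exists>y<v. F x y L)"
    then have none: "\<not> F x y L" if "y < v" for y using that by blast
    \<comment> \<open>L restricted to S and T does not force x to be without a value, as that is the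
      first disjunct of \<open>php_failure\<close>. So some order agreeing with L there gives x a
      value.\<close>
    have step: "\<exists>y K W. y < v \<and> K \<in> LO n \<and> agree (S \<union> T) L K \<and> card W \<le> k \<and> certifies n (F x y) W K"
      if T: "T \<subseteq> {..<n}" "card T \<le> b" for T
    proof -
      have "S \<union> T \<subseteq> {..<n}" using S T by simp
      then obtain y K where K: "y < v" "K \<in> LO n" "agree (S \<union> T) L K" "F x y K"
        using nofail[OF L T] x unfolding php_failure_def forced_restrict_iff[OF L(1) \<open>S \<union> T \<subseteq> {..<n}\<close>] by blast
      then show ?thesis using certF[OF x K(1,2,4)] by blast
    qed
    \<comment> \<open>Each round adds two certificates of at most k points, whence the bound
      \<open>2 * k * m\<close>.\<close>
    have "\<exists>T\<subseteq>{..<n}. card T \<le> 2 * k * m \<and> (\<forall>y K W. y < v \<longrightarrow> K \<in> LO n \<longrightarrow> agree (S \<union> T) L K \<longrightarrow>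
        card W \<le> k \<longrightarrow> certifies n (F x y) W K \<longrightarrow> m \<le> card (W \<inter> T))" if "m \<le> k + 1" for m
      using that
    proof (induction m)
      case 0
      show ?case by (intro exI[of _ "{}"]) simp
    next
      case (Suc m)
      then obtain T where T: "T \<subseteq> {..<n}" "card T \<le> 2 * k * m" and
        IH: "\<And>y K W. y < v \<Longrightarrow> K \<in> LO n \<Longrightarrow> agree (S \<union> T) L K \<Longrightarrow>
          card W \<le> k \<Longrightarrow> certifies n (F x y) W K \<Longrightarrow> m \<le> card (W \<inter> T)" by auto
      have "2 * k * m \<le> 2 * k * (k + 2)" using Suc.prems by (intro mult_le_mono) auto
      then have "card T \<le> b" using T(2) b by linarith
      then obtain y1 K1 W1 where K1: "y1 < v" "K1 \<in> LO n" "agree (S \<union> T) L K1" "card W1 \<le> k"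
        "certifies n (F x y1) W1 K1" using step[OF T(1)] by blast
      obtain V1 where V1: "card V1 \<le> k" "certifies n (\<lambda>L. \<not> F x y1 L) V1 L"
        using certN[OF x K1(1) L(1) none[OF K1(1)]] by blast
      have sub: "W1 \<subseteq> {..<n}" "V1 \<subseteq> {..<n}" using K1(5) V1(2) unfolding certifies_def by blast+
      let ?T = "T \<union> (W1 \<union> V1)"
      have "card ?T \<le> 2 * k * m + (k + k)"
        using card_Un_le[of T "W1 \<union> V1"] card_Un_le[of W1 V1] T(2) K1(4) V1(1) by linarith
      then have cT: "card ?T \<le> 2 * k * Suc m" by (simp add: algebra_simps)
      have "Suc m \<le> card (W2 \<inter> ?T)" if K2: "y2 < v" "K2 \<in> LO n" "agree (S \<union> ?T) L K2" "card W2 \<le> k"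
        "certifies n (F x y2) W2 K2" for y2 K2 W2
      proof (rule ccontr)
        assume "\<not> Suc m \<le> card (W2 \<inter> ?T)"
        then have le: "card (W2 \<inter> ?T) \<le> m" by simp
        have "W2 \<subseteq> {..<n}" using K2(5) unfolding certifies_def by blast
        then have fin: "finite (W2 \<inter> ?T)" "finite W2" using finite_subset by auto
        have aT: "agree (S \<union> T) L K2" using K2(3) by (rule agree_mono) auto
        have "m \<le> card (W2 \<inter> T)" using IH[OF K2(1,2) aT K2(4,5)] .
        \<comment> \<open>By the induction hypothesis \<open>W2\<close> meets T in m points already.
          If it met the enlarged set in no more, it would avoid the new points of \<open>W1\<close>,
          and \<open>K1\<close> and \<open>K2\<close> could be amalgamated into an order respecting
          both certificates.\<close>
        then have "W2 \<inter> T = W2 \<inter> ?T" using le fin by (intro card_seteq) auto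
        then have "(S \<union> T \<union> W1) \<inter> (S \<union> T \<union> W2) \<subseteq> S \<union> T" by blast
        moreover have "agree (S \<union> T) K1 K2" using K1(3) aT agree_sym agree_trans by blast
        ultimately have "agree ((S \<union> T \<union> W1) \<inter> (S \<union> T \<union> W2)) K1 K2" using agree_mono by blast
        then obtain K3 where K3: "K3 \<in> LO n" "agree (S \<union> T \<union> W1) K1 K3" "agree (S \<union> T \<union> W2) K2 K3"
          using LO_amalgam[OF K1(2) K2(2), of "S \<union> T \<union> W1" "S \<union> T \<union> W2"] S(1) T(1) sub \<open>W2 \<subseteq> {..<n}\<close> by auto
        have "agree W1 K1 K3" "agree W2 K2 K3" using K3(2,3) agree_mono by blast+
        then have c3: "certifies n (F x y1) W1 K3" "certifies n (F x y2) W2 K3"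
          using K1(5) K2(5) agree_trans unfolding certifies_def by blast+
        have "agree S K2 K3" "agree S L K2" using K3(3) K2(3) agree_mono by blast+
        then have "agree S L K3" using agree_trans by blast
        then have "r \<subseteq> K3" using L(2) S(2) unfolding agree_def lin_def by blast
        \<comment> \<open>The two values differ: \<open>K2\<close> agrees with L on
          \<open>V1\<close>, which certifies that \<open>y1\<close> is not a value of x, whereas
          \<open>y2\<close> is one over \<open>K2\<close>.\<close>
        have "agree V1 L K2" using K2(3) agree_mono by blast
        then have "\<not> F x y1 K2" using V1(2) K2(2) unfolding certifies_def by blast
        moreover have "F x y2 K2" using K2(2,5) agree_refl unfolding certifies_def by blast
        ultimately have "y1 \<noteq> y2" by blast
        then show False
          using pair[OF c3 K1(4) K2(4) K3(1) \<open>r \<subseteq> K3\<close> x x K1(1) K2(1)] by blast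
      qed
      moreover have "?T \<subseteq> {..<n}" using T(1) sub by auto
      ultimately show ?case using cT by (intro exI[of _ ?T]) blast
    qed
    \<comment> \<open>After k + 1 rounds a certificate of at most k points would have to meet T in k
      + 1 points.\<close>
    from this[of "k + 1"] obtain T where T: "T \<subseteq> {..<n}" "card T \<le> 2 * k * (k + 1)" and
      big: "\<And>y K W. y < v \<Longrightarrow> K \<in> LO n \<Longrightarrow> agree (S \<union> T) L K \<Longrightarrow>
          card W \<le> k \<Longrightarrow> certifies n (F x y) W K \<Longrightarrow> k + 1 \<le> card (W \<inter> T)" by auto
    have "card T \<le> b" using T(2) b by (simp add: algebra_simps)
    then obtain y K W where K: "y < v" "K \<in> LO n" "agree (S \<union> T) L K" "card W \<le> k" "certifies n (F x y) W K"
      using step[OF T(1)] by blast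
    have "finite W" using K(5) finite_subset unfolding certifies_def by blast
    then have "card (W \<inter> T) \<le> k" using card_mono[of W "W \<inter> T"] K(4) by simp
    then show False using big[OF K] by simp
  qed
  obtain L where L: "L \<in> LO n" "r \<subseteq> L" using LO_extend[OF S] by blast
  obtain f where f: "\<And>x. x < u \<Longrightarrow> f x < v \<and> F x (f x) L" using total[OF L] by metis
  \<comment> \<open>The finite pigeonhole principle for the map of values over one order L; a
    collision gives two clashing certificates over L.\<close>
  have "\<not> inj_on f {..<u}"
  proof
    assume "inj_on f {..<u}"
    moreover have "f ` {..<u} \<subseteq> {..<v}" using f by auto
    ultimately have "u \<le> v" using card_inj_on_le[of f "{..<u}" "{..<v}"] by simp
    then show False using uv by simp
  qed
  then obtain x x' where x: "x < u" "x' < u" "x \<noteq> x'" "f x = f x'" unfolding inj_on_def by auto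
  obtain W where W: "card W \<le> k" "certifies n (F x (f x)) W L" using certF[OF x(1)] f[OF x(1)] L by blast
  obtain V where V: "card V \<le> k" "certifies n (F x' (f x')) V L" using certF[OF x(2)] f[OF x(2)] L by blast
  show False using pair[OF W(2) V(2) W(1) V(1) L x(1,2)] f x by auto
qed

lemma reach_php:
  assumes "certifiable F" "certifiable (\<lambda>L e. \<not> F L e)"
  shows "\<exists>d. \<forall>n\<ge>2. \<forall>e. bounded n c e \<longrightarrow> (\<forall>S r u v. S \<subseteq> {..<n} \<longrightarrow> lin S r \<longrightarrow> v < u \<longrightarrow>
    u \<le> 2 ^ (blen n ^ c) \<longrightarrow> reach n S r (blen n ^ d) (php_failure n u v (\<lambda>(x::nat) (y::nat) L. F L (case_nat x (case_nat y e)))))"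
proof -
  obtain d1 where d1: "\<And>n e L. n \<ge> 2 \<Longrightarrow> bounded n c e \<Longrightarrow> L \<in> LO n \<Longrightarrow> F L e \<Longrightarrow>
     \<exists>W. card W \<le> blen n ^ d1 \<and> certifies n (\<lambda>L. F L e) W L"
    by (rule certifiableD[OF assms(1)], rule that) blast
  obtain d2 where d2: "\<And>n e L. n \<ge> 2 \<Longrightarrow> bounded n c e \<Longrightarrow> L \<in> LO n \<Longrightarrow> \<not> F L e \<Longrightarrow>
     \<exists>W. card W \<le> blen n ^ d2 \<and> certifies n (\<lambda>L. \<not> F L e) W L"
    by (rule certifiableD[OF assms(2)], rule that) blast
  \<comment> \<open>Twice the exponent \<open>2 + d1 + d2\<close>: both 2k and k + 2 are at most
    |n|^2 times k, because |n| is at least 2 and k at least 1.\<close>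
  let ?D = "d1 + d2 + (d1 + d2) + 4"
  show ?thesis
  proof (intro exI[of _ ?D] allI impI)
    fix n u v :: nat and e S r
    assume n: "2 \<le> n" and e: "bounded n c e" and S: "S \<subseteq> {..<n}" "lin S r" and uv: "v < u" "u \<le> 2 ^ (blen n ^ c)"
    let ?k = "blen n ^ (d1 + d2)" and ?F = "\<lambda>(x::nat) (y::nat) L. F L (case_nat x (case_nat y e))"
    have b: "bounded n c (case_nat x (case_nat y e))" if "x < u" "y < v" for x y
      using that uv by (intro bounded_case_nat e) simp_all
    have k: "blen n ^ d1 \<le> ?k" "blen n ^ d2 \<le> ?k" using blen_power_mono[OF n] by auto
    have N: "2 \<le> blen n" using blen_ge2[OF n] .
    have k1: "1 \<le> ?k" using N by simp
    have "?k + 2 \<le> 4 * ?k" using k1 by linarith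
    moreover have "4 \<le> blen n ^ 2" using mult_le_mono[OF N N] by (simp add: power2_eq_square)
    ultimately have "?k + 2 \<le> blen n ^ 2 * ?k" by (meson le_trans mult_le_mono1)
    moreover have "2 \<le> blen n ^ 2" using \<open>4 \<le> blen n ^ 2\<close> by simp
    then have "2 * ?k \<le> blen n ^ 2 * ?k" by (rule mult_le_mono1)
    ultimately have "2 * ?k * (?k + 2) \<le> (blen n ^ 2 * ?k) * (blen n ^ 2 * ?k)" using mult_le_mono by blast
    also have "\<dots> = blen n ^ (2 + (d1 + d2) + (2 + (d1 + d2)))" by (simp only: power_add)
    also have "2 + (d1 + d2) + (2 + (d1 + d2)) = ?D" by simp
    finally have le: "2 * ?k * (?k + 2) \<le> blen n ^ ?D" .
    show "reach n S r (blen n ^ ?D) (php_failure n u v ?F)"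
    proof (rule reach_php_failure[OF _ _ uv(1) S le])
      fix x y L assume xy: "x < u" "y < v" "L \<in> LO n" 
      show "?F x y L \<Longrightarrow> \<exists>W. card W \<le> ?k \<and> certifies n (?F x y) W L"
        using d1[OF n b[OF xy(1,2)] xy(3)] le_trans[OF _ k(1)] by blast
      show "\<not> ?F x y L \<Longrightarrow> \<exists>W. card W \<le> ?k \<and> certifies n (\<lambda>L. \<not> ?F x y L) W L"
        using d2[OF n b[OF xy(1,2)] xy(3)] le_trans[OF _ k(2)] by blast
    qed
  qed
qed

section \<open>Soundness of S12 over the standard numbers\<close>

lemma blen_rec: "x \<noteq> 0 \<Longrightarrow> blen x = blen (x div 2) + 1"
  using compute_floorlog[of 2 x] by simp

lemma BASIC_sound:
  assumes "p \<in> BASIC"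
  shows "sat std R e p"
proof -
  have double: "blen (x * 2) = blen x + 1" "blen (x * 2 + 1) = blen x + 1" if "0 < x" for x :: nat
    using blen_rec[of "x * 2"] blen_rec[of "x * 2 + 1"] that by simp_all
  have "blen 0 = 0" by (simp add: floorlog_def)
  show ?thesis
    using assms unfolding BASIC_def Let_def Iff_def
    apply (elim insertE emptyE)
    apply (simp_all add: blen_pow2 floorlog_mono power_add distrib_left mult.commute blen_1 double
        \<open>blen 0 = 0\<close> del: One_nat_def)
    subgoal by linarith
    subgoal using blen_rec[of "e 0"] by simp
    subgoal by presburger
    done
qed

lemma sat_lift: "sat A R (case_nat a e) (lift p) \<longleftrightarrow> sat A R e p"
  by (simp add: lift_def sat_subst)

lemma sat_inst: "sat A R e (inst t p) \<longleftrightarrow> sat A R (case_nat (tval A e t) e) p"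
proof -
  have "(\<lambda>i. tval A e (case_nat t Var i)) = case_nat (tval A e t) e"
    by (rule ext) (simp split: nat.split)
  then show ?thesis by (simp add: inst_def sat_subst)
qed

lemma sat_subst0: "sat A R (case_nat a e) (subst0 t p) \<longleftrightarrow> sat A R (case_nat (tval A (case_nat a e) t) e) p"
proof -
  have "(\<lambda>i. tval A (case_nat a e) ((Var(0 := t)) i)) = case_nat (tval A (case_nat a e) t) e"
    by (rule ext) (simp split: nat.split)
  then show ?thesis by (simp add: subst0_def sat_subst)
qed

text \<open>Over the standard numbers the scheme holds for every p and R, by well-founded induction
  along a div 2 < a. Hence any order may interpret \<open>Prec\<close> in the soundness
  argument.\<close>

lemma PIND_sound: "sat std R e (PIND p)"
proof -
  have *: "sat std R (case_nat a e) p"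
    if "sat std R (case_nat 0 e) p" "\<And>a. sat std R (case_nat (a div 2) e) p \<Longrightarrow> sat std R (case_nat a e) p" for a
  proof (induction a rule: less_induct)
    case (less a)
    show ?case
    proof (cases "a = 0")
      case True
      show ?thesis unfolding True by (rule that(1))
    next
      case False
      then have "a div 2 < a" by simp
      then show ?thesis by (rule that(2)[OF less])
    qed
  qed
  show ?thesis
    unfolding PIND_def sat.simps sat_inst sat_subst0 tval.simps std_simps nat.case
    by (intro impI ballI, elim conjE, rule *, assumption) blast
qed

lemma prop_eval_sat: "prop_eval (sat A R e) p \<longleftrightarrow> sat A R e p"
  by (induction p) simp_all

lemma provable_sound:
  assumes "provable T p" "\<And>p R e. p \<in> T \<Longrightarrow> sat std R e p"
  shows "sat std R e p"
  using assms(1)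
proof (induction arbitrary: e)
  case (Ax p)
  then show ?case by (rule assms(2))
next
  case (Taut p)
  \<comment> \<open>Satisfaction is itself one of the assignments over which
    \<open>tautology\<close> quantifies.\<close>
  then have "prop_eval (sat std R e) p" unfolding tautology_def ..
  then show ?case by (simp add: prop_eval_sat)
qed (auto simp: sat_inst sat_lift)

lemma S12_sound: "provable S12 p \<Longrightarrow> sat std R e p"
proof (erule provable_sound)
  fix p R e assume "p \<in> S12"
  then show "sat std R e p" using BASIC_sound PIND_sound unfolding S12_def by blast
qed

text \<open>By soundness, the \<open>Sigma_b1\<close> formula q defines the complement of p over the
  standard numbers with any order.\<close>

lemma Delta_b1_certifiable:
  assumes "Delta_b1 p"
  shows "certifiable (sem p)" "certifiable (\<lambda>L e. \<not> sem p L e)"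
proof -
  obtain q where q: "Sigma_b1 p" "Sigma_b1 q" "provable S12 (Iff p (Neg q))"
    using assms unfolding Delta_b1_def by blast
  show "certifiable (sem p)" using Sigma_b1_certifiable q(1) by blast
  have "sem q = (\<lambda>L e. \<not> sem p L e)"
    using S12_sound[OF q(3)] by (intro ext) (auto simp: Iff_def)
  then show "certifiable (\<lambda>L e. \<not> sem p L e)" using Sigma_b1_certifiable[OF q(2)] by simp
qed

section \<open>Coded orders\<close>

text \<open>The counterpart of \<open>prec\<close> for a sequence given by its code; using the graph
  \<open>beta\<close> in place of an entry function makes it directly expressible by a
  formula.\<close>

definition rel :: "'a arith \<Rightarrow> 'a \<Rightarrow> 'a \<Rightarrow> 'a \<Rightarrow> ('a \<times> 'a) set" where
  "rel A l a b = {(r, r'). \<exists>j\<in>below A l. \<exists>i\<in>below A j. beta A a b i r \<and> beta A a b j r'}"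

definition code :: "'a arith \<Rightarrow> 'a \<Rightarrow> 'a \<Rightarrow> 'a \<Rightarrow> 'a \<Rightarrow> bool" where
  "code A n l a b \<longleftrightarrow> (\<forall>i\<in>below A l. \<exists>r\<in>below A n. beta A a b i r) \<and>
    (\<forall>i\<in>below A l. \<forall>j\<in>below A l. \<forall>r\<in>carr A. beta A a b i r \<longrightarrow> beta A a b j r \<longrightarrow> i = j)"

text \<open>Over the standard numbers the codes of length n are those of enumerations of all numbers
  below n, so the quantifier ranges over total orders. The codes a and b are taken from all of A,
  not from the cut.\<close>

definition forces :: "'a arith \<Rightarrow> 'a \<Rightarrow> ('a \<times> 'a) set \<Rightarrow> (nat \<Rightarrow> 'a) \<Rightarrow> fm \<Rightarrow> bool" where
  "forces A n P e p \<longleftrightarrow>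
    (\<forall>a\<in>carr A. \<forall>b\<in>carr A. code A n n a b \<longrightarrow> P \<subseteq> rel A n a b \<longrightarrow> sat A (rel A n a b) e p)"

lemma forces_mono: "forces A n P e p \<Longrightarrow> P \<subseteq> P' \<Longrightarrow> forces A n P' e p"
  unfolding forces_def by blast

definition extendable ::
  "'a arith \<Rightarrow> 'a \<Rightarrow> 'a \<Rightarrow> 'a \<Rightarrow> 'a \<Rightarrow> nat \<Rightarrow> ('a \<Rightarrow> 'a \<Rightarrow> 'a \<Rightarrow> bool) \<Rightarrow> bool" where
  "extendable A n l a b d Q \<longleftrightarrow> (\<exists>l'\<in>carr A. \<exists>a'\<in>carr A. \<exists>b'\<in>carr A.
    le A l' (add A l (pow A (len A n) d)) \<and> code A n l' a' b' \<and> rel A l a b \<subseteq> rel A l' a' b' \<and> Q l' a' b')"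

text \<open>The language has no exponentiation; the bound 2^(|n|^c) is written 1 # z with z of
  length |n|^c.\<close>

definition bd :: "'a arith \<Rightarrow> 'a \<Rightarrow> nat \<Rightarrow> 'a \<Rightarrow> bool" where
  "bd A n c x \<longleftrightarrow> (\<exists>z\<in>carr A. len A z = pow A (len A n) c \<and> le A x (smash A (one A) z))"

text \<open>The conjunct \<open>Exists (Eq (Var 0) (tlift r))\<close> says that r denotes an element
  of the carrier, as \<open>beta\<close> demands; with it \<open>sat_fBeta\<close> holds for every
  valuation.\<close>

definition fBeta :: "tm \<Rightarrow> tm \<Rightarrow> tm \<Rightarrow> tm \<Rightarrow> fm" where
  "fBeta a b i r = (let d = Add One (Mul (Add i One) b) in
    And (Exists (Eq (Var 0) (tlift r)))
      (And (Lt r d) (Exists (Eq (tlift a) (Add (Mul (Var 0) (tlift d)) (tlift r))))))"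

definition fRel :: "tm \<Rightarrow> tm \<Rightarrow> tm \<Rightarrow> tm \<Rightarrow> tm \<Rightarrow> fm" where
  "fRel l a b s t = Exists_lt l (Exists_lt (Var 0)
    (And (fBeta (tlift (tlift a)) (tlift (tlift b)) (Var 0) (tlift (tlift s)))
         (fBeta (tlift (tlift a)) (tlift (tlift b)) (Var 1) (tlift (tlift t)))))"

definition fCode :: "tm \<Rightarrow> tm \<Rightarrow> tm \<Rightarrow> tm \<Rightarrow> fm" where
  "fCode n l a b = And
    (Forall_lt l (Exists_lt (tlift n) (fBeta (tlift (tlift a)) (tlift (tlift b)) (Var 1) (Var 0))))
    (Forall_lt l (Forall_lt (tlift l) (Forall
      (Imp (fBeta (tlift (tlift (tlift a))) (tlift (tlift (tlift b))) (Var 2) (Var 0))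
      (Imp (fBeta (tlift (tlift (tlift a))) (tlift (tlift (tlift b))) (Var 1) (Var 0))
           (Eq (Var 2) (Var 1)))))))"

definition fSub :: "tm \<Rightarrow> tm \<Rightarrow> tm \<Rightarrow> tm \<Rightarrow> tm \<Rightarrow> tm \<Rightarrow> fm" where
  "fSub l a b l' a' b' = Forall (Forall (Imp
    (fRel (tlift (tlift l)) (tlift (tlift a)) (tlift (tlift b)) (Var 1) (Var 0))
    (fRel (tlift (tlift l')) (tlift (tlift a')) (tlift (tlift b')) (Var 1) (Var 0))))"

text \<open>Replacing \<open>Prec\<close> by the relation of a code yields a formula of pure
  arithmetic, to which true arithmetic applies.\<close>

primrec coded :: "fm \<Rightarrow> tm \<Rightarrow> tm \<Rightarrow> tm \<Rightarrow> fm" where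
  "coded (Eq s t) l a b = Eq s t"
| "coded (Le s t) l a b = Le s t"
| "coded (Prec s t) l a b = fRel l a b s t"
| "coded (Neg p) l a b = Neg (coded p l a b)"
| "coded (And p q) l a b = And (coded p l a b) (coded q l a b)"
| "coded (Or p q) l a b = Or (coded p l a b) (coded q l a b)"
| "coded (Imp p q) l a b = Imp (coded p l a b) (coded q l a b)"
| "coded (Forall p) l a b = Forall (coded p (tlift l) (tlift a) (tlift b))"
| "coded (Exists p) l a b = Exists (coded p (tlift l) (tlift a) (tlift b))"

text \<open>The substitution \<open>\<sigma>\<close> relocates the free variables of p, which in
  applications stand among variables for the code and for witnesses.\<close>

definition fForces :: "tm \<Rightarrow> tm \<Rightarrow> tm \<Rightarrow> tm \<Rightarrow> (nat \<Rightarrow> tm) \<Rightarrow> fm \<Rightarrow> fm" where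
  "fForces n l a b \<sigma> p = Forall (Forall (Imp (fCode (tlift (tlift n)) (tlift (tlift n)) (Var 1) (Var 0))
    (Imp (fSub (tlift (tlift l)) (tlift (tlift a)) (tlift (tlift b)) (tlift (tlift n)) (Var 1) (Var 0))
      (coded (subst (\<lambda>i. tlift (tlift (\<sigma> i))) p) (tlift (tlift n)) (Var 1) (Var 0)))))"

primrec fPow :: "tm \<Rightarrow> nat \<Rightarrow> tm" where
  "fPow t 0 = One"
| "fPow t (Suc c) = Mul (fPow t c) t"

definition fBd :: "tm \<Rightarrow> nat \<Rightarrow> tm \<Rightarrow> fm" where
  "fBd n c t = Exists (And (Eq (Len (Var 0)) (fPow (Len (tlift n)) c)) (Le (tlift t) (Smash One (Var 0))))"

primrec fConj :: "(nat \<Rightarrow> fm) \<Rightarrow> nat \<Rightarrow> fm" where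
  "fConj F 0 = Eq Zero Zero"
| "fConj F (Suc k) = And (fConj F k) (F k)"

text \<open>The free variables 0 to 3 stand for b, a, l and n.  In Q the extended order comes first, followed
  by n and the parameters.\<close>

definition fExtendable :: "nat \<Rightarrow> fm \<Rightarrow> fm" where
  "fExtendable d Q = Exists (Exists (Exists (And (Le (Var 2) (Add (Var 5) (fPow (Len (Var 6)) d)))
    (And (fCode (Var 6) (Var 2) (Var 1) (Var 0)) (And (fSub (Var 5) (Var 4) (Var 3) (Var 2) (Var 1) (Var 0))
      (subst (case_nat (Var 0) (case_nat (Var 1) (case_nat (Var 2) (\<lambda>i. Var (i + 6))))) Q))))))"

section \<open>Semantics of the arithmetized notions in an arbitrary structure\<close>

lemma sat_Lt: "sat A R e (Lt s t) \<longleftrightarrow> le A (tval A e s) (tval A e t) \<and> tval A e s \<noteq> tval A e t"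
  by (simp add: Lt_def)

lemma sat_Forall_lt: "sat A R e (Forall_lt t p) \<longleftrightarrow> (\<forall>a\<in>below A (tval A e t). sat A R (case_nat a e) p)"
  by (auto simp: Forall_lt_def sat_Lt below_def)

lemma sat_Exists_lt: "sat A R e (Exists_lt t p) \<longleftrightarrow> (\<exists>a\<in>below A (tval A e t). sat A R (case_nat a e) p)"
  by (auto simp: Exists_lt_def sat_Lt below_def)

lemma sat_fBeta: "sat A R e (fBeta a b i r) \<longleftrightarrow> beta A (tval A e a) (tval A e b) (tval A e i) (tval A e r)"
  by (auto simp: fBeta_def beta_def Let_def sat_Lt below_def tlift_def tval_tsubst)

lemma sat_fRel: "sat A R e (fRel l a b s t) \<longleftrightarrow>
    (tval A e s, tval A e t) \<in> rel A (tval A e l) (tval A e a) (tval A e b)"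
  by (simp add: fRel_def sat_Exists_lt sat_fBeta rel_def eval_nat_numeral)

lemma beta_carr: "beta A a b i r \<Longrightarrow> r \<in> carr A"
  by (simp add: beta_def below_def Let_def)

lemma sat_fCode: "sat A R e (fCode n l a b) \<longleftrightarrow> code A (tval A e n) (tval A e l) (tval A e a) (tval A e b)"
  by (simp add: fCode_def code_def sat_Exists_lt sat_Forall_lt sat_fBeta eval_nat_numeral)

lemma sat_fSub: "sat A R e (fSub l a b l' a' b') \<longleftrightarrow>
    rel A (tval A e l) (tval A e a) (tval A e b) \<subseteq> rel A (tval A e l') (tval A e a') (tval A e b')"
proof -
  have "rel A l a b \<subseteq> carr A \<times> carr A" for l a b
    using beta_carr unfolding rel_def by fastforce
  then have "rel A l a b \<subseteq> R \<longleftrightarrow> (\<forall>r\<in>carr A. \<forall>r'\<in>carr A. (r, r') \<in> rel A l a b \<longrightarrow> (r, r') \<in> R)" for l a b R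
    by blast
  then show ?thesis by (simp add: fSub_def sat_fRel)
qed

lemma sat_coded: "sat A R e (coded p l a b) \<longleftrightarrow> sat A (rel A (tval A e l) (tval A e a) (tval A e b)) e p"
  by (induction p arbitrary: e l a b) (simp_all add: sat_fRel)

lemma sat_fForces: "sat A R e (fForces n l a b \<sigma> p) \<longleftrightarrow>
    forces A (tval A e n) (rel A (tval A e l) (tval A e a) (tval A e b)) (\<lambda>i. tval A e (\<sigma> i)) p"
  by (simp add: fForces_def forces_def sat_fCode sat_fSub sat_coded sat_subst)

lemma tval_fPow [simp]: "tval A e (fPow t c) = pow A (tval A e t) c"
  by (induction c) simp_all

lemma sat_fBd: "sat A R e (fBd n c t) \<longleftrightarrow> bd A (tval A e n) c (tval A e t)"
  by (simp add: fBd_def bd_def)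

lemma sat_fConj: "sat A R e (fConj F k) \<longleftrightarrow> (\<forall>i<k. sat A R e (F i))"
  by (induction k) (auto simp: less_Suc_eq)

lemma case_nat_3: "(\<lambda>i. tval A (case_nat x (case_nat y (case_nat z e)))
    (case i of 0 \<Rightarrow> Var 0 | Suc i \<Rightarrow> (case i of 0 \<Rightarrow> Var 1 | Suc i \<Rightarrow> (case i of 0 \<Rightarrow> Var 2 | Suc i \<Rightarrow> Var (i + 6))))) =
   case_nat x (case_nat y (case_nat z (\<lambda>i. e (i + 3))))"
  by (rule ext) (simp add: eval_nat_numeral split: nat.split)

lemma sat_fExtendable: "sat A R (case_nat b (case_nat a (case_nat l (case_nat n e)))) (fExtendable d Q) \<longleftrightarrow>
    extendable A n l a b d (\<lambda>l' a' b'. sat A R (case_nat b' (case_nat a' (case_nat l' (case_nat n e)))) Q)"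
proof -
  have "(\<lambda>i. case_nat b (case_nat a (case_nat l (case_nat n e))) (i + 3)) = case_nat n e"
    by (rule ext) (simp add: eval_nat_numeral)
  then show ?thesis
    by (simp only: fExtendable_def extendable_def sat.simps sat_subst case_nat_3 sat_fCode sat_fSub)
      (simp add: eval_nat_numeral)
qed

lemma prec_free_simps [simp]:
  "prec_free (Lt s t)"
  "prec_free (fBeta a b i r)"
  "prec_free (Exists_lt t p) = prec_free p" "prec_free (Forall_lt t p) = prec_free p"
  "prec_free (Exists_le t p) = prec_free p" "prec_free (Forall_le t p) = prec_free p"
  by (simp_all add: Lt_def fBeta_def Let_def Exists_lt_def Forall_lt_def Exists_le_def Forall_le_def)

lemma prec_free_code [simp]:
  "prec_free (fRel l a b s t)" "prec_free (fCode n l a b)" "prec_free (fSub l a b l' a' b')" "prec_free (fBd n c t)"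
  by (simp_all add: fRel_def fCode_def fSub_def fBd_def)

lemma prec_free_coded [simp]: "prec_free (coded p l a b)"
  by (induction p arbitrary: l a b) simp_all

lemma prec_free_subst [simp]: "prec_free (subst \<sigma> p) = prec_free p"
  by (induction p arbitrary: \<sigma>) simp_all

lemma prec_free_fForces [simp]: "prec_free (fForces n l a b \<sigma> p)"
  by (simp add: fForces_def)

lemma prec_free_fConj [simp]: "(\<And>i. prec_free (F i)) \<Longrightarrow> prec_free (fConj F k)"
  by (induction k) simp_all

lemma prec_free_fExtendable [simp]: "prec_free Q \<Longrightarrow> prec_free (fExtendable d Q)"
  by (simp add: fExtendable_def)

section \<open>Coded orders in the standard model\<close>

lemma below_std: "below std l = {..<l}"
  by (auto simp: below_def)

definition entry :: "nat \<Rightarrow> nat \<Rightarrow> nat \<Rightarrow> nat" where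
  "entry a b i = a mod (1 + (i + 1) * b)"

lemma beta_std: "beta std a b i r \<longleftrightarrow> r = entry a b i"
proof -
  let ?d = "1 + (i + 1) * b"
  have "(r < ?d \<and> (\<exists>q. a = q * ?d + r)) \<longleftrightarrow> r = a mod ?d"
  proof
    assume "r < ?d \<and> (\<exists>q. a = q * ?d + r)"
    then show "r = a mod ?d" by (metis mod_less mod_mult_self3)
  next
    assume "r = a mod ?d"
    then show "r < ?d \<and> (\<exists>q. a = q * ?d + r)"
      by (metis add_gr_0 div_mult_mod_eq less_one mod_less_divisor)
  qed
  then show ?thesis by (simp add: beta_def below_std Let_def entry_def)
qed

text \<open>Goedel's lemma: with b a suitable factorial the moduli are pairwise coprime, so the
  Chinese remainder theorem supplies a.\<close>

lemma beta_exists: "\<exists>a b. \<forall>i<l. entry a b i = f i"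
proof -
  \<comment> \<open>The sum is a cheap upper bound of all values \<open>f i\<close>. As m also
    exceeds l, every index difference j - i divides b = m!; a common divisor of two moduli is
    coprime to b yet divides (j - i) b, so it is a unit.\<close>
  define m where "m = Suc (l + (\<Sum>i<l. f i))"
  define b :: nat where "b = fact m"
  let ?d = "\<lambda>i. 1 + (i + 1) * b"
  have cop: "coprime (?d i) (?d j)" if ij: "i < j" "j < l" for i j
  proof (rule coprimeI)
    fix g assume g: "g dvd ?d i" "g dvd ?d j"
    have "(j - i) dvd b" unfolding b_def by (rule dvd_fact) (use ij m_def in auto)
    have "coprime (?d i) b"
      by (metis add.commute coprime_1_left coprime_iff_gcd_eq_1 gcd_add_mult mult.commute gcd.commute)
    then have gb: "coprime g b" using g(1) by (meson coprime_divisors dvd_refl)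
    have "g dvd ?d j - ?d i" by (rule dvd_diff_nat[OF g(2,1)])
    also have "?d j - ?d i = (j - i) * b" using ij(1) by (simp add: diff_mult_distrib)
    finally have "g dvd j - i" using gb by (simp add: coprime_dvd_mult_left_iff)
    then have "g dvd b" using \<open>(j - i) dvd b\<close> by (rule dvd_trans)
    then show "is_unit g" using gb by (meson coprime_absorb_left)
  qed
  have "\<forall>i\<in>{..<l}. \<forall>j\<in>{..<l}. i \<noteq> j \<longrightarrow> coprime (?d i) (?d j)"
    using cop by (metis coprime_commute lessThan_iff linorder_neqE_nat)
  then obtain a where a: "\<forall>i\<in>{..<l}. [a = f i] (mod ?d i)"
    using chinese_remainder_nat[of "{..<l}" ?d f] by auto
  have "entry a b i = f i" if "i < l" for i
  proof -
    have "f i \<le> (\<Sum>i<l. f i)" using that by (intro member_le_sum) auto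
    also have "\<dots> < m" unfolding m_def by simp
    also have "m \<le> b" unfolding b_def by (rule fact_ge_self)
    also have "b \<le> (i + 1) * b" by simp
    finally have "f i < ?d i" by simp
    moreover have "a mod ?d i = f i mod ?d i" using a that unfolding cong_def by simp
    ultimately show ?thesis unfolding entry_def by simp
  qed
  then show ?thesis by blast
qed

lemma rel_std: "rel std l a b = {(entry a b i, entry a b j) | i j. i < j \<and> j < l}"
  unfolding rel_def below_std beta_std by auto

lemma code_std: "code std n l a b \<longleftrightarrow> entry a b ` {..<l} \<subseteq> {..<n} \<and> inj_on (entry a b) {..<l}"
  unfolding code_def below_std beta_std inj_on_def by auto

lemma code_lin:
  assumes "code std n l a b"
  shows "lin (entry a b ` {..<l}) (rel std l a b)" "card (entry a b ` {..<l}) = l" "entry a b ` {..<l} \<subseteq> {..<n}"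
proof -
  let ?f = "entry a b"
  have inj: "?f i = ?f j \<longleftrightarrow> i = j" if "i < l" "j < l" for i j
    using assms that unfolding code_std inj_on_def by auto
  show "card (?f ` {..<l}) = l" using assms unfolding code_std by (simp add: card_image)
  show "?f ` {..<l} \<subseteq> {..<n}" using assms unfolding code_std by simp
  show "lin (?f ` {..<l}) (rel std l a b)"
    unfolding lin_iff
  proof (intro conjI allI impI ballI)
    show "rel std l a b \<subseteq> ?f ` {..<l} \<times> ?f ` {..<l}" unfolding rel_std by auto
  next
    fix x y z assume "(x, y) \<in> rel std l a b" "(y, z) \<in> rel std l a b"
    then obtain i j j' k where "x = ?f i" "y = ?f j" "i < j" "j < l" "y = ?f j'" "z = ?f k" "j' < k" "k < l"
      unfolding rel_std by auto
    moreover from this have "j = j'" using inj[of j j'] by simp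
    ultimately show "(x, z) \<in> rel std l a b" unfolding rel_std by force
  next
    fix x show "(x, x) \<notin> rel std l a b" unfolding rel_std using inj by force
  next
    fix x y assume "x \<in> ?f ` {..<l}" "y \<in> ?f ` {..<l}" "x \<noteq> y"
    then obtain i j where "x = ?f i" "y = ?f j" "i < l" "j < l" "i \<noteq> j" by auto
    then show "(x, y) \<in> rel std l a b \<or> (y, x) \<in> rel std l a b"
      unfolding rel_std by (cases "i < j") force+
  qed
qed

text \<open>The number of predecessors increases strictly along r, hence maps S bijectively onto
  \<open>{..<card S}\<close>; its inverse lists S in order.\<close>

lemma lin_enum:
  assumes "finite S" "lin S r"
  shows "\<exists>f. f ` {..<card S} = S \<and> inj_on f {..<card S} \<and> (\<forall>i<card S. \<forall>j<card S. (f i, f j) \<in> r \<longleftrightarrow> i < j)"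
proof -
  define g where "g x = card {y. (y, x) \<in> r}" for x
  have pred: "{y. (y, x) \<in> r} \<subset> S" "finite {y. (y, x) \<in> r}" if "x \<in> S" for x
  proof -
    show "{y. (y, x) \<in> r} \<subset> S" using assms(2) that unfolding lin_iff by blast
    then show "finite {y. (y, x) \<in> r}" using assms(1) by (meson finite_subset psubset_imp_subset)
  qed
  have mono: "g x < g y" if "(x, y) \<in> r" for x y
  proof -
    have "y \<in> S" using that assms(2) unfolding lin_iff by blast
    moreover have "{z. (z, x) \<in> r} \<subset> {z. (z, y) \<in> r}"
      using that assms(2) unfolding lin_iff by blast
    ultimately show ?thesis unfolding g_def by (intro psubset_card_mono pred(2))
  qed
  have tot: "(x, y) \<in> r \<or> (y, x) \<in> r" if "x \<in> S" "y \<in> S" "x \<noteq> y" for x y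
    using assms(2) that unfolding lin_iff by blast
  have inj: "inj_on g S"
  proof (rule inj_onI, rule ccontr)
    fix x y assume "x \<in> S" "y \<in> S" "g x = g y" "x \<noteq> y"
    then show False using tot[of x y] mono[of x y] mono[of y x] by auto
  qed
  have "g x < card S" if "x \<in> S" for x
    unfolding g_def by (rule psubset_card_mono[OF assms(1) pred(1)[OF that]])
  then have "g ` S \<subseteq> {..<card S}" by auto
  then have img: "g ` S = {..<card S}" using card_image[OF inj] by (intro card_subset_eq) simp_all
  let ?f = "the_inv_into S g"
  have f: "?f i \<in> S" "g (?f i) = i" if "i < card S" for i
    using that img the_inv_into_into[OF inj, of i S] f_the_inv_into_f[OF inj, of i] by simp_all
  have "(?f i, ?f j) \<in> r \<longleftrightarrow> i < j" if "i < card S" "j < card S" for i j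
  proof
    assume "i < j"
    then have "(?f j, ?f i) \<notin> r" "?f i \<noteq> ?f j"
      using mono[of "?f j" "?f i"] f(2)[OF that(1)] f(2)[OF that(2)] by auto
    then show "(?f i, ?f j) \<in> r" using tot f(1) that by blast
  next
    assume "(?f i, ?f j) \<in> r"
    then show "i < j" using mono[of "?f i" "?f j"] f(2) that by simp
  qed
  moreover have "?f ` {..<card S} = S"
    using the_inv_into_onto[OF inj] img by simp
  moreover have "inj_on ?f {..<card S}" using inj_on_the_inv_into[OF inj] img by simp
  ultimately show ?thesis by blast
qed

lemma lin_code:
  assumes "S \<subseteq> {..<n}" "lin S r"
  shows "\<exists>a b. code std n (card S) a b \<and> rel std (card S) a b = r"
proof -
  have "finite S" using assms(1) finite_subset by blast
  then obtain f where f: "f ` {..<card S} = S" "inj_on f {..<card S}"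
    "\<And>i j. i < card S \<Longrightarrow> j < card S \<Longrightarrow> (f i, f j) \<in> r \<longleftrightarrow> i < j" using lin_enum assms(2) by metis
  obtain a b where ab: "\<forall>i<card S. entry a b i = f i" using beta_exists by blast
  have "entry a b ` {..<card S} = S" using ab f(1) by (auto simp: image_iff)
  moreover have "inj_on (entry a b) {..<card S}" using ab f(2) unfolding inj_on_def by simp
  ultimately have "code std n (card S) a b" using assms(1) unfolding code_std by simp
  moreover have "rel std (card S) a b = r"
  proof
    show "rel std (card S) a b \<subseteq> r" using ab f(3) unfolding rel_std by force
    show "r \<subseteq> rel std (card S) a b"
    proof clarify
      fix x y assume xy: "(x, y) \<in> r"
      then have "x \<in> S" "y \<in> S" using assms(2) unfolding lin_def by auto
      then obtain i j where "i < card S" "j < card S" "x = f i" "y = f j" using f(1) by blast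
      moreover from this have "i < j" using xy f(3) by simp
      ultimately have "x = entry a b i" "y = entry a b j" "i < j" "j < card S" using ab by simp_all
      then show "(x, y) \<in> rel std (card S) a b" unfolding rel_std by blast
    qed
  qed
  ultimately show ?thesis by blast
qed

text \<open>An injective sequence of n numbers below n exhausts them, and every finite order has a
  code.\<close>

lemma LO_code: "L \<in> LO n \<longleftrightarrow> (\<exists>a b. code std n n a b \<and> rel std n a b = L)"
proof
  assume "L \<in> LO n"
  then show "\<exists>a b. code std n n a b \<and> rel std n a b = L" using lin_code[of "{..<n}" n L] unfolding LO_def by simp
next
  assume "\<exists>a b. code std n n a b \<and> rel std n a b = L"
  then obtain a b where ab: "code std n n a b" "rel std n a b = L" by blast
  have "entry a b ` {..<n} = {..<n}" using code_lin(2,3)[OF ab(1)] by (intro card_subset_eq) auto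
  then show "L \<in> LO n" using code_lin(1)[OF ab(1)] ab(2) unfolding LO_def by simp
qed

lemma forces_std: "forces std n P e p \<longleftrightarrow> forced n P (\<lambda>L. sem p L e)"
  unfolding forces_def forced_def Ball_def LO_code by auto

lemma pow_std [simp]: "pow std x c = x ^ c"
  by (induction c) simp_all

lemma bd_std: "bd std n c x \<longleftrightarrow> x \<le> 2 ^ (blen n ^ c)"
proof -
  have "\<exists>z. blen z = k" for k
  proof (cases k)
    case 0
    have "blen 0 = 0" by (simp add: floorlog_def)
    then show ?thesis using 0 by blast
  next
    case (Suc m)
    then show ?thesis using blen_pow2[of m] by auto
  qed
  then obtain z where "blen z = blen n ^ c" by blast
  then show ?thesis by (auto simp: bd_def blen_1 simp del: One_nat_def intro!: exI[of _ z])
qed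

text \<open>Turns combinatorial density into its arithmetized form; the length of a code is the
  number of points it orders.\<close>

lemma extendable_std:
  assumes "code std n l a b"
    and "\<And>S. S \<subseteq> {..<n} \<Longrightarrow> lin S (rel std l a b) \<Longrightarrow> reach n S (rel std l a b) (blen n ^ d) Q"
  shows "extendable std n l a b d (\<lambda>l' a' b'. Q (rel std l' a' b'))"
proof -
  obtain S r where S: "S \<subseteq> {..<n}" "lin S r" "rel std l a b \<subseteq> r" "card S \<le> l + blen n ^ d" "Q r"
    using assms(2)[OF code_lin(3,1)[OF assms(1)]] code_lin(2)[OF assms(1)] unfolding reach_def by auto
  obtain a' b' where "code std n (card S) a' b'" "rel std (card S) a' b' = r" using lin_code[OF S(1,2)] by blast
  then show ?thesis using S unfolding extendable_def by auto
qed

section \<open>Transfer\<close>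

text \<open>\<open>tfv\<close>, and \<open>fv\<close> for formulas, are strict upper bounds on the
  indices of free variables, enough for truncating valuations.\<close>

primrec tfv :: "tm \<Rightarrow> nat" where
  "tfv (Var i) = Suc i"
| "tfv Zero = 0"
| "tfv One = 0"
| "tfv (Add s t) = max (tfv s) (tfv t)"
| "tfv (Mul s t) = max (tfv s) (tfv t)"
| "tfv (Len s) = tfv s"
| "tfv (Half s) = tfv s"
| "tfv (Smash s t) = max (tfv s) (tfv t)"

primrec fv :: "fm \<Rightarrow> nat" where
  "fv (Eq s t) = max (tfv s) (tfv t)"
| "fv (Le s t) = max (tfv s) (tfv t)"
| "fv (Prec s t) = max (tfv s) (tfv t)"
| "fv (Neg p) = fv p"
| "fv (And p q) = max (fv p) (fv q)"
| "fv (Or p q) = max (fv p) (fv q)"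
| "fv (Imp p q) = max (fv p) (fv q)"
| "fv (Forall p) = fv p - 1"
| "fv (Exists p) = fv p - 1"

lemma tval_cong: "(\<And>i. i < tfv t \<Longrightarrow> e i = e' i) \<Longrightarrow> tval A e t = tval A e' t"
  by (induction t) (auto simp: less_max_iff_disj)

lemma sat_cong: "(\<And>i. i < fv p \<Longrightarrow> e i = e' i) \<Longrightarrow> sat A R e p \<longleftrightarrow> sat A R e' p"
proof (induction p arbitrary: e e')
  case (Eq s t)
  then show ?case using tval_cong[of s e e' A] tval_cong[of t e e' A] by (simp add: less_max_iff_disj)
next
  case (Le s t)
  then show ?case using tval_cong[of s e e' A] tval_cong[of t e e' A] by (simp add: less_max_iff_disj)
next
  case (Prec s t)
  then show ?case using tval_cong[of s e e' A] tval_cong[of t e e' A] by (simp add: less_max_iff_disj)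
next
  case (Neg p)
  show ?case using Neg.IH[of e e'] Neg.prems by simp
next
  case (And p q)
  show ?case using And.IH(1)[of e e'] And.IH(2)[of e e'] And.prems by (simp add: less_max_iff_disj)
next
  case (Or p q)
  show ?case using Or.IH(1)[of e e'] Or.IH(2)[of e e'] Or.prems by (simp add: less_max_iff_disj)
next
  case (Imp p q)
  show ?case using Imp.IH(1)[of e e'] Imp.IH(2)[of e e'] Imp.prems by (simp add: less_max_iff_disj)
next
  case (Forall p)
  have "sat A R (case_nat a e) p \<longleftrightarrow> sat A R (case_nat a e') p" for a
    by (rule Forall.IH) (use Forall.prems in \<open>simp split: nat.split\<close>)
  then show ?case by simp
next
  case (Exists p)
  have "sat A R (case_nat a e) p \<longleftrightarrow> sat A R (case_nat a e') p" for a
    by (rule Exists.IH) (use Exists.prems in \<open>simp split: nat.split\<close>)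
  then show ?case by simp
qed

lemma transfer:
  assumes "true_arithmetic M" "prec_free p" "\<And>e. sat std {} e p" "range e \<subseteq> carr M"
  shows "sat M {} e p"
  using assms unfolding true_arithmetic_def models_def by blast

lemma range_case_nat: "x \<in> X \<Longrightarrow> range e \<subseteq> X \<Longrightarrow> range (case_nat x e) \<subseteq> X"
  unfolding image_subset_iff by (simp split: nat.split)

text \<open>For fixed Q, c and d the density statement is the formula \<open>?p\<close>. Bounding
  all values of a valuation is infinitary; it is replaced by a finite conjunction over the
  parameters with index below \<open>fv Q\<close>, which include all those on which Q
  depends.\<close>

lemma transfer_extendable:
  assumes M: "true_arithmetic M" and Q: "prec_free Q"
    and std: "\<And>n e l a b. n \<ge> 2 \<Longrightarrow> bounded n c e \<Longrightarrow> code std n l a b \<Longrightarrow>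
      extendable std n l a b d (\<lambda>l' a' b'. sat std {} (case_nat b' (case_nat a' (case_nat l' (case_nat n e)))) Q)"
    and n: "n \<in> carr M" "le M (add M (one M) (one M)) n"
    and e: "range e \<subseteq> carr M" "\<And>i. bd M n c (e i)"
    and code: "l \<in> carr M" "a \<in> carr M" "b \<in> carr M" "code M n l a b"
  shows "extendable M n l a b d (\<lambda>l' a' b'. sat M {} (case_nat b' (case_nat a' (case_nat l' (case_nat n e)))) Q)"
proof -
  let ?E = "\<lambda>b a l n e. case_nat b (case_nat a (case_nat l (case_nat n e)))"
  let ?p = "Imp (And (Le (Add One One) (Var 3)) (And (fCode (Var 3) (Var 2) (Var 1) (Var 0))
    (fConj (\<lambda>i. fBd (Var 3) c (Var (i + 4))) (fv Q)))) (fExtendable d Q)"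
  have sat: "sat A {} (?E b a l n e) ?p \<longleftrightarrow> (le A (add A (one A) (one A)) n \<and> code A n l a b \<and>
      (\<forall>i<fv Q. bd A n c (e i)) \<longrightarrow> extendable A n l a b d (\<lambda>l' a' b'. sat A {} (?E b' a' l' n e) Q))" for A :: "'c arith" and b a l n e
    by (simp add: sat_fCode sat_fConj sat_fBd sat_fExtendable eval_nat_numeral)
  have "sat std {} f ?p" for f
  proof -
    define e where "e i = f (i + 4)" for i
    have f: "f = ?E (f 0) (f 1) (f 2) (f 3) e"
      by (rule ext) (simp add: e_def eval_nat_numeral split: nat.split)
    \<comment> \<open>The conjunction leaves the later parameters unbounded; they are reset to 0,
      which satisfies every bound and does not affect Q.\<close>
    define e' where "e' i = (if i < fv Q then e i else 0)" for i
    have "sat std {} (?E b a l n e) Q \<longleftrightarrow> sat std {} (?E b a l n e') Q" for b a l n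
      by (rule sat_cong) (auto simp: e'_def split: nat.split)
    moreover have "bounded (f 3) c e'" if "\<forall>i<fv Q. bd std (f 3) c (e i)"
      using that unfolding bounded_def e'_def bd_std by simp
    ultimately have "sat std {} (?E (f 0) (f 1) (f 2) (f 3) e) ?p"
      unfolding sat using std[of "f 3" e' "f 2" "f 1" "f 0"] by simp
    then show ?thesis unfolding f[symmetric] .
  qed
  moreover have "range (?E b a l n e) \<subseteq> carr M" by (intro range_case_nat code n e)
  moreover have "prec_free ?p" using Q by simp
  ultimately have "sat M {} (?E b a l n e) ?p" using transfer[OF M] by blast
  then show ?thesis unfolding sat using n e code by blast
qed

section \<open>Density in the nonstandard model\<close>

instance tm :: countable by countable_datatype
instance fm :: countable by countable_datatype

locale game =
  fixes M :: "'a arith" and n :: 'a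
  assumes M: "true_arithmetic M" and countable_carr: "countable (carr M)" and n: "nonstandard M n"
begin

section \<open>Elementary facts about M and the cut, mostly by transfer\<close>

lemma n_carr: "n \<in> carr M"
  using n by (simp add: nonstandard_def)

lemma M_structure: "is_structure M"
  using M by (simp add: true_arithmetic_def)

lemma zero_carr: "zero M \<in> carr M"
  using M_structure by (simp add: is_structure_def)

definition env :: "'a list \<Rightarrow> nat \<Rightarrow> 'a" where
  "env xs i = (if i < length xs then xs ! i else zero M)"

lemma range_env: "set xs \<subseteq> carr M \<Longrightarrow> range (env xs) \<subseteq> carr M"
  using zero_carr by (auto simp: env_def)

lemma transfer_env:
  assumes "prec_free p" "\<And>e. sat std {} e p" "set xs \<subseteq> carr M"
  shows "sat M {} (env xs) p"
  using transfer[OF M assms(1,2) range_env[OF assms(3)]] .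

lemma two_le: "le M (add M (one M) (one M)) n"
proof -
  \<comment> \<open>The alternatives 0 and 0 + 1 are the first two values of
    \<open>numeral_val\<close>, which a nonstandard n avoids.\<close>
  have "sat M {} (env [n]) (Or (Eq (Var 0) Zero) (Or (Eq (Var 0) (Add Zero One)) (Le (Add One One) (Var 0))))"
    by (rule transfer_env) (auto simp: n_carr)
  moreover have "n \<noteq> zero M" "n \<noteq> add M (zero M) (one M)"
    using n rangeI[of "numeral_val M" 0] rangeI[of "numeral_val M" 1] unfolding nonstandard_def by auto
  ultimately show ?thesis by (simp add: env_def)
qed

lemma below_trans:
  assumes "z \<in> carr M" "x \<in> below M y" "y \<in> below M z"
  shows "x \<in> below M z"
proof -
  have "sat M {} (env [x, y, z]) (Imp (Lt (Var 0) (Var 1)) (Imp (Lt (Var 1) (Var 2)) (Lt (Var 0) (Var 2))))"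
    by (rule transfer_env) (use assms in \<open>auto simp: sat_Lt below_def\<close>)
  then show ?thesis using assms by (simp add: env_def sat_Lt below_def)
qed

lemma beta_unique:
  assumes "a \<in> carr M" "b \<in> carr M" "i \<in> carr M" "beta M a b i r" "beta M a b i r'"
  shows "r = r'"
proof -
  have "sat M {} (env [a, b, i, r, r']) (Imp (fBeta (Var 0) (Var 1) (Var 2) (Var 3))
      (Imp (fBeta (Var 0) (Var 1) (Var 2) (Var 4)) (Eq (Var 3) (Var 4))))"
    by (rule transfer_env) (use assms beta_carr in \<open>auto simp: sat_fBeta beta_std\<close>)
  then show ?thesis using assms by (simp add: env_def sat_fBeta)
qed

lemma rel_asym:
  assumes "l \<in> carr M" "a \<in> carr M" "b \<in> carr M" "code M n l a b" "(x, y) \<in> rel M l a b"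
  shows "(y, x) \<notin> rel M l a b"
proof -
  have "sat M {} (env [n, l, a, b, x, y]) (Imp (fCode (Var 0) (Var 1) (Var 2) (Var 3))
      (Imp (fRel (Var 1) (Var 2) (Var 3) (Var 4) (Var 5)) (Neg (fRel (Var 1) (Var 2) (Var 3) (Var 5) (Var 4)))))"
  proof (rule transfer_env)
    show "set [n, l, a, b, x, y] \<subseteq> carr M" using assms n_carr beta_carr unfolding rel_def by auto
  next
    fix e
    show "sat std {} e (Imp (fCode (Var 0) (Var 1) (Var 2) (Var 3))
      (Imp (fRel (Var 1) (Var 2) (Var 3) (Var 4) (Var 5)) (Neg (fRel (Var 1) (Var 2) (Var 3) (Var 5) (Var 4)))))"
      using lin_asym[OF code_lin(1)] by (simp add: sat_fCode sat_fRel)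
  qed simp
  then show ?thesis using assms by (simp add: env_def sat_fCode sat_fRel)
qed

lemma rel_field:
  assumes "l \<in> carr M" "a \<in> carr M" "b \<in> carr M" "code M n l a b" "(x, y) \<in> rel M l a b"
  shows "x \<in> below M n" "y \<in> below M n" "x \<noteq> y"
proof -
  obtain i j where ij: "j \<in> below M l" "i \<in> below M j" "beta M a b i x" "beta M a b j y"
    using assms(5) unfolding rel_def by auto
  have "i \<in> below M l" using below_trans[OF assms(1) ij(2,1)] .
  then show "x \<in> below M n" "y \<in> below M n"
    using assms(2-4) ij beta_unique unfolding code_def below_def by blast+
  show "x \<noteq> y" using rel_asym assms by blast
qed

text \<open>Transfers \<open>LO_extend\<close>. It makes forcing nonvacuous: above every condition
  there is a coded total order, so nothing is forced together with its negation.\<close>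

lemma code_total:
  assumes "l \<in> carr M" "a \<in> carr M" "b \<in> carr M" "code M n l a b"
  shows "\<exists>a'\<in>carr M. \<exists>b'\<in>carr M. code M n n a' b' \<and> rel M l a b \<subseteq> rel M n a' b'"
proof -
  have "sat M {} (env [n, l, a, b]) (Imp (fCode (Var 0) (Var 1) (Var 2) (Var 3))
      (Exists (Exists (And (fCode (Var 2) (Var 2) (Var 1) (Var 0)) (fSub (Var 3) (Var 4) (Var 5) (Var 2) (Var 1) (Var 0))))))"
  proof (rule transfer_env)
    have "\<exists>a' b'. code std n n a' b' \<and> rel std l a b \<subseteq> rel std n a' b'" if c: "code std n l a b" for n l a b :: nat
    proof -
      obtain L where "L \<in> LO n" "rel std l a b \<subseteq> L" using LO_extend[OF code_lin(3)[OF c] code_lin(1)[OF c]] by blast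
      then show ?thesis unfolding LO_code by blast
    qed
    then show "sat std {} e (Imp (fCode (Var 0) (Var 1) (Var 2) (Var 3))
      (Exists (Exists (And (fCode (Var 2) (Var 2) (Var 1) (Var 0)) (fSub (Var 3) (Var 4) (Var 5) (Var 2) (Var 1) (Var 0))))))" for e
      by (simp add: sat_fCode sat_fSub eval_nat_numeral)
  qed (use assms n_carr in auto)
  then show ?thesis using assms by (simp add: env_def sat_fCode sat_fSub eval_nat_numeral)
qed

text \<open>Ensures that lengthening by |n|^d, d standard, leads from conditions to
  conditions.\<close>

lemma length_bound:
  assumes "l \<in> carr M" "l' \<in> carr M" "le M l (pow M (len M n) c)" "le M l' (add M l (pow M (len M n) d))"
  shows "le M l' (pow M (len M n) (c + d + 1))"
proof -
  let ?p = "Imp (Le (Add One One) (Var 0)) (Imp (Le (Var 1) (fPow (Len (Var 0)) c))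
      (Imp (Le (Var 2) (Add (Var 1) (fPow (Len (Var 0)) d))) (Le (Var 2) (fPow (Len (Var 0)) (c + d + 1)))))"
  have "sat M {} (env [n, l, l']) ?p"
  proof (rule transfer_env)
    fix e
    show "sat std {} e ?p"
    proof (simp only: sat.simps tval.simps tval_fPow std_simps pow_std, intro impI)
      assume "1 + 1 \<le> e 0" "e 1 \<le> blen (e 0) ^ c" "e 2 \<le> e 1 + blen (e 0) ^ d"
      then show "e 2 \<le> blen (e 0) ^ (c + d + 1)"
        using power_sum_le[OF blen_ge2, of "e 0" c d] by simp
    qed
  qed (use assms n_carr in auto)
  then show ?thesis using assms two_le by (simp add: env_def)
qed

lemma bd_mono:
  assumes "x \<in> carr M" "bd M n c x" "c \<le> d"
  shows "bd M n d x"
proof -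
  have "sat M {} (env [n, x]) (Imp (Le (Add One One) (Var 0)) (Imp (fBd (Var 0) c (Var 1)) (fBd (Var 0) d (Var 1))))"
    by (rule transfer_env)
      (use assms n_carr pow2_mono[OF blen_power_mono] in \<open>auto simp: sat_fBd bd_std\<close>)
  then show ?thesis using assms two_le by (simp add: env_def sat_fBd)
qed

lemma bd_down:
  assumes "x \<in> carr M" "y \<in> carr M" "bd M n c y" "le M x y"
  shows "bd M n c x"
proof -
  have "sat M {} (env [n, x, y]) (Imp (Le (Var 1) (Var 2)) (Imp (fBd (Var 0) c (Var 2)) (fBd (Var 0) c (Var 1))))"
    by (rule transfer_env) (use assms n_carr in \<open>auto simp: sat_fBd bd_std\<close>)
  then show ?thesis using assms by (simp add: env_def sat_fBd eval_nat_numeral)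
qed

text \<open>From n \<le> 2^|n|: the ordered points lie in the cut and can serve as
  parameters.\<close>

lemma bd_n: "bd M n 1 n"
proof -
  have "sat M {} (env [n]) (fBd (Var 0) 1 (Var 0))"
  proof (rule transfer_env)
    fix e :: "nat \<Rightarrow> nat"
    have "e 0 \<le> 2 ^ blen (e 0)"
      using floorlog_bounds[of "e 0" 2] by (cases "e 0 = 0") auto
    then show "sat std {} e (fBd (Var 0) 1 (Var 0))" by (simp add: sat_fBd bd_std)
  qed (use n_carr in auto)
  then show ?thesis by (simp add: env_def sat_fBd)
qed

lemma tval_carr: "range e \<subseteq> carr M \<Longrightarrow> tval M e t \<in> carr M"
  using M_structure by (induction t) (auto simp: is_structure_def)

lemma tval_bd:
  assumes "range e \<subseteq> carr M" "\<And>i. bd M n c (e i)"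
  shows "\<exists>d. bd M n d (tval M e t)"
proof -
  obtain d where d: "\<And>n e. n \<ge> 2 \<Longrightarrow> bounded n c e \<Longrightarrow> tval std e t \<le> 2 ^ (blen n ^ d)"
    by (rule tval_boundedD, rule that) blast
  let ?p = "Imp (Le (Add One One) (Var 0)) (Imp (fConj (\<lambda>i. fBd (Var 0) c (Var (Suc i))) (tfv t))
    (fBd (Var 0) d (tsubst (\<lambda>i. Var (Suc i)) t)))"
  have "sat M {} (case_nat n e) ?p"
  proof (rule transfer[OF M])
    fix f
    show "sat std {} f ?p"
    proof (simp only: sat.simps sat_fConj sat_fBd bd_std tval.simps std_simps tval_tsubst, intro impI)
      assume 2: "1 + 1 \<le> f 0" and b: "\<forall>i<tfv t. f (Suc i) \<le> 2 ^ (blen (f 0) ^ c)"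
      let ?g = "\<lambda>i. if i < tfv t then f (Suc i) else 0"
      have "bounded (f 0) c ?g" using b by (simp add: bounded_def)
      then have "tval std ?g t \<le> 2 ^ (blen (f 0) ^ d)" using d 2 by simp
      moreover have "tval std ?g t = tval std (\<lambda>i. f (Suc i)) t" by (rule tval_cong) simp
      ultimately show "tval std (\<lambda>i. f (Suc i)) t \<le> 2 ^ (blen (f 0) ^ d)" by simp
    qed
  qed (use assms n_carr in \<open>simp_all add: range_case_nat\<close>)
  then show ?thesis using assms(2) two_le by (auto simp: sat_fConj sat_fBd tval_tsubst)
qed

text \<open>Finite support leaves only countably many valuations, hence countably many requirements;
  the common exponent c is what \<open>transfer_extendable\<close> asks for.\<close>

definition adm :: "(nat \<Rightarrow> 'a) \<Rightarrow> bool" where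
  "adm e \<longleftrightarrow> range e \<subseteq> carr M \<and> (\<exists>c. \<forall>i. bd M n c (e i)) \<and> (\<exists>k. \<forall>i\<ge>k. e i = zero M)"

lemma carr_cut: "carr (cut M n) = {x \<in> carr M. \<exists>c. bd M n c x}"
  by (auto simp: cut_def exp2_def bd_def)

lemma cut_simps [simp]: "zero (cut M n) = zero M" "one (cut M n) = one M" "add (cut M n) = add M"
  "mul (cut M n) = mul M" "len (cut M n) = len M" "half (cut M n) = half M" "smash (cut M n) = smash M"
  "le (cut M n) = le M"
  by (simp_all add: cut_def)

lemma tval_cut [simp]: "tval (cut M n) e t = tval M e t"
  by (induction t) simp_all

lemma adm_case_nat:
  assumes "adm e" "x \<in> carr (cut M n)"
  shows "adm (case_nat x e)"
proof -
  obtain c d k where c: "\<forall>i. bd M n c (e i)" "bd M n d x" "\<forall>i\<ge>k. e i = zero M" "x \<in> carr M" "range e \<subseteq> carr M"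
    using assms unfolding adm_def carr_cut by blast
  have "bd M n (c + d) (e i)" for i
    by (rule bd_mono[of _ c]) (use c in auto)
  moreover have "bd M n (c + d) x" by (rule bd_mono[of _ d]) (use c in auto)
  ultimately have "bd M n (c + d) (case_nat x e i)" for i by (cases i) simp_all
  moreover have "\<forall>i\<ge>Suc k. case_nat x e i = zero M" using c(3) by (auto split: nat.split)
  ultimately show ?thesis using c(4,5) range_case_nat unfolding adm_def by meson
qed

lemma zero_cut: "zero M \<in> carr (cut M n)"
proof -
  have "sat M {} (env [n]) (fBd (Var 0) 0 Zero)"
    by (rule transfer_env) (use n_carr in \<open>auto simp: sat_fBd bd_std\<close>)
  then show ?thesis using zero_carr unfolding carr_cut by (auto simp: env_def sat_fBd)
qed

text \<open>The exponents of infinitely many values in the cut may be unbounded; finitely many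
  values share one.\<close>

lemma adm_truncate:
  assumes "range e \<subseteq> carr (cut M n)"
  shows "adm (\<lambda>i. if i < k then e i else zero M)"
  using assms
proof (induction k arbitrary: e)
  case 0
  then show ?case using zero_cut by (auto simp: adm_def carr_cut)
next
  case (Suc k)
  have "adm (\<lambda>i. if i < k then e (Suc i) else zero M)"
    using Suc.IH[of "\<lambda>i. e (Suc i)"] Suc.prems by auto
  then have "adm (case_nat (e 0) (\<lambda>i. if i < k then e (Suc i) else zero M))"
    using adm_case_nat Suc.prems by blast
  moreover have "case_nat (e 0) (\<lambda>i. if i < k then e (Suc i) else zero M) = (\<lambda>i. if i < Suc k then e i else zero M)"
    by (rule ext) (simp split: nat.split)
  ultimately show ?case by simp
qed

lemma countable_adm: "countable (Collect adm)"
proof (rule countable_subset)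
  show "Collect adm \<subseteq> env ` lists (carr M)"
  proof
    fix e assume "e \<in> Collect adm"
    then obtain k where e: "range e \<subseteq> carr M" "\<forall>i\<ge>k. e i = zero M" unfolding adm_def by blast
    then have "e = env (map e [0..<k])" by (intro ext) (simp add: env_def)
    moreover have "map e [0..<k] \<in> lists (carr M)" using e(1) by (auto simp: image_subset_iff)
    ultimately show "e \<in> env ` lists (carr M)" by blast
  qed
qed (use countable_carr in auto)

lemma tval_cut_carr: "adm e \<Longrightarrow> tval M e t \<in> carr (cut M n)"
  using tval_bd tval_carr unfolding adm_def carr_cut by blast

lemma cut_down: "x \<in> carr M \<Longrightarrow> y \<in> carr (cut M n) \<Longrightarrow> le M x y \<Longrightarrow> x \<in> carr (cut M n)"
  using bd_down unfolding carr_cut by blast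

section \<open>The requirements and their density in M\<close>

definition compares :: "'a \<Rightarrow> 'a \<Rightarrow> ('a \<times> 'a) set \<Rightarrow> bool" where
  "compares x y P \<longleftrightarrow> (x, y) \<in> P \<or> (y, x) \<in> P"

text \<open>The positive case names one witness for all coded orders, so that it can be carried over
  to the cut.\<close>

definition decides_ex :: "tm \<Rightarrow> fm \<Rightarrow> (nat \<Rightarrow> 'a) \<Rightarrow> ('a \<times> 'a) set \<Rightarrow> bool" where
  "decides_ex t p e P \<longleftrightarrow> forces M n P e (Neg (Exists_le t p)) \<or>
    (\<exists>w\<in>carr M. le M w (tval M e t) \<and> forces M n P (case_nat w e) p)"

text \<open>Forcing the instances at separate stages would not force the universal statement, which
  may have nonstandardly many instances.\<close>

definition decides_all :: "tm \<Rightarrow> fm \<Rightarrow> (nat \<Rightarrow> 'a) \<Rightarrow> ('a \<times> 'a) set \<Rightarrow> bool" where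
  "decides_all t p e P \<longleftrightarrow> forces M n P e (Forall_le (Len t) p) \<or>
    (\<exists>w\<in>carr M. le M w (len M (tval M e t)) \<and> forces M n P (case_nat w e) (Neg p))"

definition refutes :: "fm \<Rightarrow> 'a \<Rightarrow> 'a \<Rightarrow> (nat \<Rightarrow> 'a) \<Rightarrow> ('a \<times> 'a) set \<Rightarrow> bool" where
  "refutes p u v e P \<longleftrightarrow> (let \<phi> = \<lambda>x y. forces M n P (case_nat x (case_nat y e)) in
    (\<exists>x\<in>below M u. \<forall>y\<in>below M v. \<phi> x y (Neg p)) \<or>
    (\<exists>x\<in>below M u. \<exists>x'\<in>below M u. x \<noteq> x' \<and> (\<exists>y\<in>below M v. \<phi> x y p \<and> \<phi> x' y p)) \<or>
    (\<exists>x\<in>below M u. \<exists>y\<in>below M v. \<exists>y'\<in>below M v. y \<noteq> y' \<and> \<phi> x y p \<and> \<phi> x y' p))"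

text \<open>Two further points suffice and 2 \<le> |n|, so the exponent is 1. The premises on x and
  y become the antecedent of \<open>?Q\<close>, as the transferred formula must hold for all values
  of its variables.\<close>

lemma extend_compares:
  assumes "x \<in> below M n" "y \<in> below M n" "x \<noteq> y"
    and c: "l \<in> carr M" "a \<in> carr M" "b \<in> carr M" "code M n l a b"
  shows "\<exists>d. extendable M n l a b d (\<lambda>l' a' b'. compares x y (rel M l' a' b'))"
proof -
  let ?E = "\<lambda>b a l n e. case_nat b (case_nat a (case_nat l (case_nat n e)))"
  let ?Q = "Imp (And (Lt (Var 4) (Var 3)) (And (Lt (Var 5) (Var 3)) (Neg (Eq (Var 4) (Var 5)))))
    (Or (fRel (Var 2) (Var 1) (Var 0) (Var 4) (Var 5)) (fRel (Var 2) (Var 1) (Var 0) (Var 5) (Var 4)))"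
  have Q: "sat A {} (?E b a l n e) ?Q \<longleftrightarrow> (le A (e 0) n \<and> e 0 \<noteq> n \<and> le A (e 1) n \<and> e 1 \<noteq> n \<and> e 0 \<noteq> e 1 \<longrightarrow>
    (e 0, e 1) \<in> rel A l a b \<or> (e 1, e 0) \<in> rel A l a b)" for A :: "'c arith" and b a l n e
    by (simp add: sat_fRel sat_Lt eval_nat_numeral)
  have e: "x \<in> carr (cut M n)" "y \<in> carr (cut M n)"
    using assms(1,2) bd_down[OF _ n_carr bd_n] unfolding carr_cut below_def by blast+
  have "adm (\<lambda>i. zero M)" using adm_truncate[of "\<lambda>i. zero M" 0] zero_cut by auto
  then have "adm (case_nat x (case_nat y (\<lambda>i. zero M)))" using adm_case_nat e by blast
  moreover have "case_nat x (case_nat y (\<lambda>i. zero M)) = env [x, y]"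
    by (rule ext) (simp add: env_def split: nat.split)
  ultimately have "adm (env [x, y])" by simp
  then obtain k where k: "range (env [x, y]) \<subseteq> carr M" "\<And>i. bd M n k (env [x, y] i)" unfolding adm_def by blast
  have "extendable M n l a b 1 (\<lambda>l' a' b'. sat M {} (?E b' a' l' n (env [x, y])) ?Q)"
  proof (rule transfer_extendable[OF M _ _ n_carr two_le k c])
    fix n l a b :: nat and e assume n: "n \<ge> 2" and code: "code std n l a b"
    show "extendable std n l a b 1 (\<lambda>l' a' b'. sat std {} (?E b' a' l' n e) ?Q)"
      unfolding Q
    proof (rule extendable_std[OF code])
      fix S assume S: "S \<subseteq> {..<n}" "lin S (rel std l a b)"
      show "reach n S (rel std l a b) (blen n ^ 1) (\<lambda>P. le std (e 0) n \<and> e 0 \<noteq> n \<and> le std (e 1) n \<and> e 1 \<noteq> n \<and> e 0 \<noteq> e 1 \<longrightarrow>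
          (e 0, e 1) \<in> P \<or> (e 1, e 0) \<in> P)"
      proof (cases "e 0 < n \<and> e 1 < n \<and> e 0 \<noteq> e 1")
        case True
        then have "reach n S (rel std l a b) 2 (\<lambda>P. (e 0, e 1) \<in> P \<or> (e 1, e 0) \<in> P)"
          by (intro reach_compare[OF S]) auto
        then show ?thesis by (rule reach_mono) (use blen_ge2[OF n] in auto)
      next
        case False
        then show ?thesis by (intro reach_refl[OF S]) auto
      qed
    qed
  qed simp
  then show ?thesis using assms(1-3) unfolding Q compares_def by (auto simp: env_def below_def)
qed

lemma extend_ex:
  assumes "Sigma_b1 p" "adm e"
    and c: "l \<in> carr M" "a \<in> carr M" "b \<in> carr M" "code M n l a b"
  shows "\<exists>d. extendable M n l a b d (\<lambda>l' a' b'. decides_ex t p e (rel M l' a' b'))"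
proof -
  let ?E = "\<lambda>b a l n e. case_nat b (case_nat a (case_nat l (case_nat n e)))"
  \<comment> \<open>The parameters of p start at \<open>Var 4\<close>, behind b, a, l and n; the
    binder of the witness moves them to 5.\<close>
  let ?Q = "Or (fForces (Var 3) (Var 2) (Var 1) (Var 0) (\<lambda>i. Var (i + 4)) (Neg (Exists_le t p)))
    (Exists_le (tsubst (\<lambda>i. Var (i + 4)) t)
      (fForces (Var 4) (Var 3) (Var 2) (Var 1) (case_nat (Var 0) (\<lambda>i. Var (i + 5))) p))"
  have E: "(\<lambda>i. tval A (case_nat w (?E b a l n e)) (case i of 0 \<Rightarrow> Var 0 | Suc i \<Rightarrow> Var (i + 5))) = case_nat w e"
    "(\<lambda>i. ?E b a l n e (i + 4)) = e"
    for A :: "'c arith" and w b a l n e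
    by (rule ext, simp add: eval_nat_numeral split: nat.split)+
  have Q: "sat A {} (?E b a l n e) ?Q \<longleftrightarrow> (forces A n (rel A l a b) e (Neg (Exists_le t p)) \<or>
    (\<exists>w\<in>carr A. le A w (tval A e t) \<and> forces A n (rel A l a b) (case_nat w e) p))" for A :: "'c arith" and b a l n e
    by (simp only: sat.simps sat_fForces sat_Exists_le tval.simps tval_tsubst E) (simp add: eval_nat_numeral)
  obtain k where k: "range e \<subseteq> carr M" "\<And>i. bd M n k (e i)" using assms(2) unfolding adm_def by blast
  obtain d where d: "\<forall>n\<ge>2. \<forall>e. bounded n k e \<longrightarrow> (\<forall>S r. S \<subseteq> {..<n} \<longrightarrow> lin S r \<longrightarrow>
    reach n S r (blen n ^ d) (\<lambda>r'. forced n r' (\<lambda>L. \<not> (\<exists>a\<le>tval std e t. sem p L (case_nat a e))) \<or>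
      (\<exists>a\<le>tval std e t. forced n r' (\<lambda>L. sem p L (case_nat a e)))))"
    using reach_ex_le[OF Sigma_b1_certifiable[OF assms(1)], of k t] ..
  have "extendable M n l a b d (\<lambda>l' a' b'. sat M {} (?E b' a' l' n e) ?Q)"
  proof (rule transfer_extendable[OF M _ _ n_carr two_le k c])
    fix n l a b :: nat and e assume n: "n \<ge> 2" "bounded n k e" and code: "code std n l a b"
    show "extendable std n l a b d (\<lambda>l' a' b'. sat std {} (?E b' a' l' n e) ?Q)"
      unfolding Q
    proof (rule extendable_std[OF code])
      fix S assume S: "S \<subseteq> {..<n}" "lin S (rel std l a b)"
      show "reach n S (rel std l a b) (blen n ^ d) (\<lambda>P. forces std n P e (Neg (Exists_le t p)) \<or>
          (\<exists>w\<in>carr std. le std w (tval std e t) \<and> forces std n P (case_nat w e) p))"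
        by (rule reach_mono[OF d[rule_format, OF n S] order_refl]) (simp add: forces_std sat_Exists_le)
    qed
  qed simp
  then show ?thesis unfolding Q decides_ex_def by blast
qed

lemma extend_all:
  assumes "Sigma_b1 p" "adm e"
    and c: "l \<in> carr M" "a \<in> carr M" "b \<in> carr M" "code M n l a b"
  shows "\<exists>d. extendable M n l a b d (\<lambda>l' a' b'. decides_all t p e (rel M l' a' b'))"
proof -
  let ?E = "\<lambda>b a l n e. case_nat b (case_nat a (case_nat l (case_nat n e)))"
  let ?Q = "Or (fForces (Var 3) (Var 2) (Var 1) (Var 0) (\<lambda>i. Var (i + 4)) (Forall_le (Len t) p))
    (Exists_le (Len (tsubst (\<lambda>i. Var (i + 4)) t))
      (fForces (Var 4) (Var 3) (Var 2) (Var 1) (case_nat (Var 0) (\<lambda>i. Var (i + 5))) (Neg p)))"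
  have E: "(\<lambda>i. tval A (case_nat w (?E b a l n e)) (case i of 0 \<Rightarrow> Var 0 | Suc i \<Rightarrow> Var (i + 5))) = case_nat w e"
    "(\<lambda>i. ?E b a l n e (i + 4)) = e"
    for A :: "'c arith" and w b a l n e
    by (rule ext, simp add: eval_nat_numeral split: nat.split)+
  have Q: "sat A {} (?E b a l n e) ?Q \<longleftrightarrow> (forces A n (rel A l a b) e (Forall_le (Len t) p) \<or>
    (\<exists>w\<in>carr A. le A w (len A (tval A e t)) \<and> forces A n (rel A l a b) (case_nat w e) (Neg p)))" for A :: "'c arith" and b a l n e
    by (simp only: sat.simps sat_fForces sat_Exists_le tval.simps tval_tsubst E) (simp add: eval_nat_numeral)
  obtain k where k: "range e \<subseteq> carr M" "\<And>i. bd M n k (e i)" using assms(2) unfolding adm_def by blast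
  obtain d where d: "\<forall>n\<ge>2. \<forall>e. bounded n k e \<longrightarrow> (\<forall>S r. S \<subseteq> {..<n} \<longrightarrow> lin S r \<longrightarrow>
    reach n S r (blen n ^ d) (\<lambda>r'. forced n r' (\<lambda>L. \<forall>a\<le>blen (tval std e t). sem p L (case_nat a e)) \<or>
      (\<exists>a\<le>blen (tval std e t). forced n r' (\<lambda>L. \<not> sem p L (case_nat a e)))))"
    using reach_all_le[OF Sigma_b1_certifiable[OF assms(1)], of k t] ..
  have "extendable M n l a b d (\<lambda>l' a' b'. sat M {} (?E b' a' l' n e) ?Q)"
  proof (rule transfer_extendable[OF M _ _ n_carr two_le k c])
    fix n l a b :: nat and e assume n: "n \<ge> 2" "bounded n k e" and code: "code std n l a b"
    show "extendable std n l a b d (\<lambda>l' a' b'. sat std {} (?E b' a' l' n e) ?Q)"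
      unfolding Q
    proof (rule extendable_std[OF code])
      fix S assume S: "S \<subseteq> {..<n}" "lin S (rel std l a b)"
      show "reach n S (rel std l a b) (blen n ^ d) (\<lambda>P. forces std n P e (Forall_le (Len t) p) \<or>
          (\<exists>w\<in>carr std. le std w (len std (tval std e t)) \<and> forces std n P (case_nat w e) (Neg p)))"
        by (rule reach_mono[OF d[rule_format, OF n S] order_refl]) (simp add: forces_std sat_Forall_le)
    qed
  qed simp
  then show ?thesis unfolding Q decides_all_def by blast
qed

lemma extend_refutes:
  assumes "Delta_b1 p" "adm e" "u \<in> carr (cut M n)" "v \<in> below M u"
    and c: "l \<in> carr M" "a \<in> carr M" "b \<in> carr M" "code M n l a b"
  shows "\<exists>d. extendable M n l a b d (\<lambda>l' a' b'. refutes p u v e (rel M l' a' b'))"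
proof -
  let ?E = "\<lambda>b a l n u v e. case_nat b (case_nat a (case_nat l (case_nat n (case_nat u (case_nat v e)))))"
  \<comment> \<open>The variables are b, a, l, n, u, v, then the parameters from
    \<open>Var 6\<close> on; two or three binders move these to 8 or 9.\<close>
  let ?\<sigma> = "\<lambda>i j k. case_nat (Var i) (case_nat (Var j) (\<lambda>i. Var (i + k)))"
  let ?F2 = "fForces (Var 5) (Var 4) (Var 3) (Var 2)"
  let ?F3 = "fForces (Var 6) (Var 5) (Var 4) (Var 3)"
  let ?Q = "Imp (Lt (Var 5) (Var 4)) (Or
    (Exists_lt (Var 4) (Forall_lt (Var 6) (?F2 (?\<sigma> 1 0 8) (Neg p)))) (Or
    (Exists_lt (Var 4) (Exists_lt (Var 5) (And (Neg (Eq (Var 1) (Var 0)))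
      (Exists_lt (Var 7) (And (?F3 (?\<sigma> 2 0 9) p) (?F3 (?\<sigma> 1 0 9) p))))))
    (Exists_lt (Var 4) (Exists_lt (Var 6) (Exists_lt (Var 7) (And (Neg (Eq (Var 1) (Var 0)))
      (And (?F3 (?\<sigma> 2 1 9) p) (?F3 (?\<sigma> 2 0 9) p))))))))"
  let ?\<phi> = "\<lambda>A n P e x y. forces A n P (case_nat x (case_nat y e))"
  have E: "(\<lambda>i. tval A (case_nat y (case_nat x (?E b a l n u v e))) (?\<sigma> 1 0 8 i)) = case_nat x (case_nat y e)"
    "(\<lambda>i. tval A (case_nat z (case_nat y (case_nat x (?E b a l n u v e)))) (?\<sigma> 2 0 9 i)) = case_nat x (case_nat z e)"
    "(\<lambda>i. tval A (case_nat z (case_nat y (case_nat x (?E b a l n u v e)))) (?\<sigma> 1 0 9 i)) = case_nat y (case_nat z e)"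
    "(\<lambda>i. tval A (case_nat z (case_nat y (case_nat x (?E b a l n u v e)))) (?\<sigma> 2 1 9 i)) = case_nat x (case_nat y e)"
    for A :: "'c arith" and x y z b a l n u v e
    by (rule ext, simp add: eval_nat_numeral split: nat.split)+
  have Q: "sat A {} (?E b a l n u v e) ?Q \<longleftrightarrow> (le A v u \<and> v \<noteq> u \<longrightarrow>
    (\<exists>x\<in>below A u. \<forall>y\<in>below A v. ?\<phi> A n (rel A l a b) e x y (Neg p)) \<or>
    (\<exists>x\<in>below A u. \<exists>x'\<in>below A u. x \<noteq> x' \<and> (\<exists>y\<in>below A v. ?\<phi> A n (rel A l a b) e x y p \<and> ?\<phi> A n (rel A l a b) e x' y p)) \<or>
    (\<exists>x\<in>below A u. \<exists>y\<in>below A v. \<exists>y'\<in>below A v. y \<noteq> y' \<and> ?\<phi> A n (rel A l a b) e x y p \<and> ?\<phi> A n (rel A l a b) e x y' p))"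
    for A :: "'c arith" and b a l n u v e
    by (simp only: sat.simps sat_fForces sat_Exists_lt sat_Forall_lt sat_Lt tval.simps E) (simp add: eval_nat_numeral)
  have v: "v \<in> carr (cut M n)" using cut_down assms(3,4) unfolding below_def by blast
  have adm: "adm (case_nat u (case_nat v e))" using adm_case_nat assms(2,3) v by blast
  then obtain k where k: "range (case_nat u (case_nat v e)) \<subseteq> carr M" "\<And>i. bd M n k (case_nat u (case_nat v e) i)"
    unfolding adm_def by blast
  obtain d where d: "\<forall>n\<ge>2. \<forall>e. bounded n k e \<longrightarrow> (\<forall>S r u v. S \<subseteq> {..<n} \<longrightarrow> lin S r \<longrightarrow> v < u \<longrightarrow>
    u \<le> 2 ^ (blen n ^ k) \<longrightarrow> reach n S r (blen n ^ d) (php_failure n u v (\<lambda>(x::nat) (y::nat) L. sem p L (case_nat x (case_nat y e)))))"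
    using reach_php[OF Delta_b1_certifiable[OF assms(1)], of k] ..
  have "extendable M n l a b d (\<lambda>l' a' b'. sat M {} (?E b' a' l' n u v e) ?Q)"
  proof (rule transfer_extendable[OF M _ _ n_carr two_le k c])
    fix n l a b :: nat and f assume n: "n \<ge> 2" "bounded n k f" and code: "code std n l a b"
    define u v e where "u = f 0" and "v = f 1" and "e = (\<lambda>i. f (i + 2))"
    have f: "f = case_nat u (case_nat v e)"
      by (rule ext) (simp add: u_def v_def e_def eval_nat_numeral split: nat.split)
    have b: "bounded n k e" "u \<le> 2 ^ (blen n ^ k)" using n(2) by (simp_all add: bounded_def u_def e_def)
    show "extendable std n l a b d (\<lambda>l' a' b'. sat std {} (case_nat b' (case_nat a' (case_nat l' (case_nat n f)))) ?Q)"
      unfolding f Q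
    proof (rule extendable_std[OF code])
      fix S assume S: "S \<subseteq> {..<n}" "lin S (rel std l a b)"
      show "reach n S (rel std l a b) (blen n ^ d) (\<lambda>P. le std v u \<and> v \<noteq> u \<longrightarrow>
        (\<exists>x\<in>below std u. \<forall>y\<in>below std v. ?\<phi> std n P e x y (Neg p)) \<or>
        (\<exists>x\<in>below std u. \<exists>x'\<in>below std u. x \<noteq> x' \<and> (\<exists>y\<in>below std v. ?\<phi> std n P e x y p \<and> ?\<phi> std n P e x' y p)) \<or>
        (\<exists>x\<in>below std u. \<exists>y\<in>below std v. \<exists>y'\<in>below std v. y \<noteq> y' \<and> ?\<phi> std n P e x y p \<and> ?\<phi> std n P e x y' p))"
      proof (cases "v < u")
        case True
        show ?thesis
          by (rule reach_mono[OF d[rule_format, OF n(1) b(1) S True b(2)] order_refl])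
            (simp only: php_failure_def forces_std below_std sat.simps Bex_def Ball_def lessThan_iff, blast)
      next
        case False
        then show ?thesis by (intro reach_refl[OF S]) auto
      qed
    qed
  qed simp
  moreover have "le M v u" "v \<noteq> u" using assms(4) by (simp_all add: below_def)
  ultimately show ?thesis unfolding Q refutes_def Let_def by (intro exI[of _ d]) simp
qed

end

section \<open>Winning the game\<close>

text \<open>A strategy sees neither the stage nor the history. Looking for the first set that the
  current condition misses needs neither, and since the sets are closed under extension, a set once
  met stays met.\<close>

lemma strategy_meeting_all:
  assumes "countable \<D>"
    and opn: "\<And>D o0 o1. D \<in> \<D> \<Longrightarrow> o0 \<in> D \<Longrightarrow> o1 \<in> conditions M n \<Longrightarrow> extends M o1 o0 \<Longrightarrow> o1 \<in> D"
    and dense: "\<And>D o0. D \<in> \<D> \<Longrightarrow> o0 \<in> conditions M n \<Longrightarrow> \<exists>o1\<in>conditions M n. extends M o1 o0 \<and> o1 \<in> D"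
  shows "\<exists>S. strategy M n S \<and>
    (\<forall>os. play M n os \<and> follows P_PHP S os \<longrightarrow> (\<forall>D\<in>\<D>. \<exists>k. os (Suc k) \<in> D))"
proof (cases "\<D> = {}")
  case True
  then show ?thesis by (intro exI[of _ "\<lambda>x. x"]) (simp add: strategy_def extends_def)
next
  case False
  then obtain D :: "nat \<Rightarrow> _" where D: "\<D> = range D" using assms(1) by (metis range_from_nat_into)
  define T where "T x i y \<longleftrightarrow> y \<in> conditions M n \<and> extends M y x \<and> y \<in> D i" for x i y
  define S where "S x = (if \<exists>i. x \<notin> D i then SOME y. T x (LEAST i. x \<notin> D i) y else x)" for x
  have T: "T x (LEAST i. x \<notin> D i) (S x)" if "x \<in> conditions M n" "\<exists>i. x \<notin> D i" for x
  proof -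
    have "\<exists>y. T x (LEAST i. x \<notin> D i) y" using dense[of "D _" x] that(1) D unfolding T_def by blast
    then show ?thesis using that(2) someI_ex[of "T x (LEAST i. x \<notin> D i)"] unfolding S_def by simp
  qed
  have "strategy M n S"
    unfolding strategy_def
  proof
    fix x assume x: "x \<in> conditions M n"
    show "S x \<in> conditions M n \<and> extends M (S x) x"
    proof (cases "\<exists>i. x \<notin> D i")
      case True
      then show ?thesis using T[OF x] unfolding T_def by blast
    next
      case False
      then show ?thesis using x unfolding S_def extends_def by simp
    qed
  qed
  moreover have "\<exists>k. \<forall>j<i. os (Suc k) \<in> D j" if play: "play M n os" and fol: "follows P_PHP S os" for os i
  proof (induction i)
    case (Suc i)
    then obtain k where k: "\<forall>j<i. os (Suc k) \<in> D j" by blast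
    have cond: "os (Suc m) \<in> conditions M n" "extends M (os (Suc m)) (os m)" for m
      using play unfolding play_def by blast+
    have keep: "os (Suc (k + m)) \<in> D j" if "j < i" for j m
    proof (induction m)
      case (Suc m)
      have "D j \<in> \<D>" using D by blast
      then show ?case using opn[of "D j"] Suc cond(1,2)[of "Suc (k + m)"] by simp
    qed (use k that in simp)
    \<comment> \<open>\<open>Suc m\<close> is beyond k and has remainder 2 modulo 3, so
      \<open>P_PHP\<close> moves there. Successor indices are used because \<open>play\<close>
      asserts membership in the conditions for these.\<close>
    define m where "m = 3 * k + 4"
    have m: "Suc (k + (2 * k + 4)) = Suc m" by (simp add: m_def)
    have "Suc m mod 3 = 2" unfolding m_def by presburger
    then have mov: "mover (Suc m) = P_PHP" by (simp add: mover_def)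
    then have next_: "os (Suc (Suc m)) = S (os (Suc m))" using fol unfolding follows_def by blast
    have le: "os (Suc m) \<in> D j" if "j < i" for j using keep[OF that, of "2 * k + 4"] unfolding m .
    have le': "os (Suc (Suc m)) \<in> D j" if "j < i" for j
      using opn[of "D j" "os (Suc m)"] le[OF that] cond[of "Suc m"] D by blast
    show ?case
    proof (cases "os (Suc m) \<in> D i")
      case True
      then have "\<forall>j<Suc i. os (Suc m) \<in> D j" using le by (simp add: less_Suc_eq)
      then show ?thesis by blast
    next
      case False
      \<comment> \<open>All earlier sets are met, so the strategy aims precisely at the missed set
        i.\<close>
      then have "(LEAST i. os (Suc m) \<notin> D i) = i"
        using le by (intro Least_equality) (auto simp: not_less[symmetric])
      then have "os (Suc (Suc m)) \<in> D i" using T[OF cond(1)[of m]] False next_ unfolding T_def by metis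
      then have "\<forall>j<Suc i. os (Suc (Suc m)) \<in> D j" using le' by (simp add: less_Suc_eq)
      then show ?thesis by blast
    qed
  qed simp
  then have "\<forall>os. play M n os \<and> follows P_PHP S os \<longrightarrow> (\<forall>D\<in>\<D>. \<exists>k. os (Suc k) \<in> D)"
    unfolding D by (metis imageE lessI)
  ultimately show ?thesis by blast
qed

context game
begin

section \<open>Conditions and their codes\<close>

lemma prec_eq_rel:
  assumes "l \<in> carr M" "\<And>i r. i \<in> below M l \<Longrightarrow> beta M a b i r \<longleftrightarrow> r = s i"
  shows "prec M (l, s) = rel M l a b"
proof -
  have b: "i \<in> below M l" if "j \<in> below M l" "i \<in> below M j" for i j
    using below_trans[OF assms(1) that(2,1)] .
  have "(\<exists>i\<in>below M j. beta M a b i x \<and> beta M a b j y) \<longleftrightarrow> (\<exists>i\<in>below M j. x = s i \<and> y = s j)"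
    if j: "j \<in> below M l" for x y j
    using assms(2)[OF j, of y] assms(2)[OF b[OF j], of _ x] by blast
  then have "(x, y) \<in> rel M l a b \<longleftrightarrow> (\<exists>j\<in>below M l. \<exists>i\<in>below M j. x = s i \<and> y = s j)" for x y
    unfolding rel_def by simp
  then have "(x, y) \<in> prec M (l, s) \<longleftrightarrow> (x, y) \<in> rel M l a b" for x y
    unfolding prec_def by auto
  then show ?thesis by auto
qed

lemma condition_code:
  assumes "os \<in> conditions M n"
  shows "\<exists>l\<in>carr M. \<exists>a\<in>carr M. \<exists>b\<in>carr M. code M n l a b \<and> prec M os = rel M l a b \<and>
    (\<exists>c. le M l (pow M (len M n) c))"
proof -
  obtain l s where os: "os = (l, s)" by (cases os)
  then obtain a b c where ab: "l \<in> carr M" "a \<in> carr M" "b \<in> carr M" "\<And>i. i \<in> below M l \<Longrightarrow> beta M a b i (s i)"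
    "s ` below M l \<subseteq> below M n" "inj_on s (below M l)" "le M l (pow M (len M n) c)"
    using assms unfolding conditions_def internal_seqs_def by auto
  have s: "r = s i" if "i \<in> below M l" "beta M a b i r" for i r
    using beta_unique[OF ab(2,3) _ that(2) ab(4)[OF that(1)]] that(1) unfolding below_def by blast
  have "code M n l a b"
    unfolding code_def
  proof (intro conjI ballI impI)
    fix i assume "i \<in> below M l"
    then show "\<exists>r\<in>below M n. beta M a b i r" using ab(4,5) by blast
  next
    fix i j r assume ij: "i \<in> below M l" "j \<in> below M l" "beta M a b i r" "beta M a b j r"
    show "i = j" using inj_onD[OF ab(6) _ ij(1,2)] s[OF ij(1,3)] s[OF ij(2,4)] by simp
  qed
  moreover have "prec M os = rel M l a b"
    unfolding os
  proof (rule prec_eq_rel[OF ab(1)])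
    show "beta M a b i r \<longleftrightarrow> r = s i" if "i \<in> below M l" for i r
      using s[OF that, of r] ab(4)[OF that] by metis
  qed
  ultimately show ?thesis using ab by blast
qed

lemma code_condition:
  assumes "l \<in> carr M" "a \<in> carr M" "b \<in> carr M" "code M n l a b" "le M l (pow M (len M n) c)"
  shows "\<exists>os\<in>conditions M n. prec M os = rel M l a b"
proof -
  have "\<forall>i\<in>below M l. \<exists>r. r \<in> below M n \<and> beta M a b i r" using assms(4) unfolding code_def by blast
  then obtain f where f: "\<And>i. i \<in> below M l \<Longrightarrow> f i \<in> below M n \<and> beta M a b i (f i)" by metis
  define s where "s = restrict f (below M l)"
  have s: "s i \<in> below M n" "beta M a b i (s i)" if "i \<in> below M l" for i using f[OF that] that by (simp_all add: s_def)
  have uniq: "r = s i" if "i \<in> below M l" "beta M a b i r" for i r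
    using beta_unique[OF assms(2,3) _ that(2) s(2)[OF that(1)]] that(1) unfolding below_def by blast
  have "inj_on s (below M l)"
  proof (rule inj_onI)
    fix i j assume ij: "i \<in> below M l" "j \<in> below M l" "s i = s j"
    then have "beta M a b i (s i)" "beta M a b j (s i)" using s(2)[of i] s(2)[of j] by auto
    moreover have "s i \<in> carr M" using beta_carr[OF s(2)[OF ij(1)]] .
    ultimately show "i = j" using assms(4) ij(1,2) unfolding code_def by blast
  qed
  moreover have "s \<in> extensional (below M l)" by (simp add: s_def)
  ultimately have "(l, s) \<in> conditions M n"
    using assms(1,2,3,5) s unfolding conditions_def internal_seqs_def by blast
  moreover have "prec M (l, s) = rel M l a b"
  proof (rule prec_eq_rel[OF assms(1)])
    show "beta M a b i r \<longleftrightarrow> r = s i" if "i \<in> below M l" for i r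
      using uniq[OF that, of r] s(2)[OF that] by metis
  qed
  ultimately show ?thesis by blast
qed

text \<open>One family for each step of the truth lemma that is not automatic: atomic
  \<open>Prec\<close> formulas, existential and universal quantifiers. Connectives need none. The
  last family aims at the goal itself.\<close>

definition requirements :: "(('a \<times> 'a) set \<Rightarrow> bool) set" where
  "requirements = {compares x y | x y. x \<in> below M n \<and> y \<in> below M n \<and> x \<noteq> y} \<union>
    {decides_ex t p e | t p e. Sigma_b1 p \<and> adm e} \<union>
    {decides_all t p e | t p e. Sigma_b1 p \<and> adm e} \<union>
    {refutes p u v e | p u v e. Delta_b1 p \<and> adm e \<and> u \<in> carr (cut M n) \<and> v \<in> below M u}"

lemma requirement_mono:
  assumes "Q \<in> requirements" "Q P" "P \<subseteq> P'"
  shows "Q P'"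
proof -
  note f = forces_mono[OF _ assms(3)]
  consider x y where "Q = compares x y" | t p e where "Q = decides_ex t p e"
    | t p e where "Q = decides_all t p e" | p u v e where "Q = refutes p u v e"
    using assms(1) unfolding requirements_def by blast
  then show ?thesis
  proof cases
    case 1
    then show ?thesis using assms(2,3) unfolding compares_def by blast
  next
    case 2
    then show ?thesis using assms(2) f unfolding decides_ex_def by blast
  next
    case 3
    then show ?thesis using assms(2) f unfolding decides_all_def by blast
  next
    case 4
    have "refutes p u v e P" using assms(2) 4 by simp
    then have "refutes p u v e P'" unfolding refutes_def Let_def
      by (elim disjE bexE conjE) (blast intro: f)+
    then show ?thesis using 4 by simp
  qed
qed

lemma requirement_dense:
  assumes "Q \<in> requirements" "o0 \<in> conditions M n"
  shows "\<exists>o1\<in>conditions M n. extends M o1 o0 \<and> Q (prec M o1)"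
proof -
  obtain l a b c where l: "l \<in> carr M" "a \<in> carr M" "b \<in> carr M" "code M n l a b" and
    o0: "prec M o0 = rel M l a b" and c: "le M l (pow M (len M n) c)"
    using condition_code[OF assms(2)] by (elim exE bexE conjE) (rule that; assumption)
  consider x y where "Q = compares x y" "x \<in> below M n" "y \<in> below M n" "x \<noteq> y"
    | t p e where "Q = decides_ex t p e" "Sigma_b1 p" "adm e"
    | t p e where "Q = decides_all t p e" "Sigma_b1 p" "adm e"
    | p u v e where "Q = refutes p u v e" "Delta_b1 p" "adm e" "u \<in> carr (cut M n)" "v \<in> below M u"
    using assms(1) unfolding requirements_def
    by (elim UnE CollectE exE conjE) (rule that; assumption)+
  then have "\<exists>d. extendable M n l a b d (\<lambda>l' a' b'. Q (rel M l' a' b'))"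
  proof cases
    case 1
    then show ?thesis using extend_compares[OF 1(2-4) l] by simp
  next
    case 2
    then show ?thesis using extend_ex[OF 2(2,3) l] by simp
  next
    case 3
    then show ?thesis using extend_all[OF 3(2,3) l] by simp
  next
    case 4
    then show ?thesis using extend_refutes[OF 4(2-5) l] by simp
  qed
  then obtain d l' a' b' where l': "l' \<in> carr M" "a' \<in> carr M" "b' \<in> carr M" "code M n l' a' b'"
    "le M l' (add M l (pow M (len M n) d))" "rel M l a b \<subseteq> rel M l' a' b'" "Q (rel M l' a' b')"
    unfolding extendable_def by (elim exE bexE conjE) (rule that; assumption)
  have "le M l' (pow M (len M n) (c + d + 1))" using length_bound[OF l(1) l'(1) c l'(5)] .
  then obtain o1 where "o1 \<in> conditions M n" "prec M o1 = rel M l' a' b'"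
    using code_condition[OF l'(1-4)] by blast
  then show ?thesis using l'(6,7) o0 unfolding extends_def by (intro bexI[of _ o1]) simp_all
qed

lemma countable_requirements: "countable requirements"
proof (rule countable_subset)
  let ?C = "(\<lambda>z. compares (fst z) (snd z)) ` (carr M \<times> carr M)"
  let ?X = "(\<lambda>z. decides_ex (fst z) (fst (snd z)) (snd (snd z))) ` (UNIV \<times> UNIV \<times> Collect adm)"
  let ?A = "(\<lambda>z. decides_all (fst z) (fst (snd z)) (snd (snd z))) ` (UNIV \<times> UNIV \<times> Collect adm)"
  let ?R = "(\<lambda>z. refutes (fst z) (fst (snd z)) (fst (snd (snd z))) (snd (snd (snd z)))) `
    (UNIV \<times> carr M \<times> carr M \<times> Collect adm)"
  show "countable (?C \<union> ?X \<union> ?A \<union> ?R)"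
    using countable_adm countable_carr by (intro countable_Un countable_image countable_SIGMA) auto
  have 1: "compares x y \<in> ?C" if "x \<in> below M n" "y \<in> below M n" for x y
    by (rule image_eqI[of _ _ "(x, y)"]) (use that in \<open>simp_all add: below_def\<close>)
  have 2: "decides_ex t p e \<in> ?X" "decides_all t p e \<in> ?A" if "adm e" for t p e
    by (rule image_eqI[of _ _ "(t, p, e)"], use that in simp_all)+
  have 3: "refutes p u v e \<in> ?R" if "adm e" "u \<in> carr (cut M n)" "v \<in> below M u" for p u v e
    by (rule image_eqI[of _ _ "(p, u, v, e)"]) (use that in \<open>simp_all add: below_def carr_cut\<close>)
  show "requirements \<subseteq> ?C \<union> ?X \<union> ?A \<union> ?R"
    unfolding requirements_def
    by (intro Un_mono subsetI; elim CollectE exE conjE; hypsubst) (rule 1 2 3; assumption)+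
qed

end

text \<open>What is kept of a play: an increasing chain of coded orders that meets every
  requirement, however the opponents moved.\<close>

locale generic = game +
  fixes P :: "nat \<Rightarrow> ('a \<times> 'a) set"
  assumes mono: "j \<le> k \<Longrightarrow> P j \<subseteq> P k"
    and coded: "\<exists>l\<in>carr M. \<exists>a\<in>carr M. \<exists>b\<in>carr M. code M n l a b \<and> P k = rel M l a b"
    and meets: "Q \<in> requirements \<Longrightarrow> \<exists>k. Q (P k)"
begin

section \<open>The truth lemma: truth in the cut coincides with being forced\<close>

abbreviation forced_eventually :: "(nat \<Rightarrow> 'a) \<Rightarrow> fm \<Rightarrow> bool" where
  "forced_eventually e p \<equiv> \<exists>k. forces M n (P k) e p"

abbreviation true_in_cut :: "(nat \<Rightarrow> 'a) \<Rightarrow> fm \<Rightarrow> bool" where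
  "true_in_cut e p \<equiv> sat (cut M n) (\<Union>k. P k) e p"

definition decided :: "(nat \<Rightarrow> 'a) \<Rightarrow> fm \<Rightarrow> bool" where
  "decided e p \<longleftrightarrow> true_in_cut e p \<and> forced_eventually e p \<or> \<not> true_in_cut e p \<and> forced_eventually e (Neg p)"

lemma total_extension: "\<exists>a\<in>carr M. \<exists>b\<in>carr M. code M n n a b \<and> P k \<subseteq> rel M n a b"
  using coded[of k] code_total by metis

lemma forces_max:
  assumes "forces M n (P j) e p" "forces M n (P k) e' q"
  shows "\<exists>m. forces M n (P m) e p \<and> forces M n (P m) e' q"
  using forces_mono[OF assms(1) mono[of j "max j k"]] forces_mono[OF assms(2) mono[of k "max j k"]] by auto

lemma consistent: "forced_eventually e p \<Longrightarrow> \<not> forced_eventually e (Neg p)"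
proof
  assume "forced_eventually e p" "forced_eventually e (Neg p)"
  then obtain m where m: "forces M n (P m) e p" "forces M n (P m) e (Neg p)" using forces_max by blast
  obtain a b where "a \<in> carr M" "b \<in> carr M" "code M n n a b" "P m \<subseteq> rel M n a b"
    using total_extension by blast
  then show False using m unfolding forces_def by fastforce
qed

lemma decided_iff: "decided e p \<Longrightarrow> true_in_cut e p \<longleftrightarrow> forced_eventually e p"
  using consistent unfolding decided_def by blast

lemma decided_iff_Neg: "decided e p \<Longrightarrow> \<not> true_in_cut e p \<longleftrightarrow> forced_eventually e (Neg p)"
  using consistent unfolding decided_def by blast

text \<open>Distinct points below n are compared at some stage, and asymmetry of coded orders
  excludes the reverse comparison from then on. Any other pair is related by no coded order, so
  every stage forces the negation.\<close>

lemma decided_Prec: "decided e (Prec s t)"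
proof -
  let ?x = "tval M e s" and ?y = "tval M e t"
  have nf: "forces M n (P k) e (Neg (Prec s t))"
    if "\<And>a b. a \<in> carr M \<Longrightarrow> b \<in> carr M \<Longrightarrow> code M n n a b \<Longrightarrow> P k \<subseteq> rel M n a b \<Longrightarrow> (?x, ?y) \<notin> rel M n a b" for k
    using that unfolding forces_def by simp
  show ?thesis
  proof (cases "?x \<in> below M n \<and> ?y \<in> below M n \<and> ?x \<noteq> ?y")
    case True
    then have "compares ?x ?y \<in> requirements" unfolding requirements_def by blast
    then obtain k where "(?x, ?y) \<in> P k \<or> (?y, ?x) \<in> P k" using meets unfolding compares_def by blast
    then show ?thesis
    proof
      assume xy: "(?x, ?y) \<in> P k"
      then have "forces M n (P k) e (Prec s t)" unfolding forces_def by auto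
      then show ?thesis using xy unfolding decided_def by auto
    next
      assume yx: "(?y, ?x) \<in> P k"
      have "(?x, ?y) \<notin> P j" for j
      proof
        assume "(?x, ?y) \<in> P j"
        then have "(?x, ?y) \<in> P (max j k)" "(?y, ?x) \<in> P (max j k)"
          using yx mono[of j "max j k"] mono[of k "max j k"] by auto
        then show False using coded[of "max j k"] rel_asym by metis
      qed
      moreover have "forces M n (P k) e (Neg (Prec s t))" by (rule nf) (use yx rel_asym[OF n_carr] in blast)
      ultimately show ?thesis unfolding decided_def by auto
    qed
  next
    case False
    then have "(?x, ?y) \<notin> P j" for j using coded[of j] rel_field by metis
    moreover have "forces M n (P 0) e (Neg (Prec s t))" by (rule nf) (use False rel_field[OF n_carr] in blast)
    ultimately show ?thesis unfolding decided_def by auto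
  qed
qed

lemma decided_Eq: "decided e (Eq s t)" and decided_Le: "decided e (Le s t)"
  unfolding decided_def forces_def by auto

lemma decided_Neg: "decided e p \<Longrightarrow> decided e (Neg p)"
  unfolding decided_def forces_def by auto

lemma decidedI:
  assumes "true_in_cut e p \<Longrightarrow> forced_eventually e p" "\<not> true_in_cut e p \<Longrightarrow> forced_eventually e (Neg p)"
  shows "decided e p"
  unfolding decided_def using assms by (cases "true_in_cut e p") simp_all

lemma decided_And:
  assumes "decided e p" "decided e q"
  shows "decided e (And p q)"
proof (rule decidedI)
  assume "true_in_cut e (And p q)"
  then obtain j k where "forces M n (P j) e p" "forces M n (P k) e q"
    using decided_iff[OF assms(1)] decided_iff[OF assms(2)] by auto
  then obtain m where "forces M n (P m) e p" "forces M n (P m) e q" using forces_max by blast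
  then have "forces M n (P m) e (And p q)" by (simp add: forces_def)
  then show "forced_eventually e (And p q)" ..
next
  assume "\<not> true_in_cut e (And p q)"
  then obtain k where "forces M n (P k) e (Neg p) \<or> forces M n (P k) e (Neg q)"
    using decided_iff_Neg[OF assms(1)] decided_iff_Neg[OF assms(2)] by auto
  then have "forces M n (P k) e (Neg (And p q))" unfolding forces_def by auto
  then show "forced_eventually e (Neg (And p q))" ..
qed

lemma decided_Or:
  assumes "decided e p" "decided e q"
  shows "decided e (Or p q)"
proof -
  have "decided e (Neg (And (Neg p) (Neg q)))"
    using decided_Neg decided_And assms by blast
  then show ?thesis unfolding decided_def forces_def by simp
qed

lemma decided_Imp:
  assumes "decided e p" "decided e q"
  shows "decided e (Imp p q)"
proof -
  have "decided e (Neg (And p (Neg q)))"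
    using decided_Neg decided_And assms by blast
  then show ?thesis unfolding decided_def forces_def by simp
qed

text \<open>Forcing lets witnesses range over M, truth over the cut. The ranges coincide because w
  \<le> t, the value of t lies in the cut, and the cut is an initial segment of M.\<close>

lemma decided_Exists_le:
  assumes "Sigma_b1 p" "\<And>e. adm e \<Longrightarrow> decided e p" "adm e"
  shows "decided e (Exists_le t p)"
proof -
  have w_cut: "w \<in> carr (cut M n)" if "w \<in> carr M" "le M w (tval M e t)" for w
    using cut_down tval_cut_carr[OF assms(3)] that by blast
  have "decides_ex t p e \<in> requirements" using assms(1,3) unfolding requirements_def by blast
  then obtain k where "decides_ex t p e (P k)" using meets by blast
  then consider "forces M n (P k) e (Neg (Exists_le t p))"
    | w where "w \<in> carr M" "le M w (tval M e t)" "forces M n (P k) (case_nat w e) p"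
    unfolding decides_ex_def by blast
  then show ?thesis
  proof cases
    case 1
    have "\<not> true_in_cut (case_nat w e) p" if w: "w \<in> carr (cut M n)" "le M w (tval M e t)" for w
    proof -
      have "w \<in> carr M" using w(1) by (simp add: carr_cut)
      then have "forces M n (P k) (case_nat w e) (Neg p)"
        using 1 w(2) unfolding forces_def by (auto simp: sat_Exists_le)
      then show ?thesis using decided_iff_Neg assms(2) adm_case_nat[OF assms(3) w(1)] by blast
    qed
    then have "\<not> true_in_cut e (Exists_le t p)" by (auto simp: sat_Exists_le)
    then show ?thesis using 1 unfolding decided_def by blast
  next
    case 2
    then have "forces M n (P k) e (Exists_le t p)" unfolding forces_def by (auto simp: sat_Exists_le)
    moreover have "true_in_cut (case_nat w e) p"
      using 2 w_cut decided_iff assms(2) adm_case_nat[OF assms(3)] by blast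
    then have "true_in_cut e (Exists_le t p)" using w_cut 2 by (auto simp: sat_Exists_le)
    ultimately show ?thesis unfolding decided_def by blast
  qed
qed

lemma decided_Forall_le:
  assumes "Sigma_b1 p" "\<And>e. adm e \<Longrightarrow> decided e p" "adm e"
  shows "decided e (Forall_le (Len t) p)"
proof -
  have w_cut: "w \<in> carr (cut M n)" if "w \<in> carr M" "le M w (len M (tval M e t))" for w
    using cut_down tval_cut_carr[OF assms(3), of "Len t"] that by simp
  have "decides_all t p e \<in> requirements" using assms(1,3) unfolding requirements_def by blast
  then obtain k where "decides_all t p e (P k)" using meets by blast
  then consider "forces M n (P k) e (Forall_le (Len t) p)"
    | w where "w \<in> carr M" "le M w (len M (tval M e t))" "forces M n (P k) (case_nat w e) (Neg p)"
    unfolding decides_all_def by blast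
  then show ?thesis
  proof cases
    case 1
    have "true_in_cut (case_nat w e) p" if w: "w \<in> carr (cut M n)" "le M w (len M (tval M e t))" for w
    proof -
      have "w \<in> carr M" using w(1) by (simp add: carr_cut)
      then have "forces M n (P k) (case_nat w e) p"
        using 1 w(2) unfolding forces_def by (auto simp: sat_Forall_le)
      then show ?thesis using decided_iff assms(2) adm_case_nat[OF assms(3) w(1)] by blast
    qed
    then have "true_in_cut e (Forall_le (Len t) p)" by (auto simp: sat_Forall_le)
    then show ?thesis using 1 unfolding decided_def by blast
  next
    case 2
    then have "forces M n (P k) e (Neg (Forall_le (Len t) p))" unfolding forces_def by (auto simp: sat_Forall_le)
    moreover have "\<not> true_in_cut (case_nat w e) p"
      using 2 w_cut decided_iff_Neg assms(2) adm_case_nat[OF assms(3)] by blast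
    then have "\<not> true_in_cut e (Forall_le (Len t) p)" using w_cut 2 by (auto simp: sat_Forall_le)
    ultimately show ?thesis unfolding decided_def by blast
  qed
qed

lemma decided_sharply_bounded: "sharply_bounded p \<Longrightarrow> adm e \<Longrightarrow> decided e p"
  by (induction arbitrary: e rule: sharply_bounded.induct)
    (blast intro: decided_Eq decided_Le decided_Prec decided_Neg decided_And decided_Or decided_Imp
      decided_Exists_le decided_Forall_le Sigma_b1.intros(1))+

lemma decided_Sigma_b1: "Sigma_b1 p \<Longrightarrow> adm e \<Longrightarrow> decided e p"
  by (induction arbitrary: e rule: Sigma_b1.induct)
    (blast intro: decided_sharply_bounded decided_And decided_Or decided_Exists_le decided_Forall_le)+

lemma goal: "goal_PHP M n (\<Union>k. P k)"
  unfolding goal_PHP_def models_def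
proof (intro allI impI)
  fix p and e :: "nat \<Rightarrow> 'a" assume p: "Delta_b1 p" and e: "range e \<subseteq> carr (cut M n)"
  \<comment> \<open>The given valuation need not be admissible; its values from index
    \<open>fv p\<close> on do not matter for p and are replaced by zero.\<close>
  define e' where "e' = (\<lambda>i. if i < fv p then e i else zero M)"
  have adm: "adm e'" using adm_truncate[OF e, of "fv p"] unfolding e'_def .
  have cong: "true_in_cut (case_nat x (case_nat y e)) p \<longleftrightarrow> true_in_cut (case_nat x (case_nat y e')) p" for x y
    by (rule sat_cong) (simp add: e'_def split: nat.split)
  have iff: "true_in_cut (case_nat x (case_nat y e)) p \<longleftrightarrow> forced_eventually (case_nat x (case_nat y e')) p"
    "\<not> true_in_cut (case_nat x (case_nat y e)) p \<longleftrightarrow> forced_eventually (case_nat x (case_nat y e')) (Neg p)"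
    if "x \<in> carr (cut M n)" "y \<in> carr (cut M n)" for x y
    using decided_iff decided_iff_Neg decided_Sigma_b1[of p] p adm_case_nat[OF adm_case_nat[OF adm that(2)] that(1)]
    unfolding cong Delta_b1_def by blast+
  have cut_below: "x \<in> carr (cut M n)" if "u \<in> carr (cut M n)" "x \<in> below M u" for x u
    using cut_down that unfolding below_def by blast
  show "true_in_cut e (PHP p)"
    unfolding sat_PHP Let_def
  proof (intro ballI impI)
    fix u v assume u: "u \<in> carr (cut M n)" and v: "v \<in> carr (cut M n)" and lt: "le (cut M n) v u \<and> v \<noteq> u"
    have "v \<in> below M u" using lt v by (simp add: below_def carr_cut)
    then have "refutes p u v e' \<in> requirements" using p u adm unfolding requirements_def by blast
    then obtain k where "refutes p u v e' (P k)" using meets by blast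
    then consider
      x where "x \<in> below M u" "\<And>y. y \<in> below M v \<Longrightarrow> forced_eventually (case_nat x (case_nat y e')) (Neg p)"
      | x x' y where "x \<in> below M u" "x' \<in> below M u" "x \<noteq> x'" "y \<in> below M v"
        "forced_eventually (case_nat x (case_nat y e')) p" "forced_eventually (case_nat x' (case_nat y e')) p"
      | x y y' where "x \<in> below M u" "y \<in> below M v" "y' \<in> below M v" "y \<noteq> y'"
        "forced_eventually (case_nat x (case_nat y e')) p" "forced_eventually (case_nat x (case_nat y' e')) p"
      unfolding refutes_def Let_def by blast
    then show "(\<exists>x\<in>carr (cut M n). (le (cut M n) x u \<and> x \<noteq> u) \<and>
          (\<forall>y\<in>carr (cut M n). le (cut M n) y v \<and> y \<noteq> v \<longrightarrow> \<not> true_in_cut (case_nat x (case_nat y e)) p)) \<or>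
        (\<exists>x\<in>carr (cut M n). (le (cut M n) x u \<and> x \<noteq> u) \<and>
          (\<exists>x'\<in>carr (cut M n). (le (cut M n) x' u \<and> x' \<noteq> u) \<and> x \<noteq> x' \<and>
            (\<exists>y\<in>carr (cut M n). (le (cut M n) y v \<and> y \<noteq> v) \<and>
              true_in_cut (case_nat x (case_nat y e)) p \<and> true_in_cut (case_nat x' (case_nat y e)) p))) \<or>
        (\<exists>x\<in>carr (cut M n). (le (cut M n) x u \<and> x \<noteq> u) \<and>
          (\<exists>y\<in>carr (cut M n). (le (cut M n) y v \<and> y \<noteq> v) \<and>
            (\<exists>y'\<in>carr (cut M n). (le (cut M n) y' v \<and> y' \<noteq> v) \<and> y \<noteq> y' \<and>
              true_in_cut (case_nat x (case_nat y e)) p \<and> true_in_cut (case_nat x (case_nat y' e)) p)))"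
    proof cases
      case 1
      note x = cut_below[OF u 1(1)]
      have "\<not> true_in_cut (case_nat x (case_nat y e)) p"
        if y: "y \<in> carr (cut M n)" "le M y v" "y \<noteq> v" for y
      proof -
        have "y \<in> below M v" using y by (simp add: below_def carr_cut)
        then show ?thesis using iff(2)[OF x y(1)] 1(2) by blast
      qed
      then show ?thesis using x 1(1) by (intro disjI1 bexI[of _ x]) (auto simp: below_def)
    next
      case 2
      note c = cut_below[OF u 2(1)] cut_below[OF u 2(2)] cut_below[OF v 2(4)]
      have "true_in_cut (case_nat x (case_nat y e)) p" "true_in_cut (case_nat x' (case_nat y e)) p"
        using iff(1) c 2(5,6) by blast+
      then show ?thesis using c 2(1-4) unfolding below_def cut_simps
        by (intro disjI2 disjI1 bexI[of _ x] conjI bexI[of _ x'] bexI[of _ y]) auto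
    next
      case 3
      note c = cut_below[OF u 3(1)] cut_below[OF v 3(2)] cut_below[OF v 3(3)]
      have "true_in_cut (case_nat x (case_nat y e)) p" "true_in_cut (case_nat x (case_nat y' e)) p"
        using iff(1) c 3(5,6) by blast+
      then show ?thesis using c 3(1-4) unfolding below_def cut_simps
        by (intro disjI2 bexI[of _ x] conjI bexI[of _ y] bexI[of _ y']) auto
    qed
  qed
qed

end

context game
begin

lemma play_generic:
  assumes "play M n os" "\<And>Q. Q \<in> requirements \<Longrightarrow> \<exists>k. Q (prec M (os (Suc k)))"
  shows "generic M n (\<lambda>k. prec M (os (Suc k)))"
proof
  have step: "os (Suc k) \<in> conditions M n" "prec M (os k) \<subseteq> prec M (os (Suc k))" for k
    using assms(1) unfolding play_def extends_def by blast+
  show "prec M (os (Suc j)) \<subseteq> prec M (os (Suc k))" if "j \<le> k" for j k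
    using lift_Suc_mono_le[of "\<lambda>k. prec M (os (Suc k))", OF step(2) that] .
  show "\<exists>l\<in>carr M. \<exists>a\<in>carr M. \<exists>b\<in>carr M. code M n l a b \<and> prec M (os (Suc k)) = rel M l a b" for k
    using condition_code[OF step(1)] by blast
qed (rule assms(2))

lemma winning_strategy: "\<exists>S. strategy M n S \<and> winning M n P_PHP (goal_PHP M n) S"
proof -
  let ?D = "(\<lambda>Q. {x. Q (prec M x)}) ` requirements"
  have "\<exists>S. strategy M n S \<and> (\<forall>os. play M n os \<and> follows P_PHP S os \<longrightarrow> (\<forall>D\<in>?D. \<exists>k. os (Suc k) \<in> D))"
  proof (rule strategy_meeting_all)
    show "countable ?D" using countable_requirements by simp
    fix D o0 o1 assume D: "D \<in> ?D" and o0: "o0 \<in> D" and ext: "extends M o1 o0"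
    obtain Q where Q: "Q \<in> requirements" "D = {x. Q (prec M x)}" using D by blast
    show "o1 \<in> D"
      using requirement_mono[OF Q(1), of "prec M o0" "prec M o1"] o0 ext unfolding Q(2) extends_def by simp
  next
    fix D o0 assume D: "D \<in> ?D" and o0: "o0 \<in> conditions M n"
    then obtain Q where Q: "Q \<in> requirements" "D = {x. Q (prec M x)}" by blast
    show "\<exists>o1\<in>conditions M n. extends M o1 o0 \<and> o1 \<in> D"
      using requirement_dense[OF Q(1) o0] unfolding Q(2) by simp
  qed
  then obtain S where S: "strategy M n S"
    "\<And>os. play M n os \<Longrightarrow> follows P_PHP S os \<Longrightarrow> \<forall>D\<in>?D. \<exists>k. os (Suc k) \<in> D" by auto
  have "goal_PHP M n (outcome M os)" if os: "play M n os" "follows P_PHP S os" for os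
  proof -
    have "\<exists>k. Q (prec M (os (Suc k)))" if Q: "Q \<in> requirements" for Q
      using S(2)[OF os, rule_format, OF imageI[OF Q]] by simp
    then interpret generic M n "\<lambda>k. prec M (os (Suc k))"
      by (rule play_generic[OF os(1)])
    \<comment> \<open>The initial position is contained in the next one, so the union may start
      after the first move.\<close>
    have sub: "prec M (os k) \<subseteq> prec M (os (Suc k))" for k
      using os(1) unfolding play_def extends_def by blast
    have "outcome M os = (\<Union>k. prec M (os (Suc k)))"
    proof
      show "outcome M os \<subseteq> (\<Union>k. prec M (os (Suc k)))" unfolding outcome_def using sub by blast
      show "(\<Union>k. prec M (os (Suc k))) \<subseteq> outcome M os" unfolding outcome_def by blast
    qed
    then show ?thesis using goal by simp
  qed
  then show ?thesis using S(1) unfolding winning_def by blast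
qed

end

theorem theorem3p5:
  fixes M :: "'a arith" and n :: 'a
  assumes "true_arithmetic M" and "countable (carr M)" and "nonstandard_model M"
    and "nonstandard M n"
  shows "\<exists>S. strategy M n S \<and> winning M n P_PHP (goal_PHP M n) S"
proof -
  interpret game M n using assms by unfold_locales
  show ?thesis by (rule winning_strategy)
qed

end
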